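(* Let $0<p\le q<\infty$, $1<q<\infty$, $\omega\in\widehat{\mathcal D}$, $\nu,\eta\in\mathcal D$ and $\mu\in M^+([0,1))$. Then the following conditions are equivalent: (i) $C_{\mu,\omega}:A^p_\nu\to A^q_\eta$ is bounded; (ii) $\|\mu^{(p,q)}_{\omega,\nu,\eta}\|_{L^\infty}:=\sup_{0\le r<1}\frac{\widehat\mu(r)\,\widehat\eta(r)^{\frac1q}}{\widehat\omega(r)\,\widehat\nu(r)^{\frac1p}(1-r)^{1+\frac1p-\frac1q}}<\infty$; (iii) $\|\mu^{(p,q)}_{\omega,\nu,\eta}\|_{\ell^\infty}:=\sup_{n\in\mathbb N_0}\frac{\mu_n\,\eta_n^{\frac1q}(n+1)^{1+\frac1p-\frac1q}}{\omega_n\,\nu_n^{\frac1p}}<\infty$. Moreover, $\|C_{\mu,\omega}\|_{A^p_\nu\to A^q_\eta}\asymp\|\mu^{(p,q)}_{\omega,\nu,\eta}\|_{L^\infty}\asymp\|\mu^{(p,q)}_{\omega,\nu,\eta}\|_{\ell^\infty}$.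
   Context: $\mathcal H(\mathbb D)$ is the space of analytic functions in the unit disc $\mathbb D$. A weight is an integrable function $\omega:\mathbb D\to[0,\infty)$; it is radial if $\omega(z)=\omega(|z|)$. For a radial weight, $\widehat\omega(r)=\int_r^1\omega(s)\,ds$ and $\omega_x=\int_0^1 r^x\omega(r)\,dr$. $\omega\in\widehat{\mathcal D}$ means: $\omega$ is a radial weight, not a.e. zero, and there is $C>1$ with $\widehat\omega(r)\le C\,\widehat\omega\left(\frac{1+r}2\right)$ for all $0\le r<1$. $\omega\in\check{\mathcal D}$ means: $\omega$ is a radial weight and there are $C'>1$, $K>1$ with $\widehat\omega(r)\ge C'\widehat\omega\left(1-\frac{1-r}K\right)$ for all $0\le r<1$. $\mathcal D=\widehat{\mathcal D}\cap\check{\mathcal D}$. $M^+([0,1))$ is the set of finite positive Borel measures on $[0,1)$; $\widehat\mu(r)=\mu([r,1))$, $\mu_x=\int_{[0,1)}r^x\,d\mu(r)$ (with $0^0=1$). Kernel: $B^\omega_t(z)=\sum_{n=0}^\infty\frac{(tz)^n}{2\omega_{2n+1}}$, $0\le t<1$, $z\in\mathbb D$. Operator: $C_{\mu,\omega}(f)(z)=\int_0^1 f(tz)B^\omega_t(z)\,d\mu(t)$ for $f\in\mathcal H(\mathbb D)$. $A^p_\nu$ is the space of $f\in\mathcal H(\mathbb D)$ with $\|f\|_{A^p_\nu}^p=\int_{\mathbb D}|f|^p\nu\,dA<\infty$, $dA$ being normalized area measure. Bounded $X\to Y$ means $\|C_{\mu,\omega}f\|_Y\le C\|f\|_X$ for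 all $f\in X$; the operator norm is the least such $C$ (infinite if unbounded). $A\asymp B$ means $c^{-1}B\le A\le cB$ with $c>0$ independent of $\mu$ (it may depend on $p,q,\omega,\nu,\eta$). *)

theory Defs
  imports "HOL-Complex_Analysis.Complex_Analysis"
begin

abbreviation unit_disc :: "complex set" where
  "unit_disc \<equiv> ball 0 1"

text \<open>Weights are functions on the disc, and only their values there matter; for a radial
  weight \<open>\<omega>\<close> and \<open>0 \<le> s < 1\<close>, the value \<open>\<omega>(s)\<close> is \<open>\<omega> (complex_of_real s)\<close>.\<close>

definition weight :: "(complex \<Rightarrow> real) \<Rightarrow> bool" where
  "weight \<omega> \<longleftrightarrow> (\<forall>z\<in>unit_disc. 0 \<le> \<omega> z) \<and> set_integrable lebesgue unit_disc \<omega>"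

definition radial_weight :: "(complex \<Rightarrow> real) \<Rightarrow> bool" where
  "radial_weight \<omega> \<longleftrightarrow>
     weight \<omega> \<and> (\<forall>z\<in>unit_disc. \<omega> z = \<omega> (complex_of_real (norm z)))"

text \<open>Integrability over the disc does not exclude an infinite integral of \<open>\<omega>(s)\<close> near
  \<open>s = 0\<close>, so the tail integral takes values in \<open>[0,\<infinity>]\<close>. For weights in \<open>D_hat\<close> the defining
  inequality at \<open>r = 0\<close> forces it to be finite everywhere.\<close>

definition weight_tail :: "(complex \<Rightarrow> real) \<Rightarrow> real \<Rightarrow> ennreal" where
  "weight_tail \<omega> r = (\<integral>\<^sup>+ s\<in>{r..<1}. ennreal (\<omega> (complex_of_real s)) \<partial>lebesgue)"

definition weight_moment :: "(complex \<Rightarrow> real) \<Rightarrow> nat \<Rightarrow> real" where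
  "weight_moment \<omega> n = (LINT s:{0..<1}|lebesgue. s ^ n * \<omega> (complex_of_real s))"

definition D_hat :: "(complex \<Rightarrow> real) set" where
  "D_hat = {\<omega>. radial_weight \<omega> \<and>
     \<not> (AE z in lebesgue. z \<in> unit_disc \<longrightarrow> \<omega> z = 0) \<and>
     (\<exists>C::real>1. \<forall>r. 0 \<le> r \<and> r < 1 \<longrightarrow>
        weight_tail \<omega> r \<le> ennreal C * weight_tail \<omega> ((1 + r) / 2))}"

definition D_check :: "(complex \<Rightarrow> real) set" where
  "D_check = {\<omega>. radial_weight \<omega> \<and>
     (\<exists>C::real>1. \<exists>K::real>1. \<forall>r. 0 \<le> r \<and> r < 1 \<longrightarrow>
        weight_tail \<omega> r \<ge> ennreal C * weight_tail \<omega> (1 - (1 - r) / K))}"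

definition D_both :: "(complex \<Rightarrow> real) set" where
  "D_both = D_hat \<inter> D_check"

definition M_plus :: "real measure set" where
  "M_plus = {\<mu>. sets \<mu> = sets (restrict_space borel {0..<1}) \<and> finite_measure \<mu>}"

definition measure_tail :: "real measure \<Rightarrow> real \<Rightarrow> real" where
  "measure_tail \<mu> r = measure \<mu> {r..<1}"

definition measure_moment :: "real measure \<Rightarrow> nat \<Rightarrow> real" where
  "measure_moment \<mu> n = (\<integral>t. t ^ n \<partial>\<mu>)"

definition kernel_B :: "(complex \<Rightarrow> real) \<Rightarrow> real \<Rightarrow> complex \<Rightarrow> complex" where
  "kernel_B \<omega> t z =
     (\<Sum>n. (complex_of_real t * z) ^ n / complex_of_real (2 * weight_moment \<omega> (2 * n + 1)))"

definition C_op ::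
  "real measure \<Rightarrow> (complex \<Rightarrow> real) \<Rightarrow> (complex \<Rightarrow> complex) \<Rightarrow> complex \<Rightarrow> complex" where
  "C_op \<mu> \<omega> f z = (\<integral>t. f (complex_of_real t * z) * kernel_B \<omega> t z \<partial>\<mu>)"

text \<open>The \<open>p\<close>-th power of the norm of \<open>A\<^sup>p\<^sub>\<nu>\<close>; the factor \<open>1 / \<pi>\<close> normalizes the area measure.\<close>

definition bergman_integral ::
  "real \<Rightarrow> (complex \<Rightarrow> real) \<Rightarrow> (complex \<Rightarrow> complex) \<Rightarrow> ennreal" where
  "bergman_integral p \<nu> f =
     ennreal (1 / pi) * (\<integral>\<^sup>+ z\<in>unit_disc. ennreal (norm (f z) powr p * \<nu> z) \<partial>lebesgue)"

definition bergman_space :: "real \<Rightarrow> (complex \<Rightarrow> real) \<Rightarrow> (complex \<Rightarrow> complex) set" where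
  "bergman_space p \<nu> = {f. f holomorphic_on unit_disc \<and> bergman_integral p \<nu> f < \<infinity>}"

definition bergman_norm ::
  "real \<Rightarrow> (complex \<Rightarrow> real) \<Rightarrow> (complex \<Rightarrow> complex) \<Rightarrow> real" where
  "bergman_norm p \<nu> f = enn2real (bergman_integral p \<nu> f) powr (1 / p)"

definition bergman_bound ::
  "((complex \<Rightarrow> complex) \<Rightarrow> complex \<Rightarrow> complex) \<Rightarrow> real \<Rightarrow> (complex \<Rightarrow> real) \<Rightarrow>
   real \<Rightarrow> (complex \<Rightarrow> real) \<Rightarrow> real \<Rightarrow> bool" where
  "bergman_bound T p \<nu> q \<eta> C \<longleftrightarrow> 0 \<le> C \<and>
     (\<forall>f\<in>bergman_space p \<nu>. T f \<in> bergman_space q \<eta> \<and>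
        bergman_norm q \<eta> (T f) \<le> C * bergman_norm p \<nu> f)"

definition bergman_bounded ::
  "((complex \<Rightarrow> complex) \<Rightarrow> complex \<Rightarrow> complex) \<Rightarrow> real \<Rightarrow> (complex \<Rightarrow> real) \<Rightarrow>
   real \<Rightarrow> (complex \<Rightarrow> real) \<Rightarrow> bool" where
  "bergman_bounded T p \<nu> q \<eta> \<longleftrightarrow> (\<exists>C. bergman_bound T p \<nu> q \<eta> C)"

text \<open>For an unbounded operator the infimum is over the empty set, hence equal to \<open>\<infinity>\<close>.\<close>

definition bergman_op_norm ::
  "((complex \<Rightarrow> complex) \<Rightarrow> complex \<Rightarrow> complex) \<Rightarrow> real \<Rightarrow> (complex \<Rightarrow> real) \<Rightarrow>
   real \<Rightarrow> (complex \<Rightarrow> real) \<Rightarrow> ennreal" where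
  "bergman_op_norm T p \<nu> q \<eta> = (INF C\<in>{C. bergman_bound T p \<nu> q \<eta> C}. ennreal C)"

definition mu_L_infty ::
  "real \<Rightarrow> real \<Rightarrow> (complex \<Rightarrow> real) \<Rightarrow> (complex \<Rightarrow> real) \<Rightarrow> (complex \<Rightarrow> real) \<Rightarrow>
   real measure \<Rightarrow> ennreal" where
  "mu_L_infty p q \<omega> \<nu> \<eta> \<mu> = (SUP r\<in>{0..<1}. ennreal
     (measure_tail \<mu> r * enn2real (weight_tail \<eta> r) powr (1 / q) /
      (enn2real (weight_tail \<omega> r) * enn2real (weight_tail \<nu> r) powr (1 / p) *
       (1 - r) powr (1 + 1 / p - 1 / q))))"

definition mu_ell_infty ::
  "real \<Rightarrow> real \<Rightarrow> (complex \<Rightarrow> real) \<Rightarrow> (complex \<Rightarrow> real) \<Rightarrow> (complex \<Rightarrow> real) \<Rightarrow>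
   real measure \<Rightarrow> ennreal" where
  "mu_ell_infty p q \<omega> \<nu> \<eta> \<mu> = (SUP n. ennreal
     (measure_moment \<mu> n * weight_moment \<eta> n powr (1 / q) *
      real (n + 1) powr (1 + 1 / p - 1 / q) /
      (weight_moment \<omega> n * weight_moment \<nu> n powr (1 / p))))"

definition comparable_on :: "'a set \<Rightarrow> ('a \<Rightarrow> ennreal) \<Rightarrow> ('a \<Rightarrow> ennreal) \<Rightarrow> bool" where
  "comparable_on S A B \<longleftrightarrow>
     (\<exists>c::real>0. \<forall>x\<in>S. ennreal (1 / c) * B x \<le> A x \<and> A x \<le> ennreal c * B x)"

end

(* Write G = f B with B(w) = sum w^n / (2 omega_(2n+1)); then B_t(z) = B(t z) and
   C f (z) = int G(t z) d mu(t), so the operator multiplies Taylor coefficients of f B by the moments of mu.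
   All weights enter through their radial tails as functions of y = 1 - r, which are doubling in y.

   Lower bound: f = (y / (1 - (1 - y) z))^gamma has norm at most a multiple of (tau_nu(y) y)^(1/p), while
   C f at the point 1 - y/2 is at least a multiple of mu([1 - y, 1)) / (y tau_omega(y)); the norm of C f
   controls this value because |F(w)|^q is at most (4 / d) times the mean of |F|^q on the circle of radius |w| + d.

   Upper bound: |B(w)| is at most a multiple of 1 / ((1 - |w|) tau_omega(1 - |w|)). On |z| in the N-th
   dyadic shell split the t-integral over the shells k < N and the rest, apply Hoelder with geometric weights,
   average over the circle, and pass from means of order q to means of order p; the decay of tau_eta given by
   D_check makes the remaining double sum a convolution with a geometric sequence, and D_check for nu bounds
   the sum over the shells of tau_nu(2^-k) times the circle means of |f|^p by the norm of f.

   The monotonicity in the radius of the means of |f|^p, also for p < 1, comes from the maximum principle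
   for the finite sums sum_k |f(z zeta^k)|^p over the N-th roots of unity zeta^k. *)
theory Submission
  imports Defs
begin

section \<open>Polar coordinates\<close>

text \<open>Uniformity in \<mu> dictates the form of the estimates: both suprema are read as linear
  inequalities with a finite constant, such as
  \<open>measure_tail \<mu> (1 - y) \<le> M * \<Phi> y\<close> for all y, so that the constants
  depend only on weights and exponents, and infinite values are dealt with once, in
  \<open>ennreal_le_mult_if\<close>. The obstacle is that p may be below 1, where neither a triangle
  inequality nor Hoelder's inequality is available for f. So f is never decomposed; it enters
  through the circle means of |f|^p, their monotonicity and the pointwise bound drawn from it.
  Hoelder is applied in t only, with q > 1. The relation p <= q pays twice: in passing from means of
  order p to order q, and in bounding a sum of powers q/p by the power of the sum. The geometric
  Hoelder weights cost \<beta>^(-(N-k)) between shells k and N, while the tail of \<eta> gains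
  \<kappa>^(N-k). With \<beta> the square root of \<kappa> a convergent factor \<beta>^(N-k) is
  left.\<close>

lemma borel_measurable_Complex [measurable]:
  assumes [measurable]: "f \<in> borel_measurable M" "g \<in> borel_measurable M"
  shows "(\<lambda>x. Complex (f x) (g x)) \<in> borel_measurable M"
  unfolding Complex_eq by measurable

lemma lborel_complex_eq_distr:
  "(lborel :: complex measure) = distr (lborel \<Otimes>\<^sub>M lborel) borel (\<lambda>(x, y). Complex x y)"
proof (rule lborel_eqI)
  have meas: "(\<lambda>(x, y). Complex x y) \<in> borel_measurable (lborel \<Otimes>\<^sub>M lborel)"
    by measurable
  fix l u :: complex
  assume lu: "\<And>b. b \<in> Basis \<Longrightarrow> l \<bullet> b \<le> u \<bullet> b"
  have le: "Re l \<le> Re u" "Im l \<le> Im u" using lu[of 1] lu[of \<i>] by (auto simp: Basis_complex_def)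
  have "(\<lambda>(x, y). Complex x y) -` box l u \<inter> space (lborel \<Otimes>\<^sub>M lborel) = {Re l<..<Re u} \<times> {Im l<..<Im u}"
    by (auto simp: in_box_complex_iff space_pair_measure)
  then show "emeasure (distr (lborel \<Otimes>\<^sub>M lborel) borel (\<lambda>(x, y). Complex x y)) (box l u) = (\<Prod>b\<in>Basis. (u - l) \<bullet> b)"
    using le by (subst emeasure_distr[OF meas]) (auto simp: lborel.emeasure_pair_measure_Times Basis_complex_def
       ennreal_mult[symmetric])
qed simp

lemma nn_integral_lborel_complex:
  fixes F :: "complex \<Rightarrow> ennreal"
  assumes [measurable]: "F \<in> borel_measurable borel"
  shows "(\<integral>\<^sup>+z. F z \<partial>lborel) = (\<integral>\<^sup>+y. \<integral>\<^sup>+x. F (Complex x y) \<partial>lborel \<partial>lborel)"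
    and "(\<integral>\<^sup>+z. F z \<partial>lborel) = (\<integral>\<^sup>+x. \<integral>\<^sup>+y. F (Complex x y) \<partial>lborel \<partial>lborel)"
    and "(\<lambda>(x, y). F (Complex x y)) \<in> borel_measurable (lborel \<Otimes>\<^sub>M lborel)"
proof -
  have meas: "(\<lambda>(x, y). Complex x y) \<in> borel_measurable (lborel \<Otimes>\<^sub>M lborel)"
    by measurable
  from measurable_compose[OF meas assms]
  show m: "(\<lambda>(x, y). F (Complex x y)) \<in> borel_measurable (lborel \<Otimes>\<^sub>M lborel)"
    by (simp add: split_beta)
  have "(\<integral>\<^sup>+z. F z \<partial>lborel) = (\<integral>\<^sup>+z. (case z of (x, y) \<Rightarrow> F (Complex x y)) \<partial>(lborel \<Otimes>\<^sub>M lborel))"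
    by (subst lborel_complex_eq_distr, subst nn_integral_distr[OF meas]) (auto simp: case_prod_unfold)
  then show "(\<integral>\<^sup>+z. F z \<partial>lborel) = (\<integral>\<^sup>+y. \<integral>\<^sup>+x. F (Complex x y) \<partial>lborel \<partial>lborel)"
    and "(\<integral>\<^sup>+z. F z \<partial>lborel) = (\<integral>\<^sup>+x. \<integral>\<^sup>+y. F (Complex x y) \<partial>lborel \<partial>lborel)"
    using lborel_pair.nn_integral_snd[OF m] lborel.nn_integral_fst[OF m] by simp_all
qed

text \<open>A shear translates every line parallel to one axis, so Fubini in the matching order
  reduces the claim to translation invariance on the real line. Shears are the building blocks of
  \<open>nn_integral_rotate\<close>.\<close>

lemma nn_integral_shear:
  fixes F :: "complex \<Rightarrow> ennreal" and a :: real
  assumes [measurable]: "F \<in> borel_measurable borel"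
  shows "(\<integral>\<^sup>+z. F (Complex (Re z + a * Im z) (Im z)) \<partial>lborel) = (\<integral>\<^sup>+z. F z \<partial>lborel)"
    and "(\<integral>\<^sup>+z. F (Complex (Re z) (Im z + a * Re z)) \<partial>lborel) = (\<integral>\<^sup>+z. F z \<partial>lborel)"
proof -
  have m1: "(\<lambda>x. F (Complex x y)) \<in> borel_measurable borel" "(\<lambda>y. F (Complex x y)) \<in> borel_measurable borel" for x y
    by measurable
  show "(\<integral>\<^sup>+z. F (Complex (Re z + a * Im z) (Im z)) \<partial>lborel) = (\<integral>\<^sup>+z. F z \<partial>lborel)"
  proof -
    have "(\<integral>\<^sup>+x. F (Complex (x + a * y) y) \<partial>lborel) = (\<integral>\<^sup>+x. F (Complex x y) \<partial>lborel)" for y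
      using nn_integral_real_affine[OF m1(1)[of y], of 1 "a * y"] by (simp add: add.commute)
    then show ?thesis by (subst (1 2) nn_integral_lborel_complex(1)) simp_all
  qed
  show "(\<integral>\<^sup>+z. F (Complex (Re z) (Im z + a * Re z)) \<partial>lborel) = (\<integral>\<^sup>+z. F z \<partial>lborel)"
  proof -
    have "(\<integral>\<^sup>+y. F (Complex x (y + a * x)) \<partial>lborel) = (\<integral>\<^sup>+y. F (Complex x y) \<partial>lborel)" for x
      using nn_integral_real_affine[OF m1(2)[of x], of 1 "a * x"] by (simp add: add.commute)
    then show ?thesis by (subst (1 2) nn_integral_lborel_complex(2)) simp_all
  qed
qed

text \<open>A rotation other than the half turn is a product of three shears, horizontal, vertical,
  horizontal, with coefficients -tan(angle/2), sin(angle) and -tan(angle/2).\<close>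

lemma nn_integral_rotate:
  fixes F :: "complex \<Rightarrow> ennreal"
  assumes [measurable]: "F \<in> borel_measurable borel" and c: "norm c = 1"
  shows "(\<integral>\<^sup>+z. F (c * z) \<partial>lborel) = (\<integral>\<^sup>+z. F z \<partial>lborel)"
proof -
  have gen: "(\<integral>\<^sup>+z. F (c * z) \<partial>lborel) = (\<integral>\<^sup>+z. F z \<partial>lborel)"
    if F[measurable]: "F \<in> borel_measurable borel" and c: "norm c = 1" and ne: "c \<noteq> -1" for F :: "complex \<Rightarrow> ennreal" and c
  proof -
    define a b where "a = Re c" and "b = Im c"
    have ab: "a\<^sup>2 + b\<^sup>2 = 1" using c unfolding a_def b_def by (metis cmod_power2 one_power2)
    have "a \<noteq> -1" proof
      assume "a = -1" then have "b = 0" using ab by simp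
      with \<open>a = -1\<close> ne show False by (simp add: complex_eq_iff a_def b_def)
    qed
    \<comment> \<open>The tangent of half the angle of c; its pole is the reason for treating c = -1
      apart.\<close>
    define t where "t = b / (1 + a)"
    have t1: "t * (1 + a) = b" using \<open>a \<noteq> -1\<close> by (simp add: t_def)
    have "b * b = (1 - a) * (1 + a)" using ab by (simp add: power2_eq_square algebra_simps)
    then have t2: "b * t = 1 - a" using \<open>a \<noteq> -1\<close> by (simp add: t_def)
    define F1 where "F1 z = F (Complex (Re z + (-t) * Im z) (Im z))" for z
    define F2 where "F2 z = F1 (Complex (Re z) (Im z + b * Re z))" for z
    have "continuous_on UNIV (\<lambda>z. Complex (Re z + (-t) * Im z) (Im z))" "continuous_on UNIV (\<lambda>z. Complex (Re z) (Im z + b * Re z))"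
      by (auto simp: Complex_eq intro!: continuous_intros)
    then have [measurable]: "F1 \<in> borel_measurable borel" "F2 \<in> borel_measurable borel"
      unfolding F2_def F1_def by measurable
    have "F (c * z) = F2 (Complex (Re z + (-t) * Im z) (Im z))" for z
    proof -
      have e1: "Im z + b * (Re z - t * Im z) = b * Re z + a * Im z" 
      proof -
        have "Im z + b * (Re z - t * Im z) = b * Re z + (1 - b * t) * Im z" by (simp add: algebra_simps)
        then show ?thesis using t2 by simp
      qed
      have "Re z - t * Im z - t * (b * Re z + a * Im z) = Re z * (1 - b * t) - (t * (1 + a)) * Im z"
        by (simp add: algebra_simps)
      also have "\<dots> = a * Re z - b * Im z" using t1 t2 by simp
      finally have e2: "Re z - t * Im z - t * (b * Re z + a * Im z) = a * Re z - b * Im z" .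
      have "c * z = Complex (a * Re z - b * Im z) (b * Re z + a * Im z)"
        by (simp add: complex_eq_iff a_def b_def)
      then show ?thesis unfolding F2_def F1_def using e1 e2 by simp
    qed
    then have "(\<integral>\<^sup>+z. F (c * z) \<partial>lborel) = (\<integral>\<^sup>+z. F2 (Complex (Re z + (-t) * Im z) (Im z)) \<partial>lborel)" by simp
    also have "\<dots> = (\<integral>\<^sup>+z. F2 z \<partial>lborel)" by (rule nn_integral_shear) simp
    also have "\<dots> = (\<integral>\<^sup>+z. F1 z \<partial>lborel)" unfolding F2_def by (rule nn_integral_shear) simp
    also have "\<dots> = (\<integral>\<^sup>+z. F z \<partial>lborel)" unfolding F1_def by (rule nn_integral_shear) simp
    finally show ?thesis .
  qed
  show ?thesis
  proof (cases "c = -1")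
    \<comment> \<open>The half turn is two quarter turns, each covered by
      \<open>gen\<close>.\<close>
    case True
    have "(\<integral>\<^sup>+z. F (\<i> * (\<i> * z)) \<partial>lborel) = (\<integral>\<^sup>+z. F (\<i> * z) \<partial>lborel)"
      by (rule gen[where F="\<lambda>z. F (\<i> * z)"]) (auto simp: complex_eq_iff)
    also have "\<dots> = (\<integral>\<^sup>+z. F z \<partial>lborel)" by (rule gen) (auto simp: complex_eq_iff)
    finally show ?thesis using True by (simp flip: mult.assoc)
  qed (use gen assms in auto)
qed

text \<open>Measures on the line that are finite and equal on all right half-lines coincide. The
  push-forward of area on the disc under the norm and the density 2 \<pi> s on (0,1) both give \<pi>
  (1 - x^2) to the half-line beyond x in [0,1), by the area of discs.\<close>

lemma nn_integral_ball_norm: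
  fixes k :: "real \<Rightarrow> ennreal"
  assumes [measurable]: "k \<in> borel_measurable borel"
  shows "(\<integral>\<^sup>+z\<in>ball (0::complex) 1. k (norm z) \<partial>lborel) = (\<integral>\<^sup>+s\<in>{0<..<1}. ennreal (2 * pi * s) * k s \<partial>lborel)"
proof -
  have [measurable]: "ball (0::complex) 1 \<in> sets borel" by simp
  define M where "M = distr (density lborel (indicator (ball (0::complex) 1))) borel norm"
  define N where "N = density lborel (\<lambda>s. ennreal (2 * pi * s) * indicator {0<..<1::real} s)"
  have N: "emeasure N {x<..} = (if x \<ge> 1 then 0 else ennreal (pi * (1 - (max x 0)\<^sup>2)))" for x
  proof -
    have "emeasure N {x<..} = (\<integral>\<^sup>+s. ennreal (2 * pi * s) * indicator {0<..<1::real} s * indicator {x<..} s \<partial>lborel)"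
      unfolding N_def by (simp add: emeasure_density)
    also have "\<dots> = (if x \<ge> 1 then 0 else ennreal (pi * (1 - (max x 0)\<^sup>2)))"
    proof (cases "x \<ge> 1")
      case True
      then have "(\<lambda>s. ennreal (2 * pi * s) * indicator {0<..<1::real} s * indicator {x<..} s) = (\<lambda>_. 0)"
        by (auto simp: indicator_def)
      then show ?thesis using True by simp
    next
      case False
      have "(\<integral>\<^sup>+s. ennreal (2 * pi * s) * indicator {0<..<1::real} s * indicator {x<..} s \<partial>lborel)
         = (\<integral>\<^sup>+s. ennreal (2 * pi * s) * indicator {max x 0..1::real} s \<partial>lborel)"
      proof (rule nn_integral_cong_AE)
        have "AE s in lborel. s \<noteq> max x 0 \<and> s \<noteq> (1::real)" by (intro AE_conjI AE_lborel_singleton)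
        then show "AE s in lborel. ennreal (2 * pi * s) * indicator {0<..<1::real} s * indicator {x<..} s =
           ennreal (2 * pi * s) * indicator {max x 0..1::real} s"
          by eventually_elim (auto simp: indicator_def)
      qed
      also have "\<dots> = ennreal (pi * 1\<^sup>2 - pi * (max x 0)\<^sup>2)"
        by (rule nn_integral_FTC_Icc) (use False in \<open>auto intro!: derivative_eq_intros\<close>)
      finally show ?thesis using False by (simp add: algebra_simps)
    qed
    finally show ?thesis .
  qed
  have "M = N"
  proof (rule measure_eqI_lessThan)
    fix x :: real
    have "emeasure M {x<..} = emeasure (density lborel (indicator (ball (0::complex) 1))) {z. x < norm z}"
      unfolding M_def by (subst emeasure_distr) (auto simp: vimage_def)
    also have "\<dots> = emeasure lborel (ball (0::complex) 1 \<inter> {z. x < norm z})"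
      by (subst emeasure_density) (auto simp flip: nn_integral_indicator indicator_inter_arith)
    also have "\<dots> = (if x \<ge> 1 then 0 else ennreal (pi * (1 - (max x 0)\<^sup>2)))"
    proof (cases "x \<ge> 0")
      case False
      then have e: "ball (0::complex) 1 \<inter> {z. x < norm z} = ball 0 1" 
        using less_le_trans[OF _ norm_ge_zero, of x] by auto
      show ?thesis unfolding e using False by (simp add: emeasure_ball unit_ball_vol_2)
    next
      case True
      show ?thesis
      proof (cases "x \<ge> 1")
        case True
        then have e: "ball (0::complex) 1 \<inter> {z. x < norm z} = {}" by auto
        show ?thesis unfolding e using True by simp
      next
        case False
        have e: "ball (0::complex) 1 \<inter> {z. x < norm z} = ball 0 1 - cball 0 x" by auto
        have "cball 0 x \<subseteq> ball (0::complex) 1" using False by auto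
        then have "emeasure lborel (ball 0 1 - cball (0::complex) x) = emeasure lborel (ball (0::complex) 1) - emeasure lborel (cball (0::complex) x)"
          by (intro emeasure_Diff) (use \<open>x \<ge> 0\<close> in \<open>auto simp: emeasure_cball\<close>)
        also have "\<dots> = ennreal (pi - pi * x\<^sup>2)" using \<open>x \<ge> 0\<close>
          by (simp add: emeasure_ball emeasure_cball unit_ball_vol_2 ennreal_minus)
        finally show ?thesis unfolding e using \<open>x \<ge> 0\<close> False by (simp add: algebra_simps)
      qed
    qed
    finally have *: "emeasure M {x<..} = (if x \<ge> 1 then 0 else ennreal (pi * (1 - (max x 0)\<^sup>2)))" .
    show "emeasure M {x<..} = emeasure N {x<..}" using * N by simp
    show "emeasure M {x<..} < \<infinity>" unfolding * by simp
  qed (auto simp: M_def N_def)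
  have "(\<integral>\<^sup>+z\<in>ball (0::complex) 1. k (norm z) \<partial>lborel) = (\<integral>\<^sup>+s. k s \<partial>M)"
  proof -
    have [measurable]: "ball (0::complex) 1 \<in> sets borel" by simp
    show ?thesis unfolding M_def by (subst nn_integral_distr) (auto simp: nn_integral_density mult.commute)
  qed
  also have "\<dots> = (\<integral>\<^sup>+s\<in>{0<..<1}. ennreal (2 * pi * s) * k s \<partial>lborel)"
    unfolding \<open>M = N\<close> N_def by (subst nn_integral_density) (auto simp: mult_ac)
  finally show ?thesis .
qed

text \<open>The part of the shifted interval beyond 2 \<pi> is moved back by one period and fills
  the gap at the left end; since a is at most one period, a single cut suffices.\<close>

lemma nn_integral_periodic_shift:
  fixes h :: "real \<Rightarrow> ennreal"
  assumes [measurable]: "h \<in> borel_measurable borel" and per: "\<And>x. h (x + 2 * pi) = h x" and a: "0 \<le> a" "a \<le> 2 * pi"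
  shows "(\<integral>\<^sup>+x\<in>{0..2*pi}. h (x + a) \<partial>lborel) = (\<integral>\<^sup>+x\<in>{0..2*pi}. h x \<partial>lborel)"
proof -
  have cl: "(\<integral>\<^sup>+x\<in>{u..v}. h (x + d) \<partial>lborel) = (\<integral>\<^sup>+x\<in>{u+d..v+d}. h x \<partial>lborel)" for u v d :: real
  proof -
    have "(\<integral>\<^sup>+x\<in>{u+d..v+d}. h x \<partial>lborel) = (\<integral>\<^sup>+x. h (x + d) * indicator {u+d..v+d} (x + d) \<partial>lborel)"
      using nn_integral_real_affine[of "\<lambda>x. h x * indicator {u+d..v+d} x" 1 d] by (simp add: add.commute)
    then show ?thesis by (simp add: indicator_def)
  qed
  have sp: "(\<integral>\<^sup>+x\<in>{u..w}. h x \<partial>lborel) = (\<integral>\<^sup>+x\<in>{u..v}. h x \<partial>lborel) + (\<integral>\<^sup>+x\<in>{v..w}. h x \<partial>lborel)"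
    if "u \<le> v" "v \<le> w" for u v w :: real
  proof -
    have "(\<integral>\<^sup>+x\<in>{u..w}. h x \<partial>lborel) = (\<integral>\<^sup>+x. h x * indicator {u..v} x + h x * indicator {v..w} x \<partial>lborel)"
    proof (rule nn_integral_cong_AE)
      show "AE x in lborel. h x * indicator {u..w} x = h x * indicator {u..v} x + h x * indicator {v..w} x"
        using AE_lborel_singleton[of v] by eventually_elim (use that in \<open>auto simp: indicator_def\<close>)
    qed
    then show ?thesis by (simp add: nn_integral_add)
  qed
  have "(\<integral>\<^sup>+x\<in>{0..2*pi}. h (x + a) \<partial>lborel) = (\<integral>\<^sup>+x\<in>{a..2*pi + a}. h x \<partial>lborel)" using cl[where d=a and u=0 and v="2*pi"] by simp
  also have "\<dots> = (\<integral>\<^sup>+x\<in>{a..2*pi}. h x \<partial>lborel) + (\<integral>\<^sup>+x\<in>{2*pi..2*pi + a}. h x \<partial>lborel)"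
    using a by (intro sp) auto
  also have "(\<integral>\<^sup>+x\<in>{2*pi..2*pi + a}. h x \<partial>lborel) = (\<integral>\<^sup>+x\<in>{0..a}. h x \<partial>lborel)"
    using cl[where d="2*pi" and u=0 and v=a] by (simp add: per add.commute)
  also have "(\<integral>\<^sup>+x\<in>{a..2*pi}. h x \<partial>lborel) + (\<integral>\<^sup>+x\<in>{0..a}. h x \<partial>lborel) = (\<integral>\<^sup>+x\<in>{0..2*pi}. h x \<partial>lborel)"
    using sp[of 0 a "2*pi"] a by (simp add: add.commute)
  finally show ?thesis .
qed

lemma cis_borel [measurable]: "cis \<in> borel_measurable borel"
  by (intro borel_measurable_continuous_onI continuous_intros)

lemma nn_integral_circle_rotate:
  fixes F :: "complex \<Rightarrow> ennreal"
  assumes [measurable]: "F \<in> borel_measurable borel"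
  shows "(\<integral>\<^sup>+\<theta>\<in>{0..2*pi}. F (cis \<theta> * z) \<partial>lborel) = (\<integral>\<^sup>+\<theta>\<in>{0..2*pi}. F (of_real (norm z) * cis \<theta>) \<partial>lborel)"
proof -
  have z: "z = of_real (norm z) * cis (Arg2pi z)" 
    using Arg2pi_eq[of z] by (simp add: cis_conv_exp)
  have "(\<integral>\<^sup>+\<theta>\<in>{0..2*pi}. F (cis \<theta> * z) \<partial>lborel) = (\<integral>\<^sup>+\<theta>\<in>{0..2*pi}. F (of_real (norm z) * cis (\<theta> + Arg2pi z)) \<partial>lborel)"
    by (subst z) (simp add: cis_mult[symmetric] mult_ac)
  also have "\<dots> = (\<integral>\<^sup>+\<theta>\<in>{0..2*pi}. F (of_real (norm z) * cis \<theta>) \<partial>lborel)"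
    using Arg2pi[of z] by (intro nn_integral_periodic_shift[where h="\<lambda>\<theta>. F (of_real (norm z) * cis \<theta>)"])
      (auto simp flip: cis_mult)
  finally show ?thesis .
qed

text \<open>Rotation invariance of area lets F be averaged over all rotations about 0. By
  \<open>nn_integral_circle_rotate\<close> this average depends on \<open>norm z\<close> alone, and
  integrals of radial functions are given by \<open>nn_integral_ball_norm\<close>.\<close>

theorem polar_coordinates:
  fixes F :: "complex \<Rightarrow> ennreal"
  assumes F[measurable]: "F \<in> borel_measurable borel"
  shows "(\<integral>\<^sup>+z\<in>ball 0 1. F z \<partial>lborel) =
    (\<integral>\<^sup>+s\<in>{0<..<1}. ennreal s * (\<integral>\<^sup>+\<theta>\<in>{0..2*pi}. F (of_real s * cis \<theta>) \<partial>lborel) \<partial>lborel)"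
proof -
  have [measurable]: "ball (0::complex) 1 \<in> sets borel" by simp
  define J where "J = (\<integral>\<^sup>+z\<in>ball 0 1. F z \<partial>lborel)"
  \<comment> \<open>J is constant in the angle, so it can be integrated over a full turn, and F can
    then be rotated by the angle of integration. The factor 2 \<pi> cancels at the end.\<close>
  have "ennreal (2 * pi) * J = (\<integral>\<^sup>+\<theta>\<in>{0..2*pi}. J \<partial>lborel)"
    by (subst nn_integral_cmult_indicator) (auto simp: mult.commute)
  also have "\<dots> = (\<integral>\<^sup>+\<theta>. (\<integral>\<^sup>+z. F (cis \<theta> * z) * indicator (ball 0 1) z * indicator {0..2*pi} \<theta> \<partial>lborel) \<partial>lborel)"
  proof (intro nn_integral_cong)
    fix \<theta> :: real
    have "J = (\<integral>\<^sup>+z. F (cis \<theta> * z) * indicator (ball 0 1) (cis \<theta> * z) \<partial>lborel)"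
      unfolding J_def by (subst nn_integral_rotate[of _ "cis \<theta>"]) auto
    also have "\<dots> = (\<integral>\<^sup>+z. F (cis \<theta> * z) * indicator (ball 0 1) z \<partial>lborel)"
      by (intro nn_integral_cong) (auto simp: indicator_def norm_mult)
    finally show "J * indicator {0..2*pi} \<theta> = (\<integral>\<^sup>+z. F (cis \<theta> * z) * indicator (ball 0 1) z * indicator {0..2*pi} \<theta> \<partial>lborel)"
      by (subst nn_integral_multc) auto
  qed
  also have "\<dots> = (\<integral>\<^sup>+z. (\<integral>\<^sup>+\<theta>. F (cis \<theta> * z) * indicator (ball 0 1) z * indicator {0..2*pi} \<theta> \<partial>lborel) \<partial>lborel)"
    by (subst lborel_pair.Fubini') auto
  also have "\<dots> = (\<integral>\<^sup>+z. (\<integral>\<^sup>+\<theta>\<in>{0..2*pi}. F (of_real (norm (z::complex)) * cis \<theta>) \<partial>lborel) * indicator (ball 0 1) z \<partial>lborel)"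
  proof (rule nn_integral_cong)
    fix z :: complex
    show "(\<integral>\<^sup>+\<theta>. F (cis \<theta> * z) * indicator (ball 0 1) z * indicator {0..2*pi} \<theta> \<partial>lborel) =
      (\<integral>\<^sup>+\<theta>\<in>{0..2*pi}. F (of_real (norm z) * cis \<theta>) \<partial>lborel) * indicator (ball 0 1) z"
      unfolding nn_integral_circle_rotate[OF F, symmetric]
      by (subst nn_integral_multc[symmetric], measurable) (simp add: mult_ac)
  qed
  also have "\<dots> = (\<integral>\<^sup>+s\<in>{0<..<1}. ennreal (2 * pi * s) * (\<integral>\<^sup>+\<theta>\<in>{0..2*pi}. F (of_real s * cis \<theta>) \<partial>lborel) \<partial>lborel)"
    by (rule nn_integral_ball_norm) simp
  also have "\<dots> = ennreal (2 * pi) * (\<integral>\<^sup>+s\<in>{0<..<1}. ennreal s * (\<integral>\<^sup>+\<theta>\<in>{0..2*pi}. F (of_real s * cis \<theta>) \<partial>lborel) \<partial>lborel)"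
    by (subst nn_integral_cmult[symmetric], simp) (auto intro!: nn_integral_cong simp: ennreal_mult' mult_ac indicator_def)
  finally show ?thesis unfolding J_def by (simp add: ennreal_mult_cancel_left)
qed

section \<open>Radial profiles of weights\<close>

text \<open>A Borel representative of \<open>s \<mapsto> \<omega>(s)\<close>, set to \<open>0\<close> outside \<open>(0,1)\<close>; with this convention
  \<open>tail_mass g y\<close> is defined for all \<open>y\<close> and constant for \<open>y \<ge> 1\<close>, which makes its doubling global.\<close>

definition radial_profile :: "(complex \<Rightarrow> real) \<Rightarrow> (real \<Rightarrow> real) \<Rightarrow> bool" where
  "radial_profile \<omega> g \<longleftrightarrow> g \<in> borel_measurable borel \<and> (\<forall>s. 0 \<le> g s) \<and>
     (\<forall>s. s \<notin> {0<..<1} \<longrightarrow> g s = 0) \<and>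
     (AE s in lborel. s \<in> {0<..<1} \<longrightarrow> \<omega> (complex_of_real s) = g s) \<and>
     (AE z in lborel. z \<in> ball 0 1 \<longrightarrow> \<omega> z = g (norm z))"

text \<open>The polar integral of the indicator of N vanishes and the density s is positive on
  (0,1), so the inner integral vanishes for almost every s. This lets an almost everywhere identity
  in the disc be read on almost every circle.\<close>

lemma AE_polar:
  assumes N: "N \<in> null_sets (lborel :: complex measure)"
  shows "AE s in lborel. s \<in> {0<..<1} \<longrightarrow> (AE \<theta> in lborel. \<theta> \<in> {0..2*pi} \<longrightarrow> of_real s * cis \<theta> \<notin> N)"
proof -
  have [measurable]: "N \<in> sets borel" using N by auto
  define k where "k s = (\<integral>\<^sup>+\<theta>\<in>{0..2*pi}. indicator N (of_real s * cis \<theta>) \<partial>lborel)" for s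
  have k[measurable]: "k \<in> borel_measurable borel" unfolding k_def by measurable
  have "(\<integral>\<^sup>+z\<in>ball 0 1. indicator N z \<partial>lborel) \<le> (\<integral>\<^sup>+z. indicator N z \<partial>lborel)"
    by (intro nn_integral_mono) (auto simp: indicator_def)
  also have "\<dots> = 0" using N by (simp add: null_setsD1)
  finally have "(\<integral>\<^sup>+s\<in>{0<..<1}. ennreal s * k s \<partial>lborel) = 0"
    unfolding k_def by (subst polar_coordinates[symmetric]) auto
  then have "AE s in lborel. ennreal s * k s * indicator {0<..<1} s = 0"
    by (subst nn_integral_0_iff_AE[symmetric]) auto
  then show ?thesis
  proof eventually_elim
    case (elim s)
    show ?case
    proof
      assume s: "s \<in> {0<..<1}"
      then have "k s = 0" using elim by simp
      then have "AE \<theta> in lborel. indicator N (of_real s * cis \<theta>) * indicator {0..2*pi} \<theta> = (0::ennreal)"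
        unfolding k_def by (subst nn_integral_0_iff_AE[symmetric]) auto
      then show "AE \<theta> in lborel. \<theta> \<in> {0..2*pi} \<longrightarrow> of_real s * cis \<theta> \<notin> N"
        by eventually_elim (auto simp: indicator_def split: if_splits)
    qed
  qed
qed

text \<open>The converse passage, from radii to the disc: by \<open>nn_integral_ball_norm\<close>
  the points whose modulus lies in a null set form a null set. The centre is excepted because the
  hypothesis concerns (0,1).\<close>

lemma AE_norm:
  assumes "AE s in lborel. s \<in> {0<..<1} \<longrightarrow> P s"
  shows "AE z in lborel. z \<in> ball (0::complex) 1 \<longrightarrow> z \<noteq> 0 \<longrightarrow> P (norm z)"
proof -
  from assms obtain Z where Z: "Z \<in> null_sets lborel" "{s \<in> space lborel. \<not> (s \<in> {0<..<1} \<longrightarrow> P s)} \<subseteq> Z"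
    by (auto simp: eventually_ae_filter)
  have [measurable]: "Z \<in> sets borel" using Z by auto
  have [measurable]: "ball (0::complex) 1 \<in> sets borel" by simp
  have "(\<integral>\<^sup>+s\<in>{0<..<1}. ennreal (2 * pi * s) * indicator Z s \<partial>lborel) = 0"
  proof (subst nn_integral_0_iff_AE)
    show "AE s in lborel. ennreal (2 * pi * s) * indicator Z s * indicator {0<..<1} s = 0"
      using AE_not_in[OF Z(1)] by eventually_elim auto
  qed simp
  then have "(\<integral>\<^sup>+z\<in>ball (0::complex) 1. indicator Z (norm z) \<partial>lborel) = 0"
    by (subst nn_integral_ball_norm) auto
  then have "AE z in lborel. indicator Z (norm z) * indicator (ball (0::complex) 1) z = (0::ennreal)"
    by (subst nn_integral_0_iff_AE[symmetric]) auto
  then show ?thesis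
  proof eventually_elim
    case (elim z)
    show ?case
    proof (intro impI)
      assume z: "z \<in> ball 0 1" "z \<noteq> 0"
      then have "norm z \<notin> Z" using elim by (auto simp: indicator_def split: if_splits)
      moreover have "norm z \<in> {0<..<1}" using z by simp
      ultimately show "P (norm z)" using subsetD[OF Z(2), of "norm z"] by auto
    qed
  qed
qed

lemma radial_weightD:
  assumes "radial_weight \<omega>"
  shows "z \<in> unit_disc \<Longrightarrow> 0 \<le> \<omega> z" "z \<in> unit_disc \<Longrightarrow> \<omega> z = \<omega> (complex_of_real (norm z))"
    and "integrable lebesgue (\<lambda>z. indicator unit_disc z *\<^sub>R \<omega> z)"
  using assms unfolding radial_weight_def weight_def set_integrable_def by blast+

text \<open>Averaging a Borel representative of \<open>\<omega>\<close> over circles makes it radial and shows that the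
  profile of \<open>\<omega>\<close> is Lebesgue measurable.\<close>

lemma radial_weight_profile:
  assumes "radial_weight \<omega>"
  shows "\<exists>g. radial_profile \<omega> g"
proof -
  define u where "u z = indicator (ball 0 1) z * \<omega> z" for z
  note nonneg = radial_weightD(1)[OF assms] and rad = radial_weightD(2)[OF assms]
  have int: "integrable lebesgue u"
    using radial_weightD(3)[OF assms] unfolding u_def by simp
  obtain v where v[measurable]: "v \<in> borel_measurable lborel" and uv: "AE z in lborel. u z = v z"
    using completion_ex_borel_measurable_real[of u lborel] int by auto
  from uv obtain N where N: "N \<in> null_sets lborel" "{z \<in> space lborel. u z \<noteq> v z} \<subseteq> N"
    by (auto simp: eventually_ae_filter)
  define h where "h s = (\<integral>\<^sup>+\<theta>\<in>{0..2*pi}. ennreal (v (of_real s * cis \<theta>)) \<partial>lborel)" for s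
  define g where "g s = (if s \<in> {0<..<1} then enn2real (h s) / (2 * pi) else 0)" for s
  have h[measurable]: "h \<in> borel_measurable borel" unfolding h_def by measurable
  have [measurable]: "g \<in> borel_measurable borel" unfolding g_def by measurable
  have g: "AE s in lborel. s \<in> {0<..<1} \<longrightarrow> \<omega> (of_real s) = g s"
    using AE_polar[OF N(1)]
  proof eventually_elim
    case (elim s)
    show ?case
    proof
      assume s: "s \<in> {0<..<1}"
      \<comment> \<open>On such a circle v agrees with \<omega> at almost all angles, and \<omega>
        is constant there by radiality, so h s is 2 \<pi> times that constant.\<close>
      have "AE \<theta> in lborel. \<theta> \<in> {0..2*pi} \<longrightarrow> of_real s * cis \<theta> \<notin> N" using elim s by auto
      then have "h s = (\<integral>\<^sup>+\<theta>. ennreal (\<omega> (of_real s)) * indicator {0..2*pi} \<theta> \<partial>lborel)"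
        unfolding h_def
      proof (intro nn_integral_cong_AE, eventually_elim)
        fix \<theta> assume *: "\<theta> \<in> {0..2*pi} \<longrightarrow> of_real s * cis \<theta> \<notin> N"
        have "of_real s * cis \<theta> \<in> ball 0 1" using s by (auto simp: norm_mult)
        then have "u (of_real s * cis \<theta>) = \<omega> (of_real s)" unfolding u_def
          using rad[of "of_real s * cis \<theta>"] s by (auto simp: norm_mult)
        moreover have "w \<notin> N \<Longrightarrow> u w = v w" for w using N(2) by (auto simp: subset_iff)
        ultimately show "ennreal (v (of_real s * cis \<theta>)) * indicator {0..2*pi} \<theta> = ennreal (\<omega> (of_real s)) * indicator {0..2*pi} \<theta>"
          using * by (auto simp: indicator_def)
      qed
      also have "\<dots> = ennreal (\<omega> (of_real s)) * ennreal (2 * pi)"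
        by (subst nn_integral_cmult_indicator) auto
      also have "\<dots> = ennreal (\<omega> (of_real s) * (2 * pi))"
        using s nonneg[of "of_real s"] by (subst ennreal_mult) auto
      finally show "\<omega> (of_real s) = g s" using s nonneg[of "of_real s"] unfolding g_def by simp
    qed
  qed
  have "AE z in lborel. z \<in> ball (0::complex) 1 \<longrightarrow> z \<noteq> 0 \<longrightarrow> \<omega> (of_real (norm z)) = g (norm z)"
    using AE_norm[OF g] .
  moreover have "AE z in lborel. z \<noteq> (0::complex)" by (rule AE_lborel_singleton)
  ultimately have "AE z in lborel. z \<in> ball 0 1 \<longrightarrow> \<omega> z = g (norm z)"
  proof eventually_elim
    case (elim z)
    then show ?case using rad[of z] by (auto simp del: mem_ball)
  qed
  with g show ?thesis unfolding radial_profile_def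
    by (intro exI[of _ g]) (auto simp: g_def[abs_def])
qed

text \<open>The p-th power of the integral mean M_p(s, f), without the root and with values in
  [0,\<infinity>], so that p < 1 needs no separate treatment and no integrability has to be carried
  along.\<close>

definition circle_mean :: "real \<Rightarrow> (complex \<Rightarrow> complex) \<Rightarrow> real \<Rightarrow> ennreal" where
  "circle_mean p f s = ennreal (1 / (2 * pi)) *
     (\<integral>\<^sup>+\<theta>\<in>{0..2*pi}. ennreal (norm (f (of_real s * cis \<theta>)) powr p) \<partial>lborel)"

text \<open>A function on the disc is arbitrary outside it, so only its cut-off version is Borel on
  the whole plane. The auxiliary f' in later proofs is always this extension.\<close>

lemma borel_measurable_disc_extension:
  fixes f :: "complex \<Rightarrow> complex"
  assumes "continuous_on (ball 0 1) f"
  shows "(\<lambda>z. indicator (ball 0 1) z *\<^sub>R f z) \<in> borel_measurable borel"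
  by (rule borel_measurable_continuous_on_indicator[OF _ assms]) simp

lemma circle_mean_measurable:
  assumes f: "continuous_on (ball 0 1) f"
  shows "(\<lambda>s. circle_mean p f s * indicator {0<..<1} s) \<in> borel_measurable borel"
proof -
  define f' where "f' z = indicator (ball 0 1) z *\<^sub>R f z" for z
  have [measurable]: "f' \<in> borel_measurable borel" using borel_measurable_disc_extension[OF f] unfolding f'_def .
  have "(\<lambda>s. circle_mean p f s * indicator {0<..<1} s) = (\<lambda>s. circle_mean p f' s * indicator {0<..<1} s)"
    unfolding circle_mean_def f'_def by (auto simp: norm_mult indicator_def fun_eq_iff)
  also have "\<dots> \<in> borel_measurable borel" unfolding circle_mean_def by measurable
  finally show ?thesis .
qed

lemma disc_integral_polar:
  assumes k[measurable]: "k \<in> borel_measurable borel" and f: "continuous_on (ball 0 1) f"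
  shows "(\<integral>\<^sup>+z\<in>ball 0 1. ennreal (norm (f z) powr p) * k (norm z) \<partial>lborel) =
    ennreal (2 * pi) * (\<integral>\<^sup>+s\<in>{0<..<1}. ennreal s * circle_mean p f s * k s \<partial>lborel)"
proof -
  define f' where "f' z = indicator (ball 0 1) z *\<^sub>R f z" for z
  have [measurable]: "f' \<in> borel_measurable borel" using borel_measurable_disc_extension[OF f] unfolding f'_def .
  have "(\<integral>\<^sup>+ z\<in>ball 0 1. ennreal (norm (f z) powr p) * k (norm z) \<partial>lborel)
     = (\<integral>\<^sup>+ z\<in>ball 0 1. ennreal (norm (f' z) powr p) * k (norm z) \<partial>lborel)"
    by (rule nn_integral_cong) (auto simp: f'_def indicator_def)
  also have "\<dots> = (\<integral>\<^sup>+s\<in>{0<..<1}. ennreal s * (\<integral>\<^sup>+\<theta>\<in>{0..2*pi}. ennreal (norm (f' (of_real s * cis \<theta>)) powr p) *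
       k (norm (of_real s * cis \<theta>)) \<partial>lborel) \<partial>lborel)"
    by (rule polar_coordinates) measurable
  also have "\<dots> = (\<integral>\<^sup>+s. ennreal (2 * pi) * (ennreal s * (circle_mean p f s * indicator {0<..<1} s) * k s) \<partial>lborel)"
  proof (rule nn_integral_cong)
    fix s :: real
    show "ennreal s * (\<integral>\<^sup>+\<theta>\<in>{0..2*pi}. ennreal (norm (f' (of_real s * cis \<theta>)) powr p) *
       k (norm (of_real s * cis \<theta>)) \<partial>lborel) * indicator {0<..<1} s = ennreal (2 * pi) * (ennreal s * (circle_mean p f s * indicator {0<..<1} s) * k s)"
    proof (cases "s \<in> {0<..<1}")
      case True
      have "(\<integral>\<^sup>+\<theta>\<in>{0..2*pi}. ennreal (norm (f' (of_real s * cis \<theta>)) powr p) * k (norm (of_real s * cis \<theta>)) \<partial>lborel)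
         = (\<integral>\<^sup>+\<theta>. ennreal (norm (f' (of_real s * cis \<theta>)) powr p) * indicator {0..2*pi} \<theta> * k s \<partial>lborel)"
        using True by (intro nn_integral_cong) (auto simp: norm_mult mult_ac)
      also have "\<dots> = (\<integral>\<^sup>+\<theta>. ennreal (norm (f' (of_real s * cis \<theta>)) powr p) * indicator {0..2*pi} \<theta> \<partial>lborel) * k s"
        by (rule nn_integral_multc) measurable
      also have "(\<integral>\<^sup>+\<theta>. ennreal (norm (f' (of_real s * cis \<theta>)) powr p) * indicator {0..2*pi} \<theta> \<partial>lborel)
        = (\<integral>\<^sup>+\<theta>. ennreal (norm (f (of_real s * cis \<theta>)) powr p) * indicator {0..2*pi} \<theta> \<partial>lborel)"
        using True by (intro nn_integral_cong) (auto simp: f'_def norm_mult)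
      also have "\<dots> = ennreal (2 * pi) * circle_mean p f s"
        unfolding circle_mean_def by (simp add: mult.assoc[symmetric] ennreal_mult[symmetric])
      finally show ?thesis using True by (simp add: mult_ac)
    qed simp
  qed
  also have "\<dots> = ennreal (2 * pi) * (\<integral>\<^sup>+s. ennreal s * (circle_mean p f s * indicator {0<..<1} s) * k s \<partial>lborel)"
  proof (rule nn_integral_cmult)
    define c where "c s = circle_mean p f s * indicator {0<..<1} s" for s
    have [measurable]: "c \<in> borel_measurable borel" using circle_mean_measurable[OF f] unfolding c_def .
    have "(\<lambda>s. ennreal s * c s * k s) \<in> borel_measurable lborel" by measurable
    then show "(\<lambda>s. ennreal s * (circle_mean p f s * indicator {0<..<1} s) * k s) \<in> borel_measurable lborel"
      unfolding c_def .
  qed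
  finally show ?thesis by (simp add: mult_ac)
qed

text \<open>The weight may be replaced by \<open>g (norm z)\<close> off a null set, which turns the
  integral into one over radii. The factor 2 is the 2 \<pi> of the polar form over the \<pi> of
  normalized area.\<close>

lemma bergman_integral_polar:
  assumes g: "radial_profile \<nu> g" and f: "continuous_on (ball 0 1) f"
  shows "bergman_integral p \<nu> f = 2 * (\<integral>\<^sup>+s. ennreal s * circle_mean p f s * ennreal (g s) \<partial>lborel)"
proof -
  have gm[measurable]: "g \<in> borel_measurable borel" and g0: "\<And>s. 0 \<le> g s" "\<And>s. s \<notin> {0<..<1} \<Longrightarrow> g s = 0"
    and gz: "AE z in lborel. z \<in> ball 0 1 \<longrightarrow> \<nu> z = g (norm z)"
    using g unfolding radial_profile_def by auto
  have "(\<integral>\<^sup>+ z\<in>unit_disc. ennreal (norm (f z) powr p * \<nu> z) \<partial>lebesgue)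
     = (\<integral>\<^sup>+ z\<in>unit_disc. ennreal (norm (f z) powr p * \<nu> z) \<partial>lborel)" by (rule nn_integral_completion)
  also have "\<dots> = (\<integral>\<^sup>+ z\<in>unit_disc. ennreal (norm (f z) powr p) * ennreal (g (norm z)) \<partial>lborel)"
    by (rule nn_integral_cong_AE, use gz in eventually_elim) (auto simp: indicator_def ennreal_mult g0)
  also have "\<dots> = ennreal (2 * pi) * (\<integral>\<^sup>+s\<in>{0<..<1}. ennreal s * circle_mean p f s * ennreal (g s) \<partial>lborel)"
    by (rule disc_integral_polar[OF _ f]) measurable
  also have "(\<integral>\<^sup>+s\<in>{0<..<1}. ennreal s * circle_mean p f s * ennreal (g s) \<partial>lborel) =
     (\<integral>\<^sup>+s. ennreal s * circle_mean p f s * ennreal (g s) \<partial>lborel)"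
    using g0(2) by (intro nn_integral_cong) (auto simp: indicator_def)
  finally show ?thesis unfolding bergman_integral_def
    by (simp add: mult.assoc[symmetric] ennreal_mult[symmetric])
qed

section \<open>Radial tails as functions of the distance to the boundary\<close>

definition tail_mass :: "(real \<Rightarrow> real) \<Rightarrow> real \<Rightarrow> real" where
  "tail_mass g y = (\<integral>s. indicator {1 - y..} s * g s \<partial>lborel)"

text \<open>Doubling is asked for all y > 0 so that the multiples 2^j y in dyadic sums may exceed 1
  without case distinctions.\<close>

definition doubling_profile :: "(complex \<Rightarrow> real) \<Rightarrow> (real \<Rightarrow> real) \<Rightarrow> bool" where
  "doubling_profile \<omega> g \<longleftrightarrow> radial_profile \<omega> g \<and> integrable lborel g \<and> (\<forall>y>0. 0 < tail_mass g y) \<and>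
     (\<exists>C>1. \<forall>y>0. tail_mass g (2 * y) \<le> C * tail_mass g y)"

lemma weight_tail_profile:
  assumes "radial_profile \<omega> g" "0 \<le> r"
  shows "weight_tail \<omega> r = (\<integral>\<^sup>+s\<in>{r..}. ennreal (g s) \<partial>lborel)"
proof -
  have "weight_tail \<omega> r = (\<integral>\<^sup>+s\<in>{r..<1}. ennreal (\<omega> (of_real s)) \<partial>lborel)"
    unfolding weight_tail_def by (rule nn_integral_completion)
  also have "\<dots> = (\<integral>\<^sup>+s\<in>{r..}. ennreal (g s) \<partial>lborel)"
  proof (rule nn_integral_cong_AE)
    have g0: "\<And>s. s \<notin> {0<..<1} \<Longrightarrow> g s = 0" using assms by (auto simp: radial_profile_def)
    have "AE s in lborel. s \<in> {0<..<1} \<longrightarrow> \<omega> (of_real s) = g s" "AE s in lborel. s \<noteq> (0::real)"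
      using assms AE_lborel_singleton[of "0::real"] by (auto simp: radial_profile_def)
    then show "AE s in lborel. ennreal (\<omega> (of_real s)) * indicator {r..<1} s = ennreal (g s) * indicator {r..} s"
      by eventually_elim (use assms(2) g0 in \<open>auto simp: indicator_def\<close>)
  qed
  finally show ?thesis .
qed

lemma tail_mass_nn:
  assumes "radial_profile \<omega> g" "integrable lborel g"
  shows "(\<integral>\<^sup>+s\<in>{1-y..}. ennreal (g s) \<partial>lborel) = ennreal (tail_mass g y)" "0 \<le> tail_mass g y"
proof -
  have [measurable]: "g \<in> borel_measurable borel" and g0: "\<And>s. 0 \<le> g s" using assms by (auto simp: radial_profile_def)
  have "integrable lborel (\<lambda>s. indicator {1-y..} s * g s)"
    using integrable_mult_indicator[OF _ assms(2), of "{1-y..}"] by simp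
  then have "(\<integral>\<^sup>+s. ennreal (indicator {1-y..} s * g s) \<partial>lborel) = ennreal (tail_mass g y)"
    unfolding tail_mass_def by (rule nn_integral_eq_integral) (simp add: g0)
  then show "(\<integral>\<^sup>+s\<in>{1-y..}. ennreal (g s) \<partial>lborel) = ennreal (tail_mass g y)"
    by (subst (asm) ennreal_mult') (simp_all add: mult.commute ennreal_indicator g0)
  show "0 \<le> tail_mass g y" unfolding tail_mass_def by (simp add: g0)
qed

lemma tail_mass_mono:
  assumes "radial_profile \<omega> g" "integrable lborel g" "y \<le> y'"
  shows "tail_mass g y \<le> tail_mass g y'"
proof -
  have "(\<integral>\<^sup>+s\<in>{1-y..}. ennreal (g s) \<partial>lborel) \<le> (\<integral>\<^sup>+s\<in>{1-y'..}. ennreal (g s) \<partial>lborel)"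
    using assms(3) by (intro nn_integral_mono) (auto simp: indicator_def)
  then show ?thesis using assms by (simp add: tail_mass_nn)
qed

lemma tail_mass_full:
  assumes "radial_profile \<omega> g" "1 \<le> y"
  shows "tail_mass g y = tail_mass g 1"
  unfolding tail_mass_def
proof (rule Bochner_Integration.integral_cong)
  fix s show "indicator {1 - y..} s * g s = indicator {1 - 1..} s * g s"
    using assms by (auto simp: radial_profile_def indicator_def)
qed simp

lemma weight_tail_eq:
  assumes "radial_profile \<omega> g" "integrable lborel g" "0 \<le> r"
  shows "weight_tail \<omega> r = ennreal (tail_mass g (1 - r))"
  using weight_tail_profile[OF assms(1,3)] tail_mass_nn[OF assms(1,2), of "1 - r"] by simp

lemma weight_moment_eq:
  assumes g: "radial_profile \<omega> g" and "integrable lborel g"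
  shows "weight_moment \<omega> n = (\<integral>s. s ^ n * g s \<partial>lborel)"
proof -
  have [measurable]: "g \<in> borel_measurable borel" using assms by (auto simp: radial_profile_def)
  have m: "(\<lambda>s. s ^ n * g s) \<in> borel_measurable lborel" by measurable
  have g0: "\<And>s. s \<notin> {0<..<1} \<Longrightarrow> g s = 0" using assms by (auto simp: radial_profile_def)
  have "AE s in lborel. s \<in> {0<..<1} \<longrightarrow> \<omega> (of_real s) = g s" "AE s in lborel. s \<noteq> (0::real)"
    using assms AE_lborel_singleton[of "0::real"] by (auto simp: radial_profile_def)
  then have ae: "AE s in lborel. s ^ n * g s = indicator {0..<1} s *\<^sub>R (s ^ n * \<omega> (complex_of_real s))"
    by eventually_elim (use g0 in \<open>auto simp: indicator_def\<close>)
  have m1: "(\<lambda>s. s ^ n * g s) \<in> borel_measurable lebesgue" using m by (rule measurable_completion)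
  \<comment> \<open>The integrand formed with \<omega> itself inherits Lebesgue measurability from
    the Borel profile through almost everywhere equality.\<close>
  have m2: "(\<lambda>s. indicator {0..<1} s *\<^sub>R (s ^ n * \<omega> (complex_of_real s))) \<in> borel_measurable lebesgue"
    by (rule borel_measurable_AE[OF m1 AE_completion[OF ae]])
  have "weight_moment \<omega> n = (\<integral>s. s ^ n * g s \<partial>lebesgue)"
    unfolding weight_moment_def set_lebesgue_integral_def
    by (rule integral_cong_AE[OF m2 m1]) (use AE_completion[OF ae] in \<open>auto elim: eventually_mono\<close>)
  also have "\<dots> = (\<integral>s. s ^ n * g s \<partial>lborel)" by (rule integral_completion[OF m])
  finally show ?thesis .
qed

text \<open>Integrability over the disc controls only s g(s), hence the tail from 1/2 on; doubling
  at r = 0 then yields integrability of g up to 0. The total mass is positive because \<omega> is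
  not almost everywhere 0, and doubling passes positivity on to every tail.\<close>

lemma D_hat_profile:
  assumes "\<omega> \<in> D_hat"
  obtains g where "doubling_profile \<omega> g"
proof -
  from assms obtain C where rw: "radial_weight \<omega>" and nz: "\<not> (AE z in lebesgue. z \<in> unit_disc \<longrightarrow> \<omega> z = 0)"
    and C: "C > 1" "\<And>r. 0 \<le> r \<Longrightarrow> r < 1 \<Longrightarrow> weight_tail \<omega> r \<le> ennreal C * weight_tail \<omega> ((1 + r) / 2)"
    unfolding D_hat_def by auto
  obtain g where g: "radial_profile \<omega> g" using radial_weight_profile[OF rw] by auto
  have [measurable]: "g \<in> borel_measurable borel" and g0: "\<And>s. 0 \<le> g s" and g00: "\<And>s. s \<notin> {0<..<1} \<Longrightarrow> g s = 0"
    and gz: "AE z in lborel. z \<in> ball 0 1 \<longrightarrow> \<omega> z = g (norm z)"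
    using g by (auto simp: radial_profile_def)
  have [measurable]: "ball (0::complex) 1 \<in> sets borel" by simp
  note intw = radial_weightD(3)[OF rw]
  have "(\<integral>\<^sup>+s\<in>{0<..<1}. ennreal (2 * pi * s) * ennreal (g s) \<partial>lborel) = (\<integral>\<^sup>+z\<in>ball (0::complex) 1. ennreal (g (norm z)) \<partial>lborel)"
    by (rule nn_integral_ball_norm[symmetric]) simp
  also have "\<dots> = (\<integral>\<^sup>+z. ennreal (norm (indicator unit_disc z *\<^sub>R \<omega> z)) \<partial>lborel)"
    by (rule nn_integral_cong_AE, use gz in eventually_elim) (auto simp: indicator_def g0)
  also have "\<dots> = (\<integral>\<^sup>+z. ennreal (norm (indicator unit_disc z *\<^sub>R \<omega> z)) \<partial>lebesgue)"
    by (rule nn_integral_completion[symmetric])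
  also have "\<dots> < \<infinity>" using intw by (simp add: integrable_iff_bounded)
  finally have fin1: "(\<integral>\<^sup>+s\<in>{0<..<1}. ennreal (2 * pi * s) * ennreal (g s) \<partial>lborel) < \<infinity>" .
  have "weight_tail \<omega> (1/2) = (\<integral>\<^sup>+s\<in>{1/2..}. ennreal (g s) \<partial>lborel)" by (rule weight_tail_profile[OF g]) simp
  also have "\<dots> \<le> (\<integral>\<^sup>+s\<in>{0<..<1}. ennreal (2 * pi * s) * ennreal (g s) \<partial>lborel)"
  proof (rule nn_integral_mono)
    fix s
    have "1 \<le> 2 * pi * s" if "1/2 \<le> s" using mult_mono[of 1 pi "1/2" s] that pi_gt3 by simp
    then show "ennreal (g s) * indicator {1 / 2..} s \<le> ennreal (2 * pi * s) * ennreal (g s) * indicator {0<..<1} s"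
      using g00[of s] g0[of s] mult_right_mono[of 1 "2 * pi * s" "g s"]
      by (cases "s \<in> {0<..<1}") (auto simp: indicator_def ennreal_mult[symmetric])
  qed
  finally have fin2: "weight_tail \<omega> (1/2) < \<infinity>" using fin1 by simp
  have "weight_tail \<omega> 0 \<le> ennreal C * weight_tail \<omega> (1/2)" using C(2)[of 0] by simp
  also have "\<dots> < \<infinity>" using fin2 by (simp add: ennreal_mult_less_top)
  finally have "weight_tail \<omega> 0 < \<infinity>" .
  moreover have "weight_tail \<omega> 0 = (\<integral>\<^sup>+s. ennreal (g s) \<partial>lborel)"
    unfolding weight_tail_profile[OF g order_refl] using g00 by (intro nn_integral_cong) (auto simp: indicator_def)
  ultimately have int: "integrable lborel g" by (intro integrableI_nonneg) (auto simp: g0)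
  note T = tail_mass_nn[OF g int] tail_mass_mono[OF g int] tail_mass_full[OF g] weight_tail_eq[OF g int]
  have pos1: "tail_mass g 1 \<noteq> 0"
  proof
    assume "tail_mass g 1 = 0"
    then have "(\<integral>\<^sup>+s. ennreal (g s) * indicator {1 - 1..} s \<partial>lborel) = 0" using T(1)[of 1] by simp
    then have "AE s in lborel. ennreal (g s) * indicator {1 - 1..} s = 0" by (subst nn_integral_0_iff_AE[symmetric]) auto
    then have "AE s in lborel. s \<in> {0<..<1} \<longrightarrow> g s = 0"
    proof eventually_elim
      case (elim s)
      show ?case using elim g0[of s] by (cases "s \<in> {0<..<1}") (auto simp: ennreal_eq_0_iff)
    qed
    then have "AE z in lborel. z \<in> ball (0::complex) 1 \<longrightarrow> z \<noteq> 0 \<longrightarrow> g (norm z) = 0" by (rule AE_norm)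
    moreover have "AE z in lborel. z \<noteq> (0::complex)" by (rule AE_lborel_singleton)
    ultimately have "AE z in lborel. z \<in> unit_disc \<longrightarrow> \<omega> z = 0" using gz by eventually_elim auto
    from AE_completion[OF this] show False using nz by simp
  qed
  then have pos1: "tail_mass g 1 > 0" using T(2)[of 1] by simp
  \<comment> \<open>For 2 y <= 1 this is the hypothesis at r = 1 - 2 y. Otherwise the left side is
    the total mass, y exceeds 1/2, and the hypothesis at r = 0 together with monotonicity
    suffices.\<close>
  have dbl: "tail_mass g (2 * y) \<le> C * tail_mass g y" if "y > 0" for y
  proof -
    consider "2 * y \<le> 1" | "2 * y > 1" by linarith
    then show ?thesis
    proof cases
      case 1
      have "ennreal (tail_mass g (2 * y)) \<le> ennreal C * ennreal (tail_mass g y)"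
      proof -
        have e: "(1 + (1 - 2 * y)) / 2 = 1 - y" by simp
        show ?thesis using C(2)[of "1 - 2 * y", unfolded e] 1 that T(5)[of "1 - 2 * y"] T(5)[of "1 - y"] by simp
      qed
      then show ?thesis using C(1) T(2)[of y] by (simp add: ennreal_mult[symmetric])
    next
      case 2
      have "ennreal (tail_mass g 1) \<le> ennreal C * ennreal (tail_mass g (1/2))"
        using C(2)[of 0] T(5)[of 0] T(5)[of "1/2"] by simp
      then have "tail_mass g 1 \<le> C * tail_mass g (1/2)" using C(1) T(2)[of "1/2"] by (simp add: ennreal_mult[symmetric])
      moreover have "C * tail_mass g (1/2) \<le> C * tail_mass g y" using 2 C(1) T(3)[of "1/2" y] by simp
      ultimately show ?thesis using T(4)[of "2 * y"] 2 by simp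
    qed
  qed
  \<comment> \<open>The total mass is bounded by a multiple of each dyadic tail, so none of them can
    vanish.\<close>
  have iter: "tail_mass g 1 \<le> C ^ n * tail_mass g (1 / 2 ^ n)" for n
  proof (induction n)
    case (Suc n)
    have "tail_mass g (1 / 2 ^ n) \<le> C * tail_mass g (1 / 2 ^ Suc n)" using dbl[of "1 / 2 ^ Suc n"] by simp
    then have "C ^ n * tail_mass g (1 / 2 ^ n) \<le> C ^ n * (C * tail_mass g (1 / 2 ^ Suc n))" using C(1) by (intro mult_left_mono) auto
    with Suc show ?case by (simp add: mult_ac)
  qed simp
  have pos: "tail_mass g y > 0" if "y > 0" for y
  proof -
    obtain n where n: "(1 / 2::real) ^ n < y" using real_arch_pow_inv[OF \<open>y > 0\<close>, of "1/2"] by auto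
    have "0 < C ^ n * tail_mass g (1 / 2 ^ n)" using iter[of n] pos1 by linarith
    then have "0 < tail_mass g (1 / 2 ^ n)" using C(1) by (simp add: zero_less_mult_iff)
    also have "\<dots> \<le> tail_mass g y" using n by (intro T(3)) (simp add: power_divide)
    finally show ?thesis .
  qed
  show ?thesis by (rule that[of g]) (use g int pos dbl C(1) in \<open>auto simp: doubling_profile_def\<close>)
qed

lemma D_check_profile:
  assumes "\<omega> \<in> D_check" "doubling_profile \<omega> g"
  shows "\<exists>C>1. \<exists>K>1. \<forall>y. 0 < y \<longrightarrow> y \<le> 1 \<longrightarrow> C * tail_mass g (y / K) \<le> tail_mass g y"
proof -
  have g: "radial_profile \<omega> g" "integrable lborel g" using assms(2) by (auto simp: doubling_profile_def)
  from assms(1) obtain C K where CK: "C > 1" "K > 1"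
    "\<And>r. 0 \<le> r \<Longrightarrow> r < 1 \<Longrightarrow> weight_tail \<omega> r \<ge> ennreal C * weight_tail \<omega> (1 - (1 - r) / K)"
    unfolding D_check_def by auto
  have "C * tail_mass g (y / K) \<le> tail_mass g y" if y: "0 < y" "y \<le> 1" for y
  proof -
    have "y / K \<le> 1" using y CK(2) by (simp add: divide_le_eq)
    then have "ennreal C * ennreal (tail_mass g (y / K)) \<le> ennreal (tail_mass g y)"
      using CK(3)[of "1 - y"] y weight_tail_eq[OF g, of "1 - y"] weight_tail_eq[OF g, of "1 - y / K"] by simp
    then show ?thesis
      using CK(1) tail_mass_nn(2)[OF g] by (simp add: ennreal_mult[symmetric])
  qed
  then show ?thesis using CK(1,2) by blast
qed

section \<open>Monotonicity of circle means\<close>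

text \<open>Near z0 the quotient f z / f z0 stays in the right half-plane, where the principal
  logarithm is holomorphic. Scaling by |f z0|^p rather than by a complex power makes the branch
  positive at z0, so that several branches add up there without cancellation.\<close>

lemma local_powr_branch:
  assumes f: "f holomorphic_on S" "open S" "z0 \<in> S" and nz: "f z0 \<noteq> 0"
  shows "\<exists>e>0. ball z0 e \<subseteq> S \<and> (\<exists>h. h holomorphic_on ball z0 e \<and> h z0 = of_real (norm (f z0) powr p) \<and>
     (\<forall>z\<in>ball z0 e. norm (h z) = norm (f z) powr p))"
proof -
  obtain e1 where e1: "e1 > 0" "ball z0 e1 \<subseteq> S" using f by (meson openE)
  have "isCont f z0" using f holomorphic_on_imp_continuous_on continuous_on_eq_continuous_at by blast
  then obtain e2 where e2: "e2 > 0" "\<And>z. dist z z0 < e2 \<Longrightarrow> dist (f z) (f z0) < norm (f z0)"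
    using nz unfolding continuous_at_eps_delta by (metis zero_less_norm_iff)
  define e where "e = min e1 e2"
  have sub: "ball z0 e \<subseteq> S" using e1 by (auto simp: e_def)
  have half: "0 < Re (f z / f z0)" if "z \<in> ball z0 e" for z
  proof -
    have "dist (f z) (f z0) < norm (f z0)" using that e2(2)[of z] by (auto simp: e_def dist_commute)
    then have "norm ((f z - f z0) / f z0) < 1" using nz by (simp add: dist_norm norm_divide divide_less_eq)
    then have "norm (f z / f z0 - 1) < 1" using nz by (simp add: diff_divide_distrib)
    then show ?thesis using abs_Re_le_cmod[of "f z / f z0 - 1"] by auto
  qed
  define h where "h z = of_real (norm (f z0) powr p) * exp (of_real p * Ln (f z / f z0))" for z
  have "h holomorphic_on ball z0 e" unfolding h_def
    using holomorphic_on_subset[OF f(1) sub] half nz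
    by (intro holomorphic_intros) (use half in \<open>force simp: complex_nonpos_Reals_iff\<close>)+
  moreover have "norm (h z) = norm (f z) powr p" if "z \<in> ball z0 e" for z
  proof -
    have "f z \<noteq> 0" using half[OF that] by auto
    then have "norm (h z) = norm (f z0) powr p * exp (p * ln (norm (f z / f z0)))"
      using nz by (simp add: h_def norm_mult norm_exp_eq_Re Re_Ln)
    also have "exp (p * ln (norm (f z / f z0))) = norm (f z / f z0) powr p"
      using nz \<open>f z \<noteq> 0\<close> by (simp add: powr_def)
    finally show ?thesis using nz by (simp add: norm_divide powr_divide)
  qed
  moreover have "h z0 = of_real (norm (f z0) powr p)" using nz by (simp add: h_def)
  ultimately show ?thesis using e1 e2 sub by (intro exI[of _ e]) (auto simp: e_def)
qed

text \<open>Near a local maximum the non-vanishing summands are moduli of branches of \<open>f\<^sub>k\<^sup>p\<close>,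
  normalized to be positive at the maximum; their sum is a holomorphic function whose modulus has a local maximum.\<close>

lemma sum_powr_local_max:
  fixes f :: "'i \<Rightarrow> complex \<Rightarrow> complex"
  assumes fin: "finite I" and f: "\<And>k. k \<in> I \<Longrightarrow> f k holomorphic_on S" and S: "open S" "z0 \<in> S"
    and V: "open V" "z0 \<in> V" and p: "0 < p"
    and mx: "\<And>z. z \<in> V \<Longrightarrow> (\<Sum>k\<in>I. norm (f k z) powr p) \<le> (\<Sum>k\<in>I. norm (f k z0) powr p)"
  shows "\<exists>e>0. \<forall>z\<in>ball z0 e. (\<Sum>k\<in>I. norm (f k z0) powr p) \<le> (\<Sum>k\<in>I. norm (f k z) powr p)"
proof -
  define J where "J = {k\<in>I. f k z0 \<noteq> 0}"
  have J: "finite J" "J \<subseteq> I" using fin by (auto simp: J_def)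
  have "\<forall>k\<in>J. \<exists>e>0. \<exists>h. h holomorphic_on ball z0 e \<and> h z0 = of_real (norm (f k z0) powr p) \<and>
     (\<forall>z\<in>ball z0 e. norm (h z) = norm (f k z) powr p)"
    using local_powr_branch[OF f S] by (fastforce simp: J_def)
  then obtain e h where eh: "\<And>k. k \<in> J \<Longrightarrow> e k > 0" "\<And>k. k \<in> J \<Longrightarrow> h k holomorphic_on ball z0 (e k)"
    "\<And>k. k \<in> J \<Longrightarrow> h k z0 = of_real (norm (f k z0) powr p)"
    "\<And>k z. k \<in> J \<Longrightarrow> z \<in> ball z0 (e k) \<Longrightarrow> norm (h k z) = norm (f k z) powr p" by metis
  obtain e0 where e0: "e0 > 0" "ball z0 e0 \<subseteq> V" using V by (meson openE)
  define d where "d = Min (insert e0 (e ` J))"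
  have d: "d > 0" "d \<le> e0" "\<And>k. k \<in> J \<Longrightarrow> d \<le> e k" using J eh(1) e0 by (auto simp: d_def)
  define H where "H z = (\<Sum>k\<in>J. h k z)" for z
  have holH: "H holomorphic_on ball z0 d" unfolding H_def
    by (intro holomorphic_on_sum holomorphic_on_subset[OF eh(2)] subset_ball d(3))
  \<comment> \<open>Summands that vanish at z0 have no branch. They contribute 0 at z0 and are
    nonnegative elsewhere, so leaving them out keeps equality at z0 and is harmless in
    \<open>Hle\<close>.\<close>
  have U0: "(\<Sum>k\<in>J. norm (f k z0) powr p) = (\<Sum>k\<in>I. norm (f k z0) powr p)"
    by (rule sum.mono_neutral_left) (use fin J p in \<open>auto simp: J_def\<close>)
  have H0: "H z0 = of_real (\<Sum>k\<in>I. norm (f k z0) powr p)"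
    unfolding H_def U0[symmetric] by (simp add: eh(3))
  have Hle: "norm (H z) \<le> (\<Sum>k\<in>I. norm (f k z) powr p)" if "z \<in> ball z0 d" for z
  proof -
    have "norm (H z) \<le> (\<Sum>k\<in>J. norm (h k z))" unfolding H_def by (rule norm_sum)
    also have "\<dots> = (\<Sum>k\<in>J. norm (f k z) powr p)"
      by (intro sum.cong refl eh(4)) (use that d(3) in fastforce)+
    also have "\<dots> \<le> (\<Sum>k\<in>I. norm (f k z) powr p)" by (rule sum_mono2) (use fin J in auto)
    finally show ?thesis .
  qed
  have "norm (H z0) = (\<Sum>k\<in>I. norm (f k z0) powr p)" unfolding H0 norm_of_real by (simp add: sum_nonneg)
  then have "norm (H z) \<le> norm (H z0)" if "z \<in> ball z0 d" for z
    using Hle[OF that] mx[of z] that d e0 by force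
  then have "H constant_on ball z0 d"
    using maximum_modulus_principle[OF holH, of "ball z0 d" z0] d by auto
  then have "H z = H z0" if "z \<in> ball z0 d" for z
    using that d unfolding constant_on_def by (metis centre_in_ball)
  then have "\<forall>z\<in>ball z0 d. (\<Sum>k\<in>I. norm (f k z0) powr p) \<le> (\<Sum>k\<in>I. norm (f k z) powr p)"
    using Hle \<open>norm (H z0) = _\<close> by metis
  then show ?thesis using d(1) by blast
qed

text \<open>Among the maximum points in the closed disc, w is one of largest modulus. Were it
  interior, \<open>sum_powr_local_max\<close> would make points slightly farther out maximal as
  well.\<close>

lemma sum_powr_maximum_principle:
  fixes f :: "'i \<Rightarrow> complex \<Rightarrow> complex"
  assumes fin: "finite I" and f: "\<And>k. k \<in> I \<Longrightarrow> f k holomorphic_on ball 0 1" and p: "0 < p" and s: "0 \<le> s" "s < 1"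
  shows "\<exists>w. norm w = s \<and> (\<forall>z\<in>cball 0 s. (\<Sum>k\<in>I. norm (f k z) powr p) \<le> (\<Sum>k\<in>I. norm (f k w) powr p))"
proof -
  define U where "U z = (\<Sum>k\<in>I. norm (f k z) powr p)" for z
  have contU: "continuous_on (cball 0 s) U" unfolding U_def
    by (intro continuous_intros continuous_on_sum continuous_on_powr')
      (use p s in \<open>auto intro!: continuous_intros continuous_on_subset[OF holomorphic_on_imp_continuous_on[OF f]]\<close>)
  have ne: "cball (0::complex) s \<noteq> {}" using s by simp
  obtain z1 where z1: "z1 \<in> cball 0 s" "\<And>z. z \<in> cball 0 s \<Longrightarrow> U z \<le> U z1"
    using continuous_attains_sup[OF compact_cball ne contU] by auto
  define T where "T = {z \<in> cball 0 s. U z \<in> {U z1}}"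
  have "closed T"
    using continuous_closed_preimage[OF contU closed_cball, of "{U z1}"] by (simp add: T_def vimage_def Int_def)
  moreover have "cball 0 s \<inter> T = T" by (auto simp: T_def)
  ultimately have "compact T" using compact_Int_closed[OF compact_cball, of T 0 s] by simp
  moreover have "T \<noteq> {}" using z1 by (auto simp: T_def)
  ultimately obtain w where w: "w \<in> T" "\<And>z. z \<in> T \<Longrightarrow> norm z \<le> norm w"
    using continuous_attains_sup[of T norm] by (auto intro: continuous_intros)
  have "norm w = s"
  proof (rule ccontr)
    assume "norm w \<noteq> s"
    then have ws: "norm w < s" using w(1) by (auto simp: T_def)
    have "\<exists>e>0. \<forall>z\<in>ball w e. (\<Sum>k\<in>I. norm (f k w) powr p) \<le> (\<Sum>k\<in>I. norm (f k z) powr p)"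
    proof (rule sum_powr_local_max[OF fin f _ _ _ _ p])
      show "w \<in> ball 0 s" "w \<in> ball 0 1" using ws s by auto
      fix z assume "z \<in> ball (0::complex) s"
      then show "(\<Sum>k\<in>I. norm (f k z) powr p) \<le> (\<Sum>k\<in>I. norm (f k w) powr p)"
        using z1(2)[of z] w(1) by (auto simp: T_def U_def)
    qed auto
    then obtain e where e: "e > 0" "\<And>z. z \<in> ball w e \<Longrightarrow> U w \<le> U z" by (auto simp: U_def)
    define d where "d = min (e / 2) (s - norm w)"
    \<comment> \<open>A point farther out on the ray from 0 through w; at w = 0 any direction
      serves.\<close>
    define z where "z = w + of_real d * (if w = 0 then 1 else sgn w)"
    have d: "d > 0" "d < e" "norm w + d \<le> s" using e ws by (auto simp: d_def)
    have nz: "norm z = norm w + d"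
    proof (cases "w = 0")
      case False
      have "z = of_real (norm w + d) * sgn w" using False
        by (simp add: z_def sgn_eq field_simps)
      then have "norm z = \<bar>norm w + d\<bar>" using False by (simp only: norm_mult norm_sgn norm_of_real) simp
      then show ?thesis using d norm_ge_zero[of w] by linarith
    qed (use d in \<open>simp add: z_def\<close>)
    have "dist w z = d" using d by (auto simp: z_def dist_norm norm_mult norm_sgn)
    then have "U w \<le> U z" using e(2)[of z] d by simp
    then have "U z = U z1" using w(1) z1(2)[of z] nz d by (auto simp: T_def)
    then have "z \<in> T" using nz d by (simp add: T_def)
    then show False using w(2)[of z] nz d by simp
  qed
  then show ?thesis using w(1) z1(2) unfolding T_def U_def by (intro exI[of _ w]) auto
qed


section \<open>Discrete circle means over roots of unity\<close>

definition root_mean :: "real \<Rightarrow> (complex \<Rightarrow> complex) \<Rightarrow> nat \<Rightarrow> complex \<Rightarrow> real" where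
  "root_mean p f N z = (\<Sum>k<N. norm (f (z * cis (2 * pi * real k / real N))) powr p) / real N"

lemma root_mean_periodic:
  assumes "N > 0"
  shows "root_mean p f N (z * cis (2 * pi * real j / real N)) = root_mean p f N z"
proof (induction j)
  case (Suc j)
  define \<phi> where "\<phi> k = norm (f (z * cis (2 * pi * real (k + j) / real N))) powr p" for k
  have "\<phi> N = \<phi> 0" using assms by (simp add: \<phi>_def add_divide_distrib ring_distribs flip: cis_mult)
  then have "(\<Sum>k<N. \<phi> (Suc k)) = (\<Sum>k<N. \<phi> k)"
    using sum.lessThan_Suc_shift[of \<phi> N] sum.lessThan_Suc[of \<phi> N] by simp
  moreover have "root_mean p f N (z * cis (2 * pi * real (Suc j) / real N)) = (\<Sum>k<N. \<phi> (Suc k)) / real N"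
    unfolding root_mean_def \<phi>_def by (simp add: mult.assoc cis_mult add_divide_distrib ring_distribs add_ac)
  moreover have "root_mean p f N (z * cis (2 * pi * real j / real N)) = (\<Sum>k<N. \<phi> k) / real N"
    unfolding root_mean_def \<phi>_def by (simp add: mult.assoc cis_mult add_divide_distrib ring_distribs add_ac)
  ultimately show ?case using Suc by simp
qed simp

lemma norm_cis_diff_le: "norm (cis a - cis b) \<le> \<bar>a - b\<bar>"
proof -
  have "cis a - cis b = cis b * (cis (a - b) - 1)" by (simp add: algebra_simps cis_mult)
  then have "norm (cis a - cis b) = norm (exp (\<i> * of_real (a - b)) - 1)" by (simp add: norm_mult cis_conv_exp)
  also have "\<dots> \<le> \<bar>a - b\<bar>" using dist_exp_i_1[of "a - b"] abs_sin_x_le_abs_x[of "(a - b) / 2"] by simp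
  finally show ?thesis .
qed

text \<open>\<open>root_mean\<close> is invariant under rotation by \<open>2\<pi>/N\<close>, so on a circle it oscillates no more than
  \<open>\<bar>f\<bar>\<^sup>p\<close> does on arcs of length \<open>2\<pi>/N\<close>.\<close>

lemma root_mean_oscillation:
  assumes f: "f holomorphic_on ball 0 1" and p: "0 < p" and s: "0 \<le> s" "s < 1" and \<epsilon>: "\<epsilon> > 0"
  shows "\<exists>N>0. \<forall>\<alpha> \<theta>. \<alpha> \<in> {0..2*pi} \<longrightarrow> \<theta> \<in> {0..2*pi} \<longrightarrow>
     root_mean p f N (of_real s * cis \<alpha>) \<le> root_mean p f N (of_real s * cis \<theta>) + \<epsilon>"
proof -
  define u where "u z = norm (f z) powr p" for z
  have cu: "continuous_on (cball 0 s) u" unfolding u_def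
    by (intro continuous_on_powr')
      (use p s in \<open>auto intro!: continuous_intros continuous_on_subset[OF holomorphic_on_imp_continuous_on[OF f]]\<close>)
  have "uniformly_continuous_on (cball 0 s) u" by (rule compact_uniformly_continuous[OF cu compact_cball])
  then obtain d where d: "d > 0" "\<And>x y. x \<in> cball 0 s \<Longrightarrow> y \<in> cball 0 s \<Longrightarrow> dist y x < d \<Longrightarrow> dist (u y) (u x) < \<epsilon>"
    unfolding uniformly_continuous_on_def using \<epsilon> by metis
  obtain N where N: "2 * pi / d < real N" using reals_Archimedean2 by blast
  have "0 < 2 * pi / d" using d by simp
  then have N0: "N > 0" using N by (cases N) auto
  have Nd: "2 * pi / real N < d" using N d N0 by (simp add: field_simps)
  show ?thesis
  proof (intro exI[of _ N] conjI allI impI N0)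
    fix \<alpha> \<theta> :: real assume a: "\<alpha> \<in> {0..2*pi}" "\<theta> \<in> {0..2*pi}"
    \<comment> \<open>The added 2 \<pi> keeps the quantity under the floor nonnegative. After j
      steps of length 2 \<pi> / N the angle \<beta> is within one step of \<alpha> + 2 \<pi>, hence
      close to \<alpha> on the circle.\<close>
    define j where "j = nat \<lfloor>(\<alpha> + 2 * pi - \<theta>) * N / (2 * pi)\<rfloor>"
    define \<beta> where "\<beta> = \<theta> + 2 * pi * j / N"
    have "0 \<le> (\<alpha> + 2 * pi - \<theta>) * N / (2 * pi)" using a by auto
    then have "real j \<le> (\<alpha> + 2 * pi - \<theta>) * N / (2 * pi)" "(\<alpha> + 2 * pi - \<theta>) * N / (2 * pi) < real j + 1"
      unfolding j_def by linarith+
    then have "2 * pi * j / N \<le> \<alpha> + 2 * pi - \<theta>" "\<alpha> + 2 * pi - \<theta> < 2 * pi * j / N + 2 * pi / N"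
      using N0 by (simp_all add: field_simps)
    then have ab: "\<bar>(\<alpha> + 2 * pi) - \<beta>\<bar> < d" using Nd by (simp add: \<beta>_def)
    have tm: "u (of_real s * cis \<alpha> * c) \<le> u (of_real s * cis \<beta> * c) + \<epsilon>" if "norm c = 1" for c
    proof -
      have "cis \<alpha> = cis (\<alpha> + 2 * pi)" by (simp flip: cis_mult)
      then have "norm (of_real s * cis \<alpha> * c - of_real s * cis \<beta> * c) = s * norm (cis (\<alpha> + 2 * pi) - cis \<beta>)"
        using that s by (simp add: norm_mult flip: left_diff_distrib right_diff_distrib)
      also have "\<dots> \<le> 1 * norm (cis (\<alpha> + 2 * pi) - cis \<beta>)" using s by (intro mult_right_mono) auto
      also have "\<dots> < d" using norm_cis_diff_le[of "\<alpha> + 2 * pi" \<beta>] ab by simp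
      finally have "dist (of_real s * cis \<alpha> * c) (of_real s * cis \<beta> * c) < d" by (simp add: dist_norm)
      then have "dist (u (of_real s * cis \<alpha> * c)) (u (of_real s * cis \<beta> * c)) < \<epsilon>"
        by (intro d(2)) (use that s in \<open>auto simp: norm_mult\<close>)
      then show ?thesis by (simp add: dist_real_def)
    qed
    have "root_mean p f N (of_real s * cis \<alpha>) \<le> (\<Sum>k<N. u (of_real s * cis \<beta> * cis (2 * pi * real k / real N)) + \<epsilon>) / N"
      unfolding root_mean_def u_def[symmetric] using N0 by (intro divide_right_mono sum_mono tm) auto
    also have "\<dots> = root_mean p f N (of_real s * cis \<beta>) + \<epsilon>"
      using N0 unfolding root_mean_def u_def[symmetric] by (simp add: sum.distrib add_divide_distrib)
    also have "root_mean p f N (of_real s * cis \<beta>) = root_mean p f N (of_real s * cis \<theta>)"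
      using root_mean_periodic[OF N0, of p f "of_real s * cis \<theta>" j] by (simp add: \<beta>_def mult.assoc cis_mult)
    finally show "root_mean p f N (of_real s * cis \<alpha>) \<le> root_mean p f N (of_real s * cis \<theta>) + \<epsilon>" .
  qed
qed

text \<open>Each of the N summands is a shift of the same periodic function and has the same
  integral over a full turn. The identity is therefore exact for every N, and N can be chosen for
  small oscillation alone.\<close>

lemma circle_mean_root_mean:
  assumes f: "f holomorphic_on ball 0 1" and s: "0 \<le> s" "s < 1" and N: "N > 0"
  shows "circle_mean p f s = ennreal (1 / (2 * pi)) * (\<integral>\<^sup>+\<theta>\<in>{0..2*pi}. ennreal (root_mean p f N (of_real s * cis \<theta>)) \<partial>lborel)"
proof -
  define f' where "f' z = indicator (ball 0 1) z *\<^sub>R f z" for z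
  have [measurable]: "f' \<in> borel_measurable borel"
    using borel_measurable_disc_extension[OF holomorphic_on_imp_continuous_on[OF f]] unfolding f'_def .
  have eq: "norm (f (of_real s * cis t)) = norm (f' (of_real s * cis t))" for t
    using s by (simp add: f'_def norm_mult)
  define F where "F t = ennreal (norm (f' (of_real s * cis t)) powr p)" for t
  have [measurable]: "F \<in> borel_measurable borel" unfolding F_def by measurable
  have per: "F (t + 2 * pi) = F t" for t by (simp add: F_def flip: cis_mult)
  have "(\<integral>\<^sup>+\<theta>\<in>{0..2*pi}. ennreal (root_mean p f N (of_real s * cis \<theta>)) \<partial>lborel)
     = (\<integral>\<^sup>+\<theta>. ennreal (1 / N) * (\<Sum>k<N. F (\<theta> + 2 * pi * real k / real N) * indicator {0..2*pi} \<theta>) \<partial>lborel)"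
    unfolding root_mean_def mult.assoc cis_mult eq F_def
    by (intro nn_integral_cong) (auto simp: sum_ennreal ennreal_mult[symmetric] sum_nonneg indicator_def)
  also have "\<dots> = ennreal (1 / N) * (\<Sum>k<N. \<integral>\<^sup>+\<theta>\<in>{0..2*pi}. F (\<theta> + 2 * pi * real k / real N) \<partial>lborel)"
    by (subst nn_integral_cmult, simp, subst nn_integral_sum) auto
  also have "\<dots> = ennreal (1 / N) * (\<Sum>k<N. \<integral>\<^sup>+\<theta>\<in>{0..2*pi}. F \<theta> \<partial>lborel)"
    by (intro arg_cong2[where f="(*)"] refl sum.cong nn_integral_periodic_shift per) (use N in \<open>auto simp: field_simps\<close>)
  also have "\<dots> = (\<integral>\<^sup>+\<theta>\<in>{0..2*pi}. F \<theta> \<partial>lborel)"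
    using N by (simp add: mult.assoc[symmetric] ennreal_of_nat_eq_real_of_nat ennreal_mult[symmetric])
  finally show ?thesis unfolding circle_mean_def F_def eq by simp
qed

text \<open>On the inner circle the discrete mean is at most its maximum over the disc of radius s,
  which is attained at a point w of the outer circle; on that circle the discrete mean varies by at
  most \<epsilon>. Integrating over both circles gives the claim up to \<epsilon>.\<close>

theorem circle_mean_mono:
  assumes f: "f holomorphic_on ball 0 1" and p: "0 < p" and s: "0 \<le> \<rho>" "\<rho> \<le> s" "s < 1"
  shows "circle_mean p f \<rho> \<le> circle_mean p f s"
proof (rule ennreal_le_epsilon)
  fix \<epsilon> :: real assume \<epsilon>: "\<epsilon> > 0"
  have s0: "0 \<le> s" using s by simp
  obtain N where N: "N > 0" "\<And>\<alpha> \<theta>. \<alpha> \<in> {0..2*pi} \<Longrightarrow> \<theta> \<in> {0..2*pi} \<Longrightarrow>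
     root_mean p f N (of_real s * cis \<alpha>) \<le> root_mean p f N (of_real s * cis \<theta>) + \<epsilon>"
    using root_mean_oscillation[OF f p s0 s(3) \<epsilon>] by blast
  define r where "r k z = f (z * cis (2 * pi * real k / real N))" for k z
  have "r k holomorphic_on ball 0 1" for k
    unfolding r_def by (rule holomorphic_on_compose_gen[of "\<lambda>z. z * _" _ f, unfolded comp_def, OF _ f])
      (auto intro!: holomorphic_intros simp: norm_mult)
  then obtain w where w: "norm w = s" "\<And>z. z \<in> cball 0 s \<Longrightarrow> (\<Sum>k<N. norm (r k z) powr p) \<le> (\<Sum>k<N. norm (r k w) powr p)"
    using sum_powr_maximum_principle[of "{..<N}" r p s] p s0 s(3) by auto
  have le: "root_mean p f N z \<le> root_mean p f N w" if "z \<in> cball 0 s" for z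
    using w(2)[OF that] N unfolding root_mean_def r_def by (simp add: divide_right_mono)
  have wp: "w = of_real s * cis (Arg2pi w)" using Arg2pi_eq[of w] w(1) by (simp add: cis_conv_exp)
  have root0: "0 \<le> root_mean p f N z" for z unfolding root_mean_def by (intro divide_nonneg_nonneg sum_nonneg) auto
  have "circle_mean p f \<rho> = ennreal (1 / (2 * pi)) * (\<integral>\<^sup>+\<theta>\<in>{0..2*pi}. ennreal (root_mean p f N (of_real \<rho> * cis \<theta>)) \<partial>lborel)"
    using circle_mean_root_mean[OF f _ _ N(1)] s by simp
  also have "\<dots> \<le> ennreal (1 / (2 * pi)) * (\<integral>\<^sup>+\<theta>\<in>{0..2*pi}. ennreal (root_mean p f N w) \<partial>lborel)"
    by (intro mult_left_mono nn_integral_mono mult_right_mono ennreal_leI le) (use s in \<open>auto simp: norm_mult\<close>)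
  also have "\<dots> \<le> ennreal (1 / (2 * pi)) * (\<integral>\<^sup>+\<theta>. ennreal (root_mean p f N (of_real s * cis \<theta>)) * indicator {0..2*pi} \<theta> + ennreal \<epsilon> * indicator {0..2*pi} \<theta> \<partial>lborel)"
  proof (intro mult_left_mono nn_integral_mono)
    fix \<theta> :: real
    have "root_mean p f N w \<le> root_mean p f N (of_real s * cis \<theta>) + \<epsilon>" if "\<theta> \<in> {0..2*pi}"
      using N(2)[of "Arg2pi w" \<theta>] that Arg2pi[of w] wp by auto
    then show "ennreal (root_mean p f N w) * indicator {0..2*pi} \<theta> \<le>
       ennreal (root_mean p f N (of_real s * cis \<theta>)) * indicator {0..2*pi} \<theta> + ennreal \<epsilon> * indicator {0..2*pi} \<theta>"
      using \<epsilon> root0 by (auto simp: indicator_def ennreal_plus[symmetric] simp del: ennreal_plus)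
  qed simp
  also have "\<dots> = circle_mean p f s + ennreal \<epsilon>"
  proof -
    define f' where "f' z = indicator (ball 0 1) z *\<^sub>R f z" for z
    have [measurable]: "f' \<in> borel_measurable borel"
      using borel_measurable_disc_extension[OF holomorphic_on_imp_continuous_on[OF f]] unfolding f'_def .
    have eq: "root_mean p f N (of_real s * cis \<theta>) = root_mean p f' N (of_real s * cis \<theta>)" for \<theta>
      using s s0 by (simp add: f'_def root_mean_def norm_mult)
    have "(\<integral>\<^sup>+\<theta>. ennreal (root_mean p f N (of_real s * cis \<theta>)) * indicator {0..2*pi} \<theta> + ennreal \<epsilon> * indicator {0..2*pi} \<theta> \<partial>lborel)
      = (\<integral>\<^sup>+\<theta>. ennreal (root_mean p f N (of_real s * cis \<theta>)) * indicator {0..2*pi} \<theta> \<partial>lborel) + (\<integral>\<^sup>+\<theta>. ennreal \<epsilon> * indicator {0..2*pi} \<theta> \<partial>lborel)"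
      unfolding eq by (rule nn_integral_add) (unfold root_mean_def, measurable)
    also have "(\<integral>\<^sup>+\<theta>. ennreal \<epsilon> * indicator {0..2*pi} \<theta> \<partial>lborel) = ennreal (\<epsilon> * (2 * pi))"
      using \<epsilon> by (subst nn_integral_cmult_indicator) (auto simp: ennreal_mult)
    finally show ?thesis using circle_mean_root_mean[OF f s0 s(3) N(1), of p] \<epsilon>
      by (simp add: ring_distribs ennreal_mult[symmetric])
  qed
  finally show "circle_mean p f \<rho> \<le> circle_mean p f s + ennreal \<epsilon>" .
qed

lemma circle_mean_0: "circle_mean p f 0 = ennreal (norm (f 0) powr p)"
  unfolding circle_mean_def by (simp add: nn_integral_cmult_indicator ennreal_mult[symmetric] mult_ac flip: ennreal_mult'')

lemma circle_mean_finite: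
  assumes f: "f holomorphic_on ball 0 1" and s: "0 \<le> s" "s < 1" and p: "0 < p"
  shows "circle_mean p f s < \<infinity>"
proof -
  have "compact ((\<lambda>z. norm (f z)) ` cball 0 s)"
    by (intro compact_continuous_image continuous_intros continuous_on_subset[OF holomorphic_on_imp_continuous_on[OF f]])
      (use s in auto)
  then obtain B where B: "\<And>z. z \<in> cball 0 s \<Longrightarrow> norm (f z) \<le> B"
    by (metis bounded_real compact_imp_bounded image_eqI norm_imp_pos_and_ge abs_of_nonneg)
  have "circle_mean p f s \<le> ennreal (1 / (2 * pi)) * (\<integral>\<^sup>+\<theta>\<in>{0..2*pi}. ennreal (B powr p) \<partial>lborel)"
    unfolding circle_mean_def
    by (intro mult_left_mono nn_integral_mono mult_right_mono ennreal_leI powr_mono2 B) (use s p in \<open>auto simp: norm_mult\<close>)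
  also have "\<dots> < \<infinity>" by (subst nn_integral_cmult_indicator) (auto simp: ennreal_mult_less_top)
  finally show ?thesis .
qed

lemma circle_mean_real:
  assumes "f holomorphic_on ball 0 1" "0 \<le> s" "s < 1" "0 < p"
  shows "ennreal (enn2real (circle_mean p f s)) = circle_mean p f s"
  using circle_mean_finite[OF assms] by simp

section \<open>Pointwise bounds and change of exponent for circle means\<close>

lemma nn_integral_scale_complex:
  fixes F :: "complex \<Rightarrow> ennreal"
  assumes [measurable]: "F \<in> borel_measurable borel" and d: "\<delta> > 0"
  shows "(\<integral>\<^sup>+z. F (w + of_real \<delta> * z) \<partial>lborel) = ennreal (1 / \<delta>\<^sup>2) * (\<integral>\<^sup>+z. F z \<partial>lborel)"
proof -
  have "(\<integral>\<^sup>+z. F z \<partial>lborel) = ennreal (\<delta>\<^sup>2) * (\<integral>\<^sup>+z. F (w + \<delta> *\<^sub>R z) \<partial>lborel)"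
    using d by (subst lborel_affine[of \<delta> w]) (auto simp: nn_integral_density nn_integral_distr nn_integral_cmult)
  then have "ennreal (1 / \<delta>\<^sup>2) * (\<integral>\<^sup>+z. F z \<partial>lborel) = (\<integral>\<^sup>+z. F (w + \<delta> *\<^sub>R z) \<partial>lborel)"
    using d by (simp add: mult.assoc[symmetric] ennreal_mult[symmetric])
  then show ?thesis by (simp add: scaleR_conv_of_real)
qed

text \<open>Monotonicity from radius 0, applied to f recentred at w and integrated, bounds \<pi>
  \<delta>^2 |f w|^p by the area integral of |f|^p over the disc of radius \<delta> about w. That
  disc lies in the annulus between |w| - \<delta> and |w| + \<delta>, of width 2 \<delta>, whose
  integral is at most 4 \<pi> \<delta> times the outer circle mean. The quotient is 4 /
  \<delta>.\<close>

theorem pointwise_le_circle_mean: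
  assumes f: "f holomorphic_on ball 0 1" and p: "0 < p" and d: "0 < \<delta>" "norm w + \<delta> < 1"
  shows "ennreal (norm (f w) powr p) \<le> ennreal (4 / \<delta>) * circle_mean p f (norm w + \<delta>)"
proof -
  define R where "R = norm w + \<delta>"
  \<comment> \<open>Possibly negative; the interval from a to R has length 2 \<delta> in any case,
    and only an upper bound is wanted.\<close>
  define a where "a = norm w - \<delta>"
  define k where "k s = (indicator {a..R} s :: ennreal)" for s :: real
  have [measurable]: "k \<in> borel_measurable borel" unfolding k_def by measurable
  have [measurable]: "ball (0::complex) 1 \<in> sets borel" by simp
  define f' where "f' z = indicator (ball 0 1) z *\<^sub>R f z" for z
  have [measurable]: "f' \<in> borel_measurable borel"
    using borel_measurable_disc_extension[OF holomorphic_on_imp_continuous_on[OF f]] unfolding f'_def .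
  define g where "g z = f (w + of_real \<delta> * z)" for z
  have inD: "norm (w + of_real \<delta> * z) < R" if "norm z < 1" for z
  proof -
    have "norm (w + of_real \<delta> * z) \<le> norm w + \<delta> * norm z" using d norm_triangle_ineq[of w "of_real \<delta> * z"] by (simp add: norm_mult)
    also have "\<dots> < R" using that d by (simp add: R_def)
    finally show ?thesis .
  qed
  have inD2: "a \<le> norm (w + of_real \<delta> * z)" if "norm z < 1" for z
  proof -
    have "norm w \<le> norm (w + of_real \<delta> * z) + \<delta> * norm z"
      using d norm_triangle_ineq4[of "w + of_real \<delta> * z" "of_real \<delta> * z"] by (simp add: norm_mult)
    moreover have "\<delta> * norm z \<le> \<delta> * 1" using that d by (intro mult_left_mono) auto
    ultimately show ?thesis by (simp add: a_def)
  qed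
  have R1: "R < 1" "0 < R" using d norm_ge_zero[of w] by (simp_all add: R_def add_nonneg_pos)
  have hg: "g holomorphic_on ball 0 1" unfolding g_def
    by (rule holomorphic_on_compose_gen[of "\<lambda>z. w + of_real \<delta> * z" _ f, unfolded comp_def, OF _ f])
      (use inD R1 in \<open>force intro!: holomorphic_intros\<close>)+
  have "ennreal pi * ennreal (norm (f w) powr p) = ennreal (2 * pi) * (\<integral>\<^sup>+s\<in>{0<..<1}. ennreal s * ennreal (norm (f w) powr p) \<partial>lborel)"
  proof -
    have "(\<integral>\<^sup>+s\<in>{0<..<1}. ennreal s * ennreal (norm (f w) powr p) \<partial>lborel)
      = (\<integral>\<^sup>+s. ennreal s * indicator {0..1} s * ennreal (norm (f w) powr p) \<partial>lborel)"
    proof (rule nn_integral_cong_AE)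
      have "AE s in lborel. s \<noteq> 0 \<and> s \<noteq> (1::real)" by (intro AE_conjI AE_lborel_singleton)
      then show "AE s in lborel. ennreal s * ennreal (norm (f w) powr p) * indicator {0<..<1} s = ennreal s * indicator {0..1} s * ennreal (norm (f w) powr p)"
        by eventually_elim (auto simp: indicator_def)
    qed
    also have "\<dots> = (\<integral>\<^sup>+s. ennreal s * indicator {0..1} s \<partial>lborel) * ennreal (norm (f w) powr p)"
      by (rule nn_integral_multc) measurable
    also have "(\<integral>\<^sup>+s. ennreal s * indicator {0..1} s \<partial>lborel) = ennreal (1\<^sup>2 / 2 - 0\<^sup>2 / 2)"
      by (rule nn_integral_FTC_Icc) (auto intro!: derivative_eq_intros)
    finally have "ennreal (2 * pi) * (\<integral>\<^sup>+s\<in>{0<..<1}. ennreal s * ennreal (norm (f w) powr p) \<partial>lborel) =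
      ennreal (2 * pi) * (ennreal (1\<^sup>2 / 2 - 0\<^sup>2 / 2) * ennreal (norm (f w) powr p))" by (rule arg_cong)
    also have "\<dots> = ennreal (2 * pi * (1\<^sup>2 / 2 - 0\<^sup>2 / 2)) * ennreal (norm (f w) powr p)"
      unfolding mult.assoc[symmetric] by (subst ennreal_mult) auto
    finally show ?thesis by simp
  qed
  also have "\<dots> \<le> ennreal (2 * pi) * (\<integral>\<^sup>+s\<in>{0<..<1}. ennreal s * circle_mean p g s * 1 \<partial>lborel)"
  proof (intro mult_left_mono nn_integral_mono)
    fix s :: real
    have "ennreal (norm (f w) powr p) \<le> circle_mean p g s" if "s \<in> {0<..<1}"
      using circle_mean_mono[OF hg p, of 0 s] that circle_mean_0[of p g] by (simp add: g_def)
    then show "ennreal s * ennreal (norm (f w) powr p) * indicator {0<..<1} s \<le> ennreal s * circle_mean p g s * 1 * indicator {0<..<1} s"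
      by (auto simp: indicator_def intro!: mult_left_mono)
  qed simp
  also have "\<dots> = (\<integral>\<^sup>+z\<in>ball 0 1. ennreal (norm (g z) powr p) * 1 \<partial>lborel)"
    by (rule disc_integral_polar[OF _ holomorphic_on_imp_continuous_on[OF hg], symmetric, of "\<lambda>_. 1"]) simp
  also have "\<dots> \<le> (\<integral>\<^sup>+z. ennreal (norm (f' (w + of_real \<delta> * z)) powr p) * k (norm (w + of_real \<delta> * z)) * indicator (ball 0 1) (w + of_real \<delta> * z) \<partial>lborel)"
  proof (rule nn_integral_mono)
    fix z :: complex
    show "ennreal (norm (g z) powr p) * 1 * indicator (ball 0 1) z
      \<le> ennreal (norm (f' (w + of_real \<delta> * z)) powr p) * k (norm (w + of_real \<delta> * z)) * indicator (ball 0 1) (w + of_real \<delta> * z)"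
      using inD[of z] inD2[of z] R1 by (cases "norm z < 1") (auto simp: g_def f'_def k_def)
  qed
  also have "\<dots> = ennreal (1 / \<delta>\<^sup>2) * (\<integral>\<^sup>+z. ennreal (norm (f' z) powr p) * k (norm z) * indicator (ball 0 1) z \<partial>lborel)"
    by (rule nn_integral_scale_complex[OF _ d(1)]) measurable
  also have "(\<integral>\<^sup>+z. ennreal (norm (f' z) powr p) * k (norm z) * indicator (ball 0 1) z \<partial>lborel)
     = (\<integral>\<^sup>+z\<in>ball 0 1. ennreal (norm (f z) powr p) * k (norm z) \<partial>lborel)"
    by (intro nn_integral_cong) (auto simp: f'_def indicator_def)
  also have "\<dots> = ennreal (2 * pi) * (\<integral>\<^sup>+s\<in>{0<..<1}. ennreal s * circle_mean p f s * k s \<partial>lborel)"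
    by (rule disc_integral_polar[OF _ holomorphic_on_imp_continuous_on[OF f]]) measurable
  also have "(\<integral>\<^sup>+s\<in>{0<..<1}. ennreal s * circle_mean p f s * k s \<partial>lborel) \<le> (\<integral>\<^sup>+s. circle_mean p f R * indicator {a..R} s \<partial>lborel)"
  proof (rule nn_integral_mono)
    fix s :: real
    have "ennreal s * circle_mean p f s \<le> 1 * circle_mean p f R" if "0 < s" "s \<le> R"
      using that R1 by (intro mult_mono circle_mean_mono[OF f p]) auto
    then show "ennreal s * circle_mean p f s * k s * indicator {0<..<1} s \<le> circle_mean p f R * indicator {a..R} s"
      by (auto simp: k_def indicator_def)
  qed
  also have "(\<integral>\<^sup>+s. circle_mean p f R * indicator {a..R} s \<partial>lborel) = circle_mean p f R * ennreal (2 * \<delta>)"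
    using d by (subst nn_integral_cmult_indicator) (auto simp: a_def R_def)
  finally have "ennreal pi * ennreal (norm (f w) powr p) \<le> ennreal (1 / \<delta>\<^sup>2) * (ennreal (2 * pi) * (circle_mean p f R * ennreal (2 * \<delta>)))"
    by (simp add: mult_left_mono)
  also have "\<dots> = ennreal pi * (ennreal (4 / \<delta>) * circle_mean p f R)"
  proof -
    have "ennreal (1 / \<delta>\<^sup>2) * (ennreal (2 * pi) * (circle_mean p f R * ennreal (2 * \<delta>))) =
      (ennreal (1 / \<delta>\<^sup>2) * ennreal (2 * pi) * ennreal (2 * \<delta>)) * circle_mean p f R" by (simp add: mult_ac)
    also have "ennreal (1 / \<delta>\<^sup>2) * ennreal (2 * pi) * ennreal (2 * \<delta>) = ennreal (pi * (4 / \<delta>))"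
      using d by (simp add: ennreal_mult[symmetric] power2_eq_square)
    also have "ennreal (pi * (4 / \<delta>)) = ennreal pi * ennreal (4 / \<delta>)" using d by (intro ennreal_mult) auto
    finally show ?thesis by (simp only: mult.assoc)
  qed
  finally show ?thesis using ennreal_mult_le_mult_iff[of "ennreal pi"] by (simp add: R_def)
qed

text \<open>Write |f|^q as (|f|^p)^(q/p - 1) times |f|^p and bound the first factor by the pointwise
  estimate at radius s + \<delta>; p <= q makes its exponent nonnegative.\<close>

lemma circle_mean_exponent:
  assumes f: "f holomorphic_on ball 0 1" and p: "0 < p" "p \<le> q" and d: "0 < \<delta>" "0 \<le> s" "s + \<delta> < 1"
  shows "circle_mean q f s \<le> ennreal ((4 / \<delta>) powr (q / p - 1) * enn2real (circle_mean p f (s + \<delta>)) powr (q / p))"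
proof -
  define P where "P = enn2real (circle_mean p f (s + \<delta>))"
  have P: "circle_mean p f (s + \<delta>) = ennreal P" "0 \<le> P" using circle_mean_real[OF f, of "s + \<delta>" p] d p by (auto simp: P_def)
  define A where "A = 4 / \<delta> * P"
  have A: "0 \<le> A" using d P by (simp add: A_def)
  have b: "norm (f w) powr q \<le> A powr (q / p - 1) * norm (f w) powr p" if "norm w = s" for w
  proof -
    have "ennreal (norm (f w) powr p) \<le> ennreal (4 / \<delta>) * ennreal P"
      using pointwise_le_circle_mean[OF f p(1), of \<delta> w] d that P by simp
    then have le: "norm (f w) powr p \<le> A" using P d by (simp add: A_def ennreal_mult[symmetric])
    have "norm (f w) powr q = (norm (f w) powr p) powr (q / p - 1) * norm (f w) powr p"
      using p by (simp add: powr_powr powr_add[symmetric] field_simps)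
    also have "\<dots> \<le> A powr (q / p - 1) * norm (f w) powr p"
      using p le by (intro mult_right_mono powr_mono2) auto
    finally show ?thesis .
  qed
  define f' where "f' z = indicator (ball 0 1) z *\<^sub>R f z" for z
  have [measurable]: "f' \<in> borel_measurable borel"
    using borel_measurable_disc_extension[OF holomorphic_on_imp_continuous_on[OF f]] unfolding f'_def .
  have eq: "norm (f (of_real s * cis t)) = norm (f' (of_real s * cis t))" for t
    using d by (simp add: f'_def norm_mult)
  have "circle_mean q f s \<le> ennreal (1 / (2 * pi)) * (\<integral>\<^sup>+\<theta>. ennreal (A powr (q / p - 1)) *
      (ennreal (norm (f (of_real s * cis \<theta>)) powr p) * indicator {0..2*pi} \<theta>) \<partial>lborel)"
    unfolding circle_mean_def
    by (intro mult_left_mono nn_integral_mono) (use b d in \<open>auto simp: indicator_def ennreal_mult[symmetric] norm_mult intro!: ennreal_leI\<close>)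
  also have "\<dots> = ennreal (A powr (q / p - 1)) * circle_mean p f s"
    unfolding circle_mean_def eq by (subst nn_integral_cmult) (auto simp: mult_ac)
  also have "\<dots> \<le> ennreal (A powr (q / p - 1)) * ennreal P"
    unfolding P(1)[symmetric] using d by (intro mult_left_mono circle_mean_mono[OF f p(1)]) auto
  also have "\<dots> = ennreal ((4 / \<delta>) powr (q / p - 1) * P powr (q / p))"
  proof -
    have "P powr (q / p) = P powr (q / p - 1) * P"
    proof (cases "P = 0")
      case False
      then have "P powr (q / p) = P powr ((q / p - 1) + 1)" by simp
      also have "\<dots> = P powr (q / p - 1) * P powr 1" by (rule powr_add)
      finally show ?thesis using P(2) by simp
    qed (use p in simp)
    moreover have "A powr (q / p - 1) = (4 / \<delta>) powr (q / p - 1) * P powr (q / p - 1)"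
      unfolding A_def by (rule powr_mult)
    ultimately have "(4 / \<delta>) powr (q / p - 1) * P powr (q / p) = A powr (q / p - 1) * P" by simp
    then show ?thesis using P(2) by (simp add: ennreal_mult)
  qed
  finally show ?thesis by (simp add: P_def)
qed

section \<open>Doubling tails, moments and the kernel\<close>

lemma power_le_fact_exp:
  fixes y :: real
  assumes "0 \<le> y"
  shows "y ^ k \<le> fact k * exp y"
proof -
  have "(\<Sum>n\<in>{k}. y ^ n /\<^sub>R fact n) \<le> exp y"
    unfolding exp_def by (rule sum_le_suminf[OF summable_exp_generic]) (use assms in auto)
  then show ?thesis by (simp add: field_simps)
qed

text \<open>A form of (1 + 1/n)^n <= e. It gives s^n >= 1/e for s >= 1 - 1/(n + 1), the lower half
  of the comparison of moments with tails.\<close>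

lemma one_minus_power_ge: "exp (-1) \<le> (1 - 1 / real (n + 1)) ^ n"
proof (cases "n = 0")
  case False
  have "1 + 1 / real n \<le> exp (1 / real n)" by simp
  then have "(1 + 1 / real n) ^ n \<le> exp (1 / real n) ^ n" by (intro power_mono) auto
  also have "\<dots> = exp 1" using False by (simp add: exp_of_nat_mult[symmetric])
  finally have "exp (-1) \<le> inverse ((1 + 1 / real n) ^ n)"
    unfolding exp_minus using False by (intro le_imp_inverse_le zero_less_power add_pos_pos) auto
  also have "\<dots> = (1 - 1 / real (n + 1)) ^ n"
    unfolding power_inverse[symmetric] using False by (intro arg_cong2[where f=power] refl) (simp add: field_simps)
  finally show ?thesis .
qed simp

text \<open>s^n decays like exp(-n (1 - s)), and the exponential beats every power of 1 + (n + 1)(1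
  - s), the reciprocal of x / (x + (1 - s)). Moments are thus dominated by integrals of kernels of
  any polynomial order, which can be summed dyadically.\<close>

lemma power_le_kernel:
  fixes s :: real
  assumes s: "0 \<le> s" "s \<le> 1" and x: "x = 1 / real (n + 1)"
  shows "s ^ n \<le> fact k * exp 2 * (x / (x + (1 - s))) ^ k"
proof -
  define y where "y = 1 + real (n + 1) * (1 - s)"
  have y: "1 \<le> y" using s by (simp add: y_def)
  have q: "x / (x + (1 - s)) = 1 / y" using s unfolding x y_def by (simp add: field_simps)
  have "s \<le> exp (- (1 - s))" using exp_ge_add_one_self[of "- (1 - s)"] by simp
  then have "s ^ n \<le> exp (- (1 - s)) ^ n" using s by (intro power_mono)
  also have "\<dots> = exp (- (real n * (1 - s)))" by (simp add: exp_of_nat_mult[symmetric] algebra_simps)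
  finally have 1: "s ^ n \<le> exp (- (real n * (1 - s)))" .
  \<comment> \<open>The base exceeds 1 + n (1 - s) by 1 - s <= 1; the resulting 2 is the origin of
    \<open>exp 2\<close>.\<close>
  have "y ^ k \<le> (2 + real n * (1 - s)) ^ k" using y s by (intro power_mono) (auto simp: y_def algebra_simps)
  also have "\<dots> \<le> fact k * exp (2 + real n * (1 - s))" by (rule power_le_fact_exp) (use s in auto)
  finally have 2: "y ^ k \<le> fact k * exp (2 + real n * (1 - s))" .
  have "s ^ n * y ^ k \<le> exp (- (real n * (1 - s))) * (fact k * exp (2 + real n * (1 - s)))"
    using 1 2 y s by (intro mult_mono) auto
  also have "\<dots> = fact k * exp 2" by (simp add: exp_add exp_minus)
  finally have "s ^ n \<le> fact k * exp 2 / y ^ k" using y by (simp add: pos_le_divide_eq)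
  then show ?thesis unfolding q by (simp add: power_inverse divide_inverse)
qed

text \<open>Dyadic decomposition: \<open>j\<close> is the index of the shell \<open>2\<^sup>j\<^sup>-\<^sup>1 x < 1 - s \<le> 2\<^sup>j x\<close>.\<close>

lemma kernel_le_dyadic:
  fixes s x :: real
  assumes x: "x > 0" and s: "s \<le> 1"
  shows "ennreal ((x / (x + (1 - s))) ^ k) \<le> ennreal (2 ^ k) * (\<Sum>j. ennreal ((1 / 2 ^ k) ^ j) * indicator {1 - 2 ^ j * x..} s)"
proof -
  obtain n where n: "(1 - s) / x < 2 ^ n" using real_arch_pow[of 2 "(1 - s) / x"] by auto
  define j where "j = (LEAST j. 1 - s \<le> 2 ^ j * x)"
  have ex: "1 - s \<le> 2 ^ n * x" using n x by (simp add: field_simps)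
  have j: "1 - s \<le> 2 ^ j * x" unfolding j_def by (rule LeastI[of "\<lambda>j. 1 - s \<le> 2 ^ j * x" n, OF ex])
  have "(x / (x + (1 - s))) ^ k \<le> 2 ^ k * (1 / 2 ^ k) ^ j"
  proof (cases j)
    case 0
    have "(x / (x + (1 - s))) ^ k \<le> 1" using x s by (intro power_le_one) (auto simp: field_simps)
    also have "1 \<le> (2::real) ^ k" by simp
    finally show ?thesis using 0 by simp
  next
    case (Suc i)
    have "\<not> 1 - s \<le> 2 ^ i * x" using not_less_Least[of i "\<lambda>j. 1 - s \<le> 2 ^ j * x"] Suc by (simp add: j_def)
    then have "2 ^ i * x \<le> x + (1 - s)" using x by linarith
    then have "x / (x + (1 - s)) \<le> 1 / 2 ^ i" using x s by (simp add: field_simps)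
    then have "(x / (x + (1 - s))) ^ k \<le> (1 / 2 ^ i) ^ k" using x s by (intro power_mono) auto
    also have "\<dots> = 2 ^ k * (1 / 2 ^ k) ^ j" using Suc by (simp add: power_one_over power_mult[symmetric] mult.commute)
    finally show ?thesis .
  qed
  then have "ennreal ((x / (x + (1 - s))) ^ k) \<le> ennreal (2 ^ k) * (ennreal ((1 / 2 ^ k) ^ j) * indicator {1 - 2 ^ j * x..} s)"
    using j by (simp add: ennreal_mult[symmetric] ennreal_leI)
  also have "\<dots> \<le> ennreal (2 ^ k) * (\<Sum>j. ennreal ((1 / 2 ^ k) ^ j) * indicator {1 - 2 ^ j * x..} s)"
  proof (rule mult_left_mono)
    define h where "h j = ennreal ((1 / 2 ^ k) ^ j) * indicator {1 - 2 ^ j * x..} s" for j :: nat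
    have "h j \<le> suminf h" using sum_le_suminf[OF summableI, of "{j}" h] by simp
    then show "ennreal ((1 / 2 ^ k) ^ j) * indicator {1 - 2 ^ j * x..} s \<le> (\<Sum>j. ennreal ((1 / 2 ^ k) ^ j) * indicator {1 - 2 ^ j * x..} s)"
      unfolding h_def[abs_def] .
  qed simp
  finally show ?thesis .
qed

lemma nn_integral_kernel_le:
  fixes M :: "real measure"
  assumes id[measurable]: "(\<lambda>s. s) \<in> borel_measurable M" and le1: "AE s in M. s \<le> 1" and x: "x > 0" and A: "A \<ge> 0"
    and tail: "\<And>j. emeasure M {s \<in> space M. 1 - 2 ^ j * x \<le> s} \<le> ennreal (A * D ^ j)" and D: "0 \<le> D" "2 * D \<le> 2 ^ k"
  shows "(\<integral>\<^sup>+s. ennreal ((x / (x + (1 - s))) ^ k) \<partial>M) \<le> ennreal (2 ^ (k + 1) * A)"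
proof -
  have "(\<integral>\<^sup>+s. ennreal ((x / (x + (1 - s))) ^ k) \<partial>M) \<le>
     (\<integral>\<^sup>+s. ennreal (2 ^ k) * (\<Sum>j. ennreal ((1 / 2 ^ k) ^ j) * indicator {1 - 2 ^ j * x..} s) \<partial>M)"
    by (rule nn_integral_mono_AE, use le1 in eventually_elim) (rule kernel_le_dyadic[OF x])
  also have "\<dots> = ennreal (2 ^ k) * (\<Sum>j. ennreal ((1 / 2 ^ k) ^ j) * (\<integral>\<^sup>+s. indicator {1 - 2 ^ j * x..} s \<partial>M))"
    by (subst nn_integral_cmult, simp, subst nn_integral_suminf, simp, subst nn_integral_cmult, auto)
  also have "(\<lambda>j. \<integral>\<^sup>+s. indicator {1 - 2 ^ j * x..} s \<partial>M) = (\<lambda>j. emeasure M {s \<in> space M. 1 - 2 ^ j * x \<le> s})"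
  proof
    fix j
    have "(\<integral>\<^sup>+s. indicator {1 - 2 ^ j * x..} s \<partial>M) = (\<integral>\<^sup>+s. indicator {s \<in> space M. 1 - 2 ^ j * x \<le> s} s \<partial>M)"
      by (intro nn_integral_cong) (auto simp: indicator_def)
    then show "(\<integral>\<^sup>+s. indicator {1 - 2 ^ j * x..} s \<partial>M) = emeasure M {s \<in> space M. 1 - 2 ^ j * x \<le> s}" by simp
  qed
  also have "(\<Sum>j. ennreal ((1 / 2 ^ k) ^ j) * emeasure M {s \<in> space M. 1 - 2 ^ j * x \<le> s}) \<le> (\<Sum>j. ennreal (A * (1 / 2) ^ j))"
  proof (intro suminf_le summableI)
    fix j
    have "ennreal ((1 / 2 ^ k) ^ j) * emeasure M {s \<in> space M. 1 - 2 ^ j * x \<le> s} \<le> ennreal ((1 / 2 ^ k) ^ j) * ennreal (A * D ^ j)"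
      by (intro mult_left_mono tail) auto
    also have "\<dots> = ennreal (A * (D / 2 ^ k) ^ j)" using A D by (simp add: ennreal_mult[symmetric] power_divide mult_ac)
    also have "\<dots> \<le> ennreal (A * (1 / 2) ^ j)" using A D by (intro ennreal_leI mult_left_mono power_mono) (auto simp: field_simps)
    finally show "ennreal ((1 / 2 ^ k) ^ j) * emeasure M {s \<in> space M. 1 - 2 ^ j * x \<le> s} \<le> ennreal (A * (1 / 2) ^ j)" .
  qed
  also have "(\<Sum>j. ennreal (A * (1 / 2) ^ j)) = ennreal (A * 2)"
    using A by (subst suminf_ennreal2) (auto simp: suminf_mult suminf_geometric)
  finally have "(\<integral>\<^sup>+s. ennreal ((x / (x + (1 - s))) ^ k) \<partial>M) \<le> ennreal (2 ^ k) * ennreal (A * 2)" by (simp add: mult_left_mono)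
  then show ?thesis using A by (simp add: ennreal_mult[symmetric] mult_ac)
qed

lemma doubling_profileD:
  assumes "doubling_profile \<omega> g"
  shows "radial_profile \<omega> g" "integrable lborel g" "\<And>y. 0 < y \<Longrightarrow> 0 < tail_mass g y"
    "\<And>s. 0 \<le> g s" "\<And>s. s \<notin> {0<..<1} \<Longrightarrow> g s = 0" "g \<in> borel_measurable borel"
  using assms by (auto simp: doubling_profile_def radial_profile_def)

text \<open>The doubling constant is rounded up to a power of 2, so that j doublings cost (2^j)^k
  with a natural exponent k.\<close>

lemma doubling_profile_constant:
  assumes "doubling_profile \<omega> g"
  shows "\<exists>k::nat. \<forall>y j. 0 < y \<longrightarrow> tail_mass g (2 ^ j * y) \<le> (2 ^ k) ^ j * tail_mass g y"
proof -
  from assms obtain C where C: "C > 1" "\<And>y. 0 < y \<Longrightarrow> tail_mass g (2 * y) \<le> C * tail_mass g y"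
    by (auto simp: doubling_profile_def)
  obtain k where k: "C < 2 ^ k" using real_arch_pow[of 2 C] by auto
  have 1: "tail_mass g (2 * y) \<le> 2 ^ k * tail_mass g y" if "0 < y" for y
    using C(2)[OF that] mult_right_mono[of C "2 ^ k" "tail_mass g y"] k doubling_profileD(3)[OF assms that] by linarith
  have 2: "tail_mass g (2 ^ j * y) \<le> (2 ^ k) ^ j * tail_mass g y" if y: "0 < y" for y j
  proof (induction j)
    case (Suc j)
    have "tail_mass g (2 ^ Suc j * y) \<le> 2 ^ k * tail_mass g (2 ^ j * y)" using 1[of "2 ^ j * y"] y by (simp add: mult_ac)
    also have "\<dots> \<le> 2 ^ k * ((2 ^ k) ^ j * tail_mass g y)" using Suc by (intro mult_left_mono) auto
    finally show ?case by (simp add: mult_ac)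
  qed simp
  show ?thesis using 2 by blast
qed

text \<open>Take the least j with y <= 2^j z; the cost is (2^j)^k. Minimality gives 2^j < 2 y / z
  unless j = 0, and the summand 1 covers that case.\<close>

lemma tail_mass_polynomial:
  assumes g: "doubling_profile \<omega> g" and k: "\<And>y j. 0 < y \<Longrightarrow> tail_mass g (2 ^ j * y) \<le> (2 ^ k) ^ j * tail_mass g y"
    and y: "0 < y" "0 < z"
  shows "tail_mass g y \<le> (1 + 2 * y / z) ^ k * tail_mass g z"
proof -
  note mono = tail_mass_mono[OF doubling_profileD(1,2)[OF g]]
  have pos: "0 < tail_mass g z" using doubling_profileD(3)[OF g y(2)] .
  obtain n where n: "y / z < 2 ^ n" using real_arch_pow[of 2 "y / z"] by auto
  define j where "j = (LEAST j. y \<le> 2 ^ j * z)"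
  have ex: "y \<le> 2 ^ n * z" using n y by (simp add: field_simps)
  have j: "y \<le> 2 ^ j * z" unfolding j_def by (rule LeastI[of "\<lambda>j. y \<le> 2 ^ j * z" n, OF ex])
  have "2 ^ j \<le> 1 + 2 * y / z"
  proof (cases j)
    case (Suc i)
    have "\<not> y \<le> 2 ^ i * z" using not_less_Least[of i "\<lambda>j. y \<le> 2 ^ j * z"] Suc by (simp add: j_def)
    then show ?thesis using Suc y by (simp add: field_simps)
  qed (use y in simp)
  then have "(2 ^ j) ^ k \<le> (1 + 2 * y / z) ^ k" by (intro power_mono) auto
  moreover have "tail_mass g y \<le> (2 ^ k) ^ j * tail_mass g z" using mono[OF j] k[OF y(2), of j] by linarith
  moreover have "(2 ^ k :: real) ^ j = (2 ^ j) ^ k" by (simp add: power_mult[symmetric] mult.commute)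
  ultimately have "tail_mass g y \<le> (2 ^ j) ^ k * tail_mass g z" by simp
  also have "\<dots> \<le> (1 + 2 * y / z) ^ k * tail_mass g z"
    using \<open>(2 ^ j) ^ k \<le> (1 + 2 * y / z) ^ k\<close> pos by (intro mult_right_mono) auto
  finally show ?thesis .
qed

text \<open>This is \<open>nn_integral_kernel_le\<close> for the measure with density g. An order m
  above the doubling exponent k is what makes the dyadic series converge.\<close>

lemma kernel_integral_le:
  assumes g: "doubling_profile \<omega> g" and k: "\<And>y j. 0 < y \<Longrightarrow> tail_mass g (2 ^ j * y) \<le> (2 ^ k) ^ j * tail_mass g y"
    and m: "k < m" and x: "0 < x"
  shows "(\<integral>\<^sup>+s. ennreal ((x / (x + (1 - s))) ^ m) * ennreal (g s) \<partial>lborel) \<le> ennreal (2 ^ (m + 1) * tail_mass g x)"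
proof -
  note [measurable] = doubling_profileD(6)[OF g]
  note T = tail_mass_nn[OF doubling_profileD(1,2)[OF g]]
  define M where "M = density lborel (\<lambda>s. ennreal (g s))"
  have "(\<integral>\<^sup>+s. ennreal ((x / (x + (1 - s))) ^ m) * ennreal (g s) \<partial>lborel) = (\<integral>\<^sup>+s. ennreal ((x / (x + (1 - s))) ^ m) \<partial>M)"
    unfolding M_def by (subst nn_integral_density) (auto simp: mult_ac)
  also have "\<dots> \<le> ennreal (2 ^ (m + 1) * tail_mass g x)"
  proof (rule nn_integral_kernel_le[OF _ _ x T(2)])
    have "s \<le> 1" if "0 < ennreal (g s)" for s
    proof (rule ccontr)
      assume "\<not> s \<le> 1"
      then have "g s = 0" by (intro doubling_profileD(5)[OF g]) auto
      then show False using that by simp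
    qed
    then show "AE s in M. s \<le> 1" unfolding M_def by (subst AE_density) auto
    show "emeasure M {s \<in> space M. 1 - 2 ^ j * x \<le> s} \<le> ennreal (tail_mass g x * (2 ^ k) ^ j)" for j
    proof -
      have "emeasure M {s \<in> space M. 1 - 2 ^ j * x \<le> s} = (\<integral>\<^sup>+s\<in>{1 - 2 ^ j * x..}. ennreal (g s) \<partial>lborel)"
        unfolding M_def by (subst emeasure_density) (auto intro!: nn_integral_cong simp: indicator_def)
      then show ?thesis using k[OF x, of j] T(1)[of "2 ^ j * x"] by (simp add: ennreal_leI mult.commute)
    qed
    have "2 ^ (k + 1) \<le> (2::real) ^ m" using m by (intro power_increasing) auto
    then show "2 * 2 ^ k \<le> (2::real) ^ m" by simp
  qed (auto simp: M_def)
  finally show ?thesis .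
qed

lemma weight_moment_nn:
  assumes g: "doubling_profile \<omega> g"
  shows "ennreal (weight_moment \<omega> n) = (\<integral>\<^sup>+s. ennreal (s ^ n) * ennreal (g s) \<partial>lborel)" "0 \<le> weight_moment \<omega> n"
proof -
  note [measurable] = doubling_profileD(6)[OF g] and D = doubling_profileD[OF g]
  have nn: "0 \<le> s ^ n * g s" for s using D(4,5)[of s] by (cases "s \<in> {0<..<1}") auto
  have "integrable lborel (\<lambda>s. s ^ n * g s)"
  proof (rule Bochner_Integration.integrable_bound[OF D(2)])
    show "AE s in lborel. norm (s ^ n * g s) \<le> norm (g s)"
    proof (intro AE_I2)
      fix s show "norm (s ^ n * g s) \<le> norm (g s)"
        using D(4,5)[of s] power_le_one[of s n] mult_right_mono[of "s ^ n" 1 "g s"] by (cases "s \<in> {0<..<1}") auto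
    qed
  qed simp
  then have "ennreal (weight_moment \<omega> n) = (\<integral>\<^sup>+s. ennreal (s ^ n * g s) \<partial>lborel)"
    unfolding weight_moment_eq[OF D(1,2)] by (subst nn_integral_eq_integral) (use nn in auto)
  also have "\<dots> = (\<integral>\<^sup>+s. ennreal (s ^ n) * ennreal (g s) \<partial>lborel)"
    by (intro nn_integral_cong) (use D(4) in \<open>auto simp: ennreal_mult''\<close>)
  finally show "ennreal (weight_moment \<omega> n) = (\<integral>\<^sup>+s. ennreal (s ^ n) * ennreal (g s) \<partial>lborel)" .
  show "0 \<le> weight_moment \<omega> n" unfolding weight_moment_eq[OF D(1,2)] by (intro integral_nonneg_AE) (use nn in auto)
qed

text \<open>The power s^n is dominated by the kernel at scale 1/(n + 1) whose order is one above the
  doubling exponent. With \<open>weight_moment_ge\<close>, the n-th moment is comparable to the tail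
  at distance 1/(n + 1).\<close>

lemma weight_moment_le:
  assumes g: "doubling_profile \<omega> g"
  shows "\<exists>K>0. \<forall>n. weight_moment \<omega> n \<le> K * tail_mass g (1 / real (n + 1))"
proof -
  obtain k where k: "\<And>y j. 0 < y \<Longrightarrow> tail_mass g (2 ^ j * y) \<le> (2 ^ k) ^ j * tail_mass g y"
    using doubling_profile_constant[OF g] by blast
  note D = doubling_profileD[OF g] and [measurable] = doubling_profileD(6)[OF g]
  define m where "m = Suc k"
  define K where "K = fact m * exp 2 * (2::real) ^ (m + 1)"
  have "weight_moment \<omega> n \<le> K * tail_mass g (1 / real (n + 1))" for n
  proof -
    define x where "x = 1 / real (n + 1)"
    have x: "x > 0" by (simp add: x_def)
    have "ennreal (weight_moment \<omega> n) = (\<integral>\<^sup>+s. ennreal (s ^ n) * ennreal (g s) \<partial>lborel)" by (rule weight_moment_nn[OF g])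
    also have "\<dots> \<le> (\<integral>\<^sup>+s. ennreal (fact m * exp 2) * (ennreal ((x / (x + (1 - s))) ^ m) * ennreal (g s)) \<partial>lborel)"
    proof (rule nn_integral_mono)
      fix s :: real
      show "ennreal (s ^ n) * ennreal (g s) \<le> ennreal (fact m * exp 2) * (ennreal ((x / (x + (1 - s))) ^ m) * ennreal (g s))"
      proof (cases "s \<in> {0<..<1}")
        case True
        then have "ennreal (s ^ n) \<le> ennreal (fact m * exp 2) * ennreal ((x / (x + (1 - s))) ^ m)"
          using power_le_kernel[of s x n m] x by (subst ennreal_mult[symmetric]) (auto simp: x_def intro!: ennreal_leI)
        from mult_right_mono[OF this, of "ennreal (g s)"] show ?thesis by (simp add: mult_ac)
      qed (simp add: D(5))
    qed
    also have "\<dots> = ennreal (fact m * exp 2) * (\<integral>\<^sup>+s. ennreal ((x / (x + (1 - s))) ^ m) * ennreal (g s) \<partial>lborel)"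
      by (rule nn_integral_cmult) measurable
    also have "\<dots> \<le> ennreal (fact m * exp 2) * ennreal (2 ^ (m + 1) * tail_mass g x)"
      by (intro mult_left_mono kernel_integral_le[OF g k _ x]) (auto simp: m_def)
    also have "\<dots> = ennreal (K * tail_mass g x)"
      using D(3)[OF x] by (simp add: K_def ennreal_mult[symmetric] mult_ac)
    finally show ?thesis using D(3)[OF x] by (simp add: x_def K_def)
  qed
  moreover have "K > 0" by (simp add: K_def)
  ultimately show ?thesis by blast
qed

text \<open>On the tail from 1 - 1/(n + 1) on, the factor s^n is at least 1/e.\<close>

lemma weight_moment_ge:
  assumes g: "doubling_profile \<omega> g"
  shows "tail_mass g (1 / real (n + 1)) \<le> exp 1 * weight_moment \<omega> n" "0 < weight_moment \<omega> n"
proof -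
  note D = doubling_profileD[OF g] and [measurable] = doubling_profileD(6)[OF g]
  define x where "x = 1 / real (n + 1)"
  have x: "x > 0" "x \<le> 1" by (auto simp: x_def)
  have "ennreal (exp (-1) * tail_mass g x) = ennreal (exp (-1)) * (\<integral>\<^sup>+s\<in>{1-x..}. ennreal (g s) \<partial>lborel)"
    using tail_mass_nn[OF D(1,2)] by (simp add: ennreal_mult)
  also have "\<dots> = (\<integral>\<^sup>+s. ennreal (exp (-1)) * (ennreal (g s) * indicator {1-x..} s) \<partial>lborel)"
    by (rule nn_integral_cmult[symmetric]) measurable
  also have "\<dots> \<le> (\<integral>\<^sup>+s. ennreal (s ^ n) * ennreal (g s) \<partial>lborel)"
  proof (rule nn_integral_mono)
    fix s :: real
    have "exp (-1) \<le> s ^ n" if "1 - x \<le> s"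
      using one_minus_power_ge[of n] power_mono[OF that, of n] x by (simp add: x_def)
    then show "ennreal (exp (-1)) * (ennreal (g s) * indicator {1-x..} s) \<le> ennreal (s ^ n) * ennreal (g s)"
      by (auto simp: indicator_def intro!: mult_right_mono ennreal_leI)
  qed
  also have "\<dots> = ennreal (weight_moment \<omega> n)" by (rule weight_moment_nn(1)[OF g, symmetric])
  finally have le: "exp (-1) * tail_mass g x \<le> weight_moment \<omega> n" using weight_moment_nn(2)[OF g] by simp
  then show "tail_mass g (1 / real (n + 1)) \<le> exp 1 * weight_moment \<omega> n" by (simp add: x_def exp_minus field_simps)
  have "0 < exp (-1) * tail_mass g x" using D(3)[OF x(1)] by simp
  then show "0 < weight_moment \<omega> n" using le by linarith
qed

section \<open>Size of the kernel on the radius\<close>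

definition kernel_real :: "(complex \<Rightarrow> real) \<Rightarrow> real \<Rightarrow> real" where
  "kernel_real \<omega> x = (\<Sum>n. x ^ n / (2 * weight_moment \<omega> (2 * n + 1)))"

text \<open>With y = 1 - x, the n-th coefficient is at most a power of 1 + 4 (n + 1) y, up to a
  constant, over the tail at y, while x^n <= exp(-n y). Half of this exponential absorbs the
  polynomial; the other half is the geometric sequence r^n, whose sum is of order 1 / y.\<close>

lemma kernel_real_le:
  assumes g: "doubling_profile \<omega> g"
  shows "\<exists>K>0. \<forall>x. 0 \<le> x \<longrightarrow> x < 1 \<longrightarrow> summable (\<lambda>n. x ^ n / (2 * weight_moment \<omega> (2 * n + 1))) \<and>
    kernel_real \<omega> x \<le> K / ((1 - x) * tail_mass g (1 - x))"
proof -
  obtain k where k: "\<And>y j. 0 < y \<Longrightarrow> tail_mass g (2 ^ j * y) \<le> (2 ^ k) ^ j * tail_mass g y"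
    using doubling_profile_constant[OF g] by blast
  note D = doubling_profileD[OF g]
  define K0 where "K0 = 8 ^ k * fact k * exp (5/8) * exp (1::real) / 2"
  have K0: "K0 > 0" by (simp add: K0_def)
  have main: "summable (\<lambda>n. x ^ n / (2 * weight_moment \<omega> (2 * n + 1)))"
    "kernel_real \<omega> x \<le> 4 * K0 / ((1 - x) * tail_mass g (1 - x))" if x: "0 \<le> x" "x < 1" for x
  proof -
    define y where "y = 1 - x"
    have y: "0 < y" "y \<le> 1" using x by (auto simp: y_def)
    define r where "r = exp (- (y / 2))"
    have r: "0 < r" "r < 1" using y by (auto simp: r_def)
    have Ty: "0 < tail_mass g y" using D(3)[OF y(1)] .
    have b: "x ^ n / (2 * weight_moment \<omega> (2 * n + 1)) \<le> K0 / tail_mass g y * r ^ n" for n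
    proof -
      define z where "z = 1 / real (2 * n + 1 + 1)"
      have z: "0 < z" by (simp add: z_def)
      have Tz: "0 < tail_mass g z" using D(3)[OF z] .
      have mz: "tail_mass g z \<le> exp 1 * weight_moment \<omega> (2 * n + 1)" unfolding z_def by (rule weight_moment_ge(1)[OF g])
      have "tail_mass g y \<le> (1 + 2 * y / z) ^ k * tail_mass g z" by (rule tail_mass_polynomial[OF g k y(1) z])
      \<comment> \<open>Extracting 8 makes the exponential bound for the k-th power cost exp((n + 1)
        y / 2), half of the available decay. Replacing n + 1 by n in it then turns 1/8 into 5/8, as
        y <= 1.\<close>
      also have "1 + 2 * y / z = 8 * (1 / 8 + (real n + 1) * y / 2)" by (simp add: z_def algebra_simps)
      also have "(8 * (1 / 8 + (real n + 1) * y / 2)) ^ k \<le> 8 ^ k * (fact k * exp (1 / 8 + (real n + 1) * y / 2))"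
        unfolding power_mult_distrib using y by (intro mult_left_mono power_le_fact_exp) auto
      finally have 1: "tail_mass g y \<le> 8 ^ k * (fact k * exp (1 / 8 + (real n + 1) * y / 2)) * tail_mass g z"
        using Tz by (simp add: mult_right_mono)
      have "exp (1 / 8 + (real n + 1) * y / 2) \<le> exp (5/8 + real n * y / 2)"
      proof -
        have "(real n + 1) * y / 2 = real n * y / 2 + y / 2" by (simp add: field_simps)
        then have "1 / 8 + (real n + 1) * y / 2 \<le> 5 / 8 + real n * y / 2" using y by linarith
        then show ?thesis by (simp only: exp_le_cancel_iff)
      qed
      also have "\<dots> = exp (5/8) * exp (real n * y / 2)" by (rule exp_add)
      finally have 2: "exp (1 / 8 + (real n + 1) * y / 2) \<le> exp (5/8) * exp (real n * y / 2)" .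
      have "tail_mass g y \<le> 8 ^ k * (fact k * (exp (5/8) * exp (real n * y / 2))) * (exp 1 * weight_moment \<omega> (2 * n + 1))"
        using order_trans[OF 1 mult_mono[OF mult_left_mono[OF mult_left_mono[OF 2]] mz]] Tz by simp
      also have "\<dots> = K0 * (2 * weight_moment \<omega> (2 * n + 1)) * exp (real n * y / 2)" by (simp add: K0_def)
      finally have 3: "tail_mass g y \<le> K0 * (2 * weight_moment \<omega> (2 * n + 1)) * exp (real n * y / 2)" .
      have w: "0 < weight_moment \<omega> (2 * n + 1)" by (rule weight_moment_ge(2)[OF g])
      have "x \<le> exp (- y)" using exp_ge_add_one_self[of "- y"] by (simp add: y_def)
      then have "x ^ n \<le> exp (- y) ^ n" using x by (intro power_mono)
      also have "\<dots> = r ^ n * exp (- (real n * y / 2))"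
        by (simp add: r_def exp_of_nat_mult[symmetric] exp_add[symmetric])
      finally have "x ^ n * tail_mass g y \<le> (r ^ n * exp (- (real n * y / 2))) * (K0 * (2 * weight_moment \<omega> (2 * n + 1)) * exp (real n * y / 2))"
        using 3 r x Ty by (intro mult_mono) auto
      also have "\<dots> = r ^ n * K0 * (2 * weight_moment \<omega> (2 * n + 1))" by (simp add: exp_minus field_simps)
      finally show ?thesis using w Ty by (simp add: field_simps)
    qed
    have sr: "summable (\<lambda>n. K0 / tail_mass g y * r ^ n)" using r by (intro summable_mult summable_geometric) auto
    have nn: "0 \<le> x ^ n / (2 * weight_moment \<omega> (2 * n + 1))" for n using x weight_moment_nn(2)[OF g] by auto
    show s: "summable (\<lambda>n. x ^ n / (2 * weight_moment \<omega> (2 * n + 1)))"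
    proof (rule summable_comparison_test'[OF sr, of 0])
      fix n show "norm (x ^ n / (2 * weight_moment \<omega> (2 * n + 1))) \<le> K0 / tail_mass g y * r ^ n"
        unfolding real_norm_def abs_of_nonneg[OF nn] by (rule b)
    qed
    have "kernel_real \<omega> x \<le> (\<Sum>n. K0 / tail_mass g y * r ^ n)" unfolding kernel_real_def by (rule suminf_le[OF b s sr])
    also have "\<dots> = K0 / tail_mass g y * (1 / (1 - r))" using r by (subst suminf_mult) (auto simp: suminf_geometric summable_geometric)
    also have "\<dots> \<le> K0 / tail_mass g y * (4 / y)"
    proof (intro mult_left_mono)
      \<comment> \<open>From here 1 - r >= y / 4 is derived, which bounds the sum of the geometric
        series by 4 / y.\<close>
      have "1 + y / 2 \<le> exp (y / 2)" by simp
      then have "r * (1 + y / 2) \<le> r * exp (y / 2)" using r by (intro mult_left_mono) auto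
      also have "\<dots> = 1" by (simp add: r_def exp_minus)
      finally have "r * (1 + y / 2) \<le> 1" .
      moreover have "(1 - y / 4) * (1 + y / 2) \<ge> 1" using y mult_left_mono[of y 1 y] by (simp add: algebra_simps)
      ultimately have "r * (1 + y / 2) \<le> (1 - y / 4) * (1 + y / 2)" by simp
      then have "r \<le> 1 - y / 4" using y by (simp add: mult_le_cancel_right)
      then show "1 / (1 - r) \<le> 4 / y" using y r by (simp add: field_simps)
    qed (use K0 Ty in auto)
    finally show "kernel_real \<omega> x \<le> 4 * K0 / ((1 - x) * tail_mass g (1 - x))" by (simp add: y_def field_simps)
  qed
  show ?thesis by (intro exI[of _ "4 * K0"]) (use K0 main in auto)
qed

text \<open>Keep only the terms with N div 2 <= n < N, where N is the integer part of 1 / y and y =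
  1 - x. There x^n >= 1/e because n < N, the moment of order 2 n + 1 is at most a multiple of the
  tail at y because 2 n + 2 exceeds 1 / y, and at least 1 / (4 y) such terms exist.\<close>

lemma kernel_real_ge:
  assumes g: "doubling_profile \<omega> g"
  shows "\<exists>c>0. \<forall>x. 0 \<le> x \<longrightarrow> x < 1 \<longrightarrow> c / ((1 - x) * tail_mass g (1 - x)) \<le> kernel_real \<omega> x"
proof -
  obtain K where K: "K > 0" "\<And>n. weight_moment \<omega> n \<le> K * tail_mass g (1 / real (n + 1))" 
    using weight_moment_le[OF g] by blast
  note D = doubling_profileD[OF g]
  note mono = tail_mass_mono[OF D(1,2)]
  define c where "c = exp (-1) / (8 * K)"
  have "c / ((1 - x) * tail_mass g (1 - x)) \<le> kernel_real \<omega> x" if x: "0 \<le> x" "x < 1" for x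
  proof -
    define y where "y = 1 - x"
    have y: "0 < y" "y \<le> 1" using x by (auto simp: y_def)
    have Ty: "0 < tail_mass g y" using D(3)[OF y(1)] .
    define N where "N = nat \<lfloor>1 / y\<rfloor>"
    have "1 \<le> 1 / y" using y by simp
    then have N: "real N \<le> 1 / y" "1 / y < real N + 1" "1 \<le> N" unfolding N_def by linarith+
    have s: "summable (\<lambda>n. x ^ n / (2 * weight_moment \<omega> (2 * n + 1)))" using kernel_real_le[OF g] x by blast
    have b: "exp (-1) / (2 * (K * tail_mass g y)) \<le> x ^ n / (2 * weight_moment \<omega> (2 * n + 1))" if n: "n \<in> {N div 2..<N}" for n
    proof (rule frac_le)
      have "1 - 1 / real (N - 1 + 1) \<le> x"
      proof -
        have "real N * y \<le> 1" using N(1) y by (simp add: field_simps)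
        then have "y \<le> 1 / real N" using N(3) by (simp add: field_simps)
        then show ?thesis using N(3) by (simp add: y_def)
      qed
      moreover have "0 \<le> 1 - 1 / real (N - 1 + 1)" by simp
      ultimately have "(1 - 1 / real (N - 1 + 1)) ^ (N - 1) \<le> x ^ (N - 1)" by (intro power_mono)
      also have "\<dots> \<le> x ^ n" using n x by (intro power_decreasing) auto
      finally show "exp (-1) \<le> x ^ n" using one_minus_power_ge[of "N - 1"] by linarith
      have "real N + 1 \<le> real (2 * n + 1 + 1)" using n by (auto simp flip: of_nat_Suc)
      then have "1 / y \<le> real (2 * n + 1 + 1)" using N(2) by linarith
      then have "1 / real (2 * n + 1 + 1) \<le> y" using y by (simp add: field_simps)
      then have "tail_mass g (1 / real (2 * n + 1 + 1)) \<le> tail_mass g y" by (rule mono)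
      then show "2 * weight_moment \<omega> (2 * n + 1) \<le> 2 * (K * tail_mass g y)"
        using K(2)[of "2 * n + 1"] K(1) mult_left_mono[of "tail_mass g (1 / real (2 * n + 1 + 1))" "tail_mass g y" K] by linarith
      show "0 < 2 * weight_moment \<omega> (2 * n + 1)" using weight_moment_ge(2)[OF g] by simp
    qed (use x in auto)
    have "1 / y \<le> 4 * real (N - N div 2)"
    proof -
      have "N \<le> 2 * (N - N div 2)" by simp
      then have "real N \<le> 2 * real (N - N div 2)" by (metis of_nat_le_iff of_nat_mult of_nat_numeral)
      then show ?thesis using N(2,3) by linarith
    qed
    then have "c / (y * tail_mass g y) \<le> real (N - N div 2) * (exp (-1) / (2 * (K * tail_mass g y)))"
      using mult_right_mono[of "1 / y" "4 * real (N - N div 2)" "c / tail_mass g y"] K(1) Ty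
      by (simp add: c_def field_simps)
    also have "\<dots> = (\<Sum>n\<in>{N div 2..<N}. exp (-1) / (2 * (K * tail_mass g y)))" by simp
    also have "\<dots> \<le> (\<Sum>n\<in>{N div 2..<N}. x ^ n / (2 * weight_moment \<omega> (2 * n + 1)))" by (rule sum_mono[OF b])
    also have "\<dots> \<le> kernel_real \<omega> x" unfolding kernel_real_def
      by (rule sum_le_suminf[OF s]) (use x weight_moment_nn(2)[OF g] in auto)
    finally show ?thesis by (simp add: y_def)
  qed
  moreover have "c > 0" using K(1) by (simp add: c_def)
  ultimately show ?thesis by blast
qed

section \<open>The two suprema\<close>

text \<open>Testing against finite positive M reduces the comparison of possibly infinite suprema to
  real inequalities. A finite B, even 0, is approached by M = B + e / K, and an infinite B makes the
  right side infinite.\<close>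

lemma ennreal_le_mult_if:
  fixes A B :: ennreal
  assumes K: "0 < K" and *: "\<And>M. 0 < M \<Longrightarrow> B \<le> ennreal M \<Longrightarrow> A \<le> ennreal (K * M)"
  shows "A \<le> ennreal K * B"
proof (cases B)
  case (real b)
  show ?thesis
  proof (rule ennreal_le_epsilon)
    fix e :: real assume e: "e > 0"
    have "A \<le> ennreal (K * (b + e / K))"
      by (rule *) (use real K e in \<open>auto intro!: add_nonneg_pos ennreal_leI\<close>)
    also have "K * (b + e / K) = K * b + e" using K by (simp add: field_simps)
    finally show "A \<le> ennreal K * B + ennreal e" using real K e by (simp add: ennreal_mult ennreal_plus)
  qed
qed (use K in \<open>simp add: ennreal_mult_top\<close>)

text \<open>Gathers the factors free of \<mu>: the supremum in \<open>mu_L_infty\<close> is that of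
  \<open>measure_tail \<mu> (1 - y) / tail_ratio p q g n h y\<close>. The next definition,
  \<open>moment_ratio\<close>, does the same for \<open>mu_ell_infty\<close>.\<close>

definition tail_ratio :: "real \<Rightarrow> real \<Rightarrow> (real \<Rightarrow> real) \<Rightarrow> (real \<Rightarrow> real) \<Rightarrow> (real \<Rightarrow> real) \<Rightarrow> real \<Rightarrow> real" where
  "tail_ratio p q g n h y = tail_mass g y * tail_mass n y powr (1 / p) * y powr (1 + 1 / p - 1 / q) / tail_mass h y powr (1 / q)"

definition moment_ratio ::
  "real \<Rightarrow> real \<Rightarrow> (complex \<Rightarrow> real) \<Rightarrow> (complex \<Rightarrow> real) \<Rightarrow> (complex \<Rightarrow> real) \<Rightarrow> nat \<Rightarrow> real" where
  "moment_ratio p q \<omega> \<nu> \<eta> n = weight_moment \<omega> n * weight_moment \<nu> n powr (1 / p) /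
     (weight_moment \<eta> n powr (1 / q) * real (n + 1) powr (1 + 1 / p - 1 / q))"

text \<open>Here n is the profile of \<nu>, so indices are written m, k, j or N inside the
  locale.\<close>

locale exponents_and_profiles =
  fixes p q :: real and \<omega> \<nu> \<eta> :: "complex \<Rightarrow> real" and g n h :: "real \<Rightarrow> real"
  assumes pq: "0 < p" "p \<le> q" "1 < q"
    and g: "doubling_profile \<omega> g" and n: "doubling_profile \<nu> n" and h: "doubling_profile \<eta> h"
begin

abbreviation "a \<equiv> 1 + 1 / p - 1 / q"
abbreviation "\<Phi> \<equiv> tail_ratio p q g n h"
abbreviation "\<Psi> \<equiv> moment_ratio p q \<omega> \<nu> \<eta>"

lemma a_pos: "a > 0"
proof -
  have "1 / q < 1" using pq by simp
  moreover have "1 / p > 0" using pq by simp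
  ultimately show ?thesis by linarith
qed

lemma \<Phi>_pos: "0 < y \<Longrightarrow> 0 < \<Phi> y"
  using doubling_profileD(3)[OF g, of y] doubling_profileD(3)[OF n, of y] doubling_profileD(3)[OF h, of y]
  by (auto simp: tail_ratio_def)

lemma \<Psi>_pos: "0 < \<Psi> m"
  using weight_moment_ge(2)[OF g, of m] weight_moment_ge(2)[OF n, of m] weight_moment_ge(2)[OF h, of m]
  by (auto simp: moment_ratio_def)

text \<open>The two sides have the same shape with separate constants for each factor, so that one
  estimate yields both doubling of \<open>\<Phi>\<close> and the comparison of \<open>\<Phi>\<close>
  with \<open>\<Psi>\<close> in either direction.\<close>

lemma ratio_estimate:
  fixes A A' N N' H H' x x' :: real
  assumes A: "0 < A" "A \<le> K1 * A'" and N: "0 < N" "N \<le> K2 * N'" and H: "0 < H'" "H' \<le> K3 * H" "0 < H"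
    and x: "0 < x" "x \<le> K4 * x'" and K: "0 < K1" "0 < K2" "0 < K3" "0 < K4"
  shows "A * N powr (1 / p) * x powr a / H powr (1 / q) \<le>
    (K1 * K2 powr (1 / p) * K3 powr (1 / q) * K4 powr a) * (A' * N' powr (1 / p) * x' powr a / H' powr (1 / q))"
proof -
  have pos: "0 < A'" "0 < N'" "0 < x'" using A N x K by (smt (verit) mult_nonneg_nonpos2 mult.commute)+
  have 1: "N powr (1 / p) \<le> K2 powr (1 / p) * N' powr (1 / p)"
    using powr_mono2[of "1 / p" N "K2 * N'"] N pq K pos by (simp add: powr_mult)
  have 2: "x powr a \<le> K4 powr a * x' powr a"
    using powr_mono2[of a x "K4 * x'"] x a_pos K pos by (simp add: powr_mult)
  have 3: "H' powr (1 / q) \<le> K3 powr (1 / q) * H powr (1 / q)"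
    using powr_mono2[of "1 / q" H' "K3 * H"] H pq K by (simp add: powr_mult)
  have 4: "1 / H powr (1 / q) \<le> K3 powr (1 / q) / H' powr (1 / q)" using 3 H by (simp add: field_simps)
  have "A * N powr (1 / p) * x powr a * (1 / H powr (1 / q)) \<le>
     (K1 * A') * (K2 powr (1 / p) * N' powr (1 / p)) * (K4 powr a * x' powr a) * (K3 powr (1 / q) / H' powr (1 / q))"
    by (intro mult_mono 1 2 4 A(2) mult_nonneg_nonneg) (use A N H x K pos in auto)
  then show ?thesis by (simp add: mult_ac)
qed

text \<open>From y to x <= 2 y the tails of \<omega> and \<nu> grow by a bounded factor, and the
  tail of \<eta>, being in the denominator, helps by its monotonicity.\<close>

lemma \<Phi>_doubling: "\<exists>D>0. \<forall>x y. 0 < y \<longrightarrow> y \<le> x \<longrightarrow> x \<le> 2 * y \<longrightarrow> \<Phi> x \<le> D * \<Phi> y"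
proof -
  obtain k where k: "\<And>y j. 0 < y \<Longrightarrow> tail_mass g (2 ^ j * y) \<le> (2 ^ k) ^ j * tail_mass g y"
    using doubling_profile_constant[OF g] by blast
  obtain k' where k': "\<And>y j. 0 < y \<Longrightarrow> tail_mass n (2 ^ j * y) \<le> (2 ^ k') ^ j * tail_mass n y"
    using doubling_profile_constant[OF n] by blast
  have "\<Phi> x \<le> (2 ^ k * (2 ^ k') powr (1 / p) * 1 powr (1 / q) * 2 powr a) * \<Phi> y" if "0 < y" "y \<le> x" "x \<le> 2 * y" for x y
    unfolding tail_ratio_def
  proof (rule ratio_estimate)
    show "tail_mass g x \<le> 2 ^ k * tail_mass g y"
      using k[of y 1] that tail_mass_mono[OF doubling_profileD(1,2)[OF g], of x "2 * y"] by simp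
    show "tail_mass n x \<le> 2 ^ k' * tail_mass n y"
      using k'[of y 1] that tail_mass_mono[OF doubling_profileD(1,2)[OF n], of x "2 * y"] by simp
    show "tail_mass h y \<le> 1 * tail_mass h x"
      using that tail_mass_mono[OF doubling_profileD(1,2)[OF h], of y x] by simp
  qed (use that doubling_profileD(3)[OF g] doubling_profileD(3)[OF n] doubling_profileD(3)[OF h] in auto)
  then show ?thesis by (intro exI[of _ "2 ^ k * (2 ^ k') powr (1 / p) * 1 powr (1 / q) * 2 powr a"]) auto
qed

lemma \<Phi>_dyadic: "\<exists>D>0. \<forall>y j. 0 < y \<longrightarrow> \<Phi> (2 ^ j * y) \<le> D ^ j * \<Phi> y"
proof -
  obtain D where D: "D > 0" "\<And>x y. 0 < y \<Longrightarrow> y \<le> x \<Longrightarrow> x \<le> 2 * y \<Longrightarrow> \<Phi> x \<le> D * \<Phi> y" using \<Phi>_doubling by blast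
  have "\<Phi> (2 ^ j * y) \<le> D ^ j * \<Phi> y" if "0 < y" for y j
  proof (induction j)
    case (Suc j)
    have "\<Phi> (2 ^ Suc j * y) \<le> D * \<Phi> (2 ^ j * y)" using that by (intro D(2)) auto
    also have "\<dots> \<le> D * (D ^ j * \<Phi> y)" using Suc D(1) by (intro mult_left_mono) auto
    finally show ?case by (simp add: mult_ac)
  qed simp
  then show ?thesis using D(1) by blast
qed

text \<open>Beyond 1 the three tails are constant and only y^a with a > 0 varies. This covers dyadic
  scales larger than 1 in \<open>ell_infty_le_L_infty\<close>.\<close>

lemma \<Phi>_ge_1: "1 \<le> y \<Longrightarrow> \<Phi> 1 \<le> \<Phi> y"
  using tail_mass_full[OF doubling_profileD(1)[OF g], of y] tail_mass_full[OF doubling_profileD(1)[OF n], of y]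
    tail_mass_full[OF doubling_profileD(1)[OF h], of y] ge_one_powr_ge_zero[of y a] a_pos
    doubling_profileD(3)[OF g, of 1] doubling_profileD(3)[OF n, of 1] doubling_profileD(3)[OF h, of 1]
  by (auto simp: tail_ratio_def intro!: divide_right_mono)

lemma moment_ratio_alt: "\<Psi> m = weight_moment \<omega> m * weight_moment \<nu> m powr (1 / p) * (1 / real (m + 1)) powr a / weight_moment \<eta> m powr (1 / q)"
  unfolding moment_ratio_def by (subst powr_divide) (auto simp: divide_simps)

lemma \<Psi>_\<Phi>: "\<exists>K>0. \<forall>m. \<Psi> m \<le> K * \<Phi> (1 / real (m + 1)) \<and> \<Phi> (1 / real (m + 1)) \<le> K * \<Psi> m"
proof -
  obtain K1 where K1: "K1 > 0" "\<And>m. weight_moment \<omega> m \<le> K1 * tail_mass g (1 / real (m + 1))" using weight_moment_le[OF g] by blast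
  obtain K2 where K2: "K2 > 0" "\<And>m. weight_moment \<nu> m \<le> K2 * tail_mass n (1 / real (m + 1))" using weight_moment_le[OF n] by blast
  obtain K3 where K3: "K3 > 0" "\<And>m. weight_moment \<eta> m \<le> K3 * tail_mass h (1 / real (m + 1))" using weight_moment_le[OF h] by blast
  define K where "K = K1 * K2 powr (1 / p) * exp 1 powr (1 / q) * 1 powr a"
  define K' where "K' = exp 1 * exp 1 powr (1 / p) * K3 powr (1 / q) * 1 powr a"
  have 1: "\<Psi> m \<le> K * \<Phi> (1 / real (m + 1))" for m
    unfolding moment_ratio_alt tail_ratio_def K_def
    by (rule ratio_estimate) (use K1 K2 weight_moment_ge[OF g] weight_moment_ge[OF n] weight_moment_ge[OF h]
       doubling_profileD(3)[OF g] doubling_profileD(3)[OF n] doubling_profileD(3)[OF h] in auto)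
  have 2: "\<Phi> (1 / real (m + 1)) \<le> K' * \<Psi> m" for m
    unfolding moment_ratio_alt tail_ratio_def K'_def
    by (rule ratio_estimate) (use K3 weight_moment_ge[OF g] weight_moment_ge[OF n] weight_moment_ge[OF h]
       doubling_profileD(3)[OF g] doubling_profileD(3)[OF n] doubling_profileD(3)[OF h] in auto)
  have "\<Psi> m \<le> max K K' * \<Phi> (1 / real (m + 1))" for m
    by (rule order_trans[OF 1 mult_right_mono]) (auto intro!: less_imp_le \<Phi>_pos)
  moreover have "\<Phi> (1 / real (m + 1)) \<le> max K K' * \<Psi> m" for m
    by (rule order_trans[OF 2 mult_right_mono]) (auto intro!: less_imp_le \<Psi>_pos)
  moreover have "0 < max K K'" using K1 K2 by (auto simp: K_def less_max_iff_disj)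
  ultimately show ?thesis by blast
qed

lemma mu_L_infty_le_iff:
  assumes "0 \<le> M"
  shows "mu_L_infty p q \<omega> \<nu> \<eta> \<mu> \<le> ennreal M \<longleftrightarrow> (\<forall>y. 0 < y \<longrightarrow> y \<le> 1 \<longrightarrow> measure_tail \<mu> (1 - y) \<le> M * \<Phi> y)"
proof -
  have T: "enn2real (weight_tail \<omega> r) = tail_mass g (1 - r)" "enn2real (weight_tail \<nu> r) = tail_mass n (1 - r)"
    "enn2real (weight_tail \<eta> r) = tail_mass h (1 - r)" if "0 \<le> r" for r
    using weight_tail_eq[OF doubling_profileD(1,2)[OF g] that] weight_tail_eq[OF doubling_profileD(1,2)[OF n] that]
      weight_tail_eq[OF doubling_profileD(1,2)[OF h] that]
      tail_mass_nn(2)[OF doubling_profileD(1,2)[OF g]] tail_mass_nn(2)[OF doubling_profileD(1,2)[OF n]]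
      tail_mass_nn(2)[OF doubling_profileD(1,2)[OF h]] by simp_all
  have e: "(measure_tail \<mu> r * enn2real (weight_tail \<eta> r) powr (1 / q) /
      (enn2real (weight_tail \<omega> r) * enn2real (weight_tail \<nu> r) powr (1 / p) * (1 - r) powr a)) = measure_tail \<mu> r / \<Phi> (1 - r)"
    if "0 \<le> r" "r < 1" for r
    using that unfolding T[OF that(1)] tail_ratio_def by simp
  have "mu_L_infty p q \<omega> \<nu> \<eta> \<mu> \<le> ennreal M \<longleftrightarrow> (\<forall>r\<in>{0..<1}. measure_tail \<mu> r / \<Phi> (1 - r) \<le> M)"
    unfolding mu_L_infty_def SUP_le_iff using assms e by (auto simp: ennreal_le_iff)
  also have "\<dots> \<longleftrightarrow> (\<forall>r\<in>{0..<1}. measure_tail \<mu> r \<le> M * \<Phi> (1 - r))"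
    using \<Phi>_pos by (intro ball_cong refl) (simp add: pos_divide_le_eq)
  also have "\<dots> \<longleftrightarrow> (\<forall>y. 0 < y \<longrightarrow> y \<le> 1 \<longrightarrow> measure_tail \<mu> (1 - y) \<le> M * \<Phi> y)"
  proof safe
    fix y :: real assume "\<forall>r\<in>{0..<1}. measure_tail \<mu> r \<le> M * \<Phi> (1 - r)" "0 < y" "y \<le> 1"
    then show "measure_tail \<mu> (1 - y) \<le> M * \<Phi> y" by (auto dest: bspec[of _ _ "1 - y"])
  next
    fix r :: real assume "\<forall>y. 0 < y \<longrightarrow> y \<le> 1 \<longrightarrow> measure_tail \<mu> (1 - y) \<le> M * \<Phi> y" "r \<in> {0..<1}"
    then show "measure_tail \<mu> r \<le> M * \<Phi> (1 - r)" by (auto dest: spec[of _ "1 - r"])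
  qed
  finally show ?thesis .
qed

lemma mu_ell_infty_le_iff:
  assumes "0 \<le> M"
  shows "mu_ell_infty p q \<omega> \<nu> \<eta> \<mu> \<le> ennreal M \<longleftrightarrow> (\<forall>m. measure_moment \<mu> m \<le> M * \<Psi> m)"
proof -
  have e: "measure_moment \<mu> m * weight_moment \<eta> m powr (1 / q) * real (m + 1) powr a / (weight_moment \<omega> m * weight_moment \<nu> m powr (1 / p))
    = measure_moment \<mu> m / \<Psi> m" for m
    unfolding moment_ratio_def by simp
  show ?thesis unfolding mu_ell_infty_def SUP_le_iff e
    using assms \<Psi>_pos by (simp add: ennreal_le_iff pos_divide_le_eq)
qed

end

section \<open>Tails and moments of the measure\<close>

lemma M_plusD:
  assumes "\<mu> \<in> M_plus"
  shows "finite_measure \<mu>" "space \<mu> = {0..<1}" "sets \<mu> = sets (restrict_space borel {0..<1})"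
    and "(\<lambda>t. t) \<in> borel_measurable \<mu>" "\<And>r. 0 \<le> r \<Longrightarrow> {r..<1} \<in> sets \<mu>"
proof -
  show "finite_measure \<mu>" and s: "sets \<mu> = sets (restrict_space borel {0..<1})" using assms by (auto simp: M_plus_def)
  show "space \<mu> = {0..<1}" using sets_eq_imp_space_eq[OF s] by (simp add: space_restrict_space)
  have "(\<lambda>t. t) \<in> borel_measurable (restrict_space borel {0..<1::real})" by (rule measurable_restrict_space1) simp
  then show "(\<lambda>t. t) \<in> borel_measurable \<mu>" using measurable_cong_sets[OF s refl] by blast
  show "{r..<1} \<in> sets \<mu>" if "0 \<le> r" for r
    unfolding s sets_restrict_space using that by (auto intro!: image_eqI[of _ _ "{r..<1}"])
qed

lemma tail_set_M_plus:
  assumes "\<mu> \<in> M_plus"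
  shows "emeasure \<mu> {s \<in> space \<mu>. r \<le> s} = ennreal (measure_tail \<mu> (max 0 r))"
proof -
  interpret finite_measure \<mu> using M_plusD(1)[OF assms] .
  have "{s \<in> space \<mu>. r \<le> s} = {max 0 r..<1}" using M_plusD(2)[OF assms] by auto
  then show ?thesis by (simp add: measure_tail_def emeasure_eq_measure)
qed

lemma measure_tail_antimono:
  assumes "\<mu> \<in> M_plus" "0 \<le> r" "r \<le> r'"
  shows "measure_tail \<mu> r' \<le> measure_tail \<mu> r"
proof -
  interpret finite_measure \<mu> using M_plusD(1)[OF assms(1)] .
  show ?thesis unfolding measure_tail_def using assms by (intro finite_measure_mono M_plusD(5)) auto
qed

lemma measure_moment_nn:
  assumes "\<mu> \<in> M_plus"
  shows "ennreal (measure_moment \<mu> m) = (\<integral>\<^sup>+t. ennreal (t ^ m) \<partial>\<mu>)" "0 \<le> measure_moment \<mu> m"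
proof -
  interpret finite_measure \<mu> using M_plusD(1)[OF assms] .
  note [measurable] = M_plusD(4)[OF assms]
  have b: "AE t in \<mu>. 0 \<le> t ^ m" "AE t in \<mu>. norm (t ^ m) \<le> 1"
    by (auto intro!: AE_I2 power_le_one simp: M_plusD(2)[OF assms] power_abs)
  have "integrable \<mu> (\<lambda>t. t ^ m)" by (rule integrable_const_bound[OF b(2)]) measurable
  then show "ennreal (measure_moment \<mu> m) = (\<integral>\<^sup>+t. ennreal (t ^ m) \<partial>\<mu>)"
    unfolding measure_moment_def using b(1) by (rule nn_integral_eq_integral[symmetric])
  show "0 \<le> measure_moment \<mu> m" unfolding measure_moment_def using b(1) by (rule integral_nonneg_AE)
qed

lemma measure_tail_le_moment:
  assumes \<mu>: "\<mu> \<in> M_plus"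
  shows "measure_tail \<mu> (1 - 1 / real (m + 1)) \<le> exp 1 * measure_moment \<mu> m"
proof -
  define x where "x = 1 / real (m + 1)"
  have x: "0 < x" "x \<le> 1" by (auto simp: x_def)
  interpret finite_measure \<mu> using M_plusD(1)[OF \<mu>] .
  note [measurable] = M_plusD(4)[OF \<mu>]
  have "ennreal (exp (-1) * measure_tail \<mu> (1 - x)) = (\<integral>\<^sup>+t. ennreal (exp (-1)) * indicator {1 - x..<1} t \<partial>\<mu>)"
    using M_plusD(5)[OF \<mu>, of "1 - x"] x
    by (subst nn_integral_cmult_indicator) (auto simp: measure_tail_def emeasure_eq_measure ennreal_mult)
  also have "\<dots> \<le> (\<integral>\<^sup>+t. ennreal (t ^ m) \<partial>\<mu>)"
  proof (rule nn_integral_mono)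
    fix t
    have "exp (-1) \<le> t ^ m" if "1 - x \<le> t"
      using one_minus_power_ge[of m] power_mono[OF that, of m] x by (simp add: x_def)
    then show "ennreal (exp (-1)) * indicator {1 - x..<1} t \<le> ennreal (t ^ m)"
      by (auto simp: indicator_def intro!: ennreal_leI)
  qed
  also have "\<dots> = ennreal (measure_moment \<mu> m)" by (rule measure_moment_nn(1)[OF \<mu>, symmetric])
  finally have "exp (-1) * measure_tail \<mu> (1 - x) \<le> measure_moment \<mu> m" using measure_moment_nn(2)[OF \<mu>] by simp
  then show ?thesis by (simp add: x_def exp_minus field_simps)
qed

context exponents_and_profiles
begin

lemma L_infty_le_ell_infty:
  "\<exists>K>0. \<forall>\<mu>\<in>M_plus. mu_L_infty p q \<omega> \<nu> \<eta> \<mu> \<le> ennreal K * mu_ell_infty p q \<omega> \<nu> \<eta> \<mu>"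
proof -
  obtain D where D: "D > 0" "\<And>x y. 0 < y \<Longrightarrow> y \<le> x \<Longrightarrow> x \<le> 2 * y \<Longrightarrow> \<Phi> x \<le> D * \<Phi> y" using \<Phi>_doubling by blast
  obtain K where K: "K > 0" "\<And>m. \<Psi> m \<le> K * \<Phi> (1 / real (m + 1))" using \<Psi>_\<Phi> by blast
  have "mu_L_infty p q \<omega> \<nu> \<eta> \<mu> \<le> ennreal (exp 1 * K * D) * mu_ell_infty p q \<omega> \<nu> \<eta> \<mu>" if \<mu>: "\<mu> \<in> M_plus" for \<mu>
  proof (rule ennreal_le_mult_if)
    fix M :: real assume M: "0 < M" and le: "mu_ell_infty p q \<omega> \<nu> \<eta> \<mu> \<le> ennreal M"
    have mom: "measure_moment \<mu> m \<le> M * \<Psi> m" for m using le mu_ell_infty_le_iff[of M] M by simp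
    have "measure_tail \<mu> (1 - y) \<le> exp 1 * K * D * M * \<Phi> y" if y: "0 < y" "y \<le> 1" for y
    proof -
      \<comment> \<open>The off-by-one places 1 / y between m + 1 and m + 2, so that x = 1 / (m + 1)
        lies between y and 2 y.\<close>
      define m where "m = nat \<lfloor>1 / y\<rfloor> - 1"
      have "1 \<le> 1 / y" using y by simp
      then have m: "real (m + 1) \<le> 1 / y" "1 / y < real (m + 1) + 1" unfolding m_def by linarith+
      define x where "x = 1 / real (m + 1)"
      have x: "y \<le> x" "0 < x" "x \<le> 1" using m(1) y by (auto simp: x_def field_simps)
      have "1 / y \<le> 2 * real (m + 1)" using m(2) by simp
      then have x2: "x \<le> 2 * y" using y by (simp add: x_def field_simps)
      have "measure_tail \<mu> (1 - y) \<le> measure_tail \<mu> (1 - x)" using x by (intro measure_tail_antimono[OF \<mu>]) auto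
      also have "\<dots> \<le> exp 1 * measure_moment \<mu> m" unfolding x_def by (rule measure_tail_le_moment[OF \<mu>])
      also have "\<dots> \<le> exp 1 * (M * \<Psi> m)" using mom[of m] by simp
      also have "\<dots> \<le> exp 1 * (M * (K * \<Phi> x))" using K(2)[of m] M by (simp add: x_def)
      also have "\<dots> \<le> exp 1 * (M * (K * (D * \<Phi> y)))" using D(2)[OF y(1) x(1) x2] M K(1) by simp
      finally show ?thesis by (simp add: mult_ac)
    qed
    then show "mu_L_infty p q \<omega> \<nu> \<eta> \<mu> \<le> ennreal (exp 1 * K * D * M)"
      using M K D by (subst mu_L_infty_le_iff) auto
  qed (use K D in auto)
  then show ?thesis using K D by (intro exI[of _ "exp 1 * K * D"]) auto
qed

lemma ell_infty_le_L_infty: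
  "\<exists>K>0. \<forall>\<mu>\<in>M_plus. mu_ell_infty p q \<omega> \<nu> \<eta> \<mu> \<le> ennreal K * mu_L_infty p q \<omega> \<nu> \<eta> \<mu>"
proof -
  obtain D where D: "D > 0" "\<And>y j. 0 < y \<Longrightarrow> \<Phi> (2 ^ j * y) \<le> D ^ j * \<Phi> y" using \<Phi>_dyadic by blast
  obtain K where K: "K > 0" "\<And>m. \<Phi> (1 / real (m + 1)) \<le> K * \<Psi> m" using \<Psi>_\<Phi> by blast
  \<comment> \<open>The order of the kernel has to outweigh the growth D of \<open>\<Phi>\<close>
    under doubling; this is the condition on D in \<open>nn_integral_kernel_le\<close>.\<close>
  obtain k where k: "2 * D < 2 ^ k" using real_arch_pow[of 2 "2 * D"] by auto
  define C where "C = fact k * exp 2 * 2 ^ (k + 1) * K"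
  have C: "C > 0" using K by (simp add: C_def)
  have "mu_ell_infty p q \<omega> \<nu> \<eta> \<mu> \<le> ennreal C * mu_L_infty p q \<omega> \<nu> \<eta> \<mu>" if \<mu>: "\<mu> \<in> M_plus" for \<mu>
  proof (rule ennreal_le_mult_if[OF C])
    note [measurable] = M_plusD(4)[OF \<mu>]
    fix M :: real assume M: "0 < M" and le: "mu_L_infty p q \<omega> \<nu> \<eta> \<mu> \<le> ennreal M"
    have tail: "measure_tail \<mu> (1 - y) \<le> M * \<Phi> y" if "0 < y" "y \<le> 1" for y
      using le mu_L_infty_le_iff[of M] M that by simp
    have "measure_moment \<mu> m \<le> C * M * \<Psi> m" for m
    proof -
      define x where "x = 1 / real (m + 1)"
      have x: "0 < x" by (simp add: x_def)
      have "ennreal (measure_moment \<mu> m) = (\<integral>\<^sup>+t. ennreal (t ^ m) \<partial>\<mu>)" by (rule measure_moment_nn[OF \<mu>])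
      also have "\<dots> \<le> (\<integral>\<^sup>+t. ennreal (fact k * exp 2) * ennreal ((x / (x + (1 - t))) ^ k) \<partial>\<mu>)"
      proof (rule nn_integral_mono)
        fix t assume "t \<in> space \<mu>"
        then have t: "0 \<le> t" "t \<le> 1" using M_plusD(2)[OF \<mu>] by auto
        then show "ennreal (t ^ m) \<le> ennreal (fact k * exp 2) * ennreal ((x / (x + (1 - t))) ^ k)"
          using power_le_kernel[OF t x_def, of k] x by (subst ennreal_mult[symmetric]) (auto intro!: ennreal_leI)
      qed
      also have "\<dots> = ennreal (fact k * exp 2) * (\<integral>\<^sup>+t. ennreal ((x / (x + (1 - t))) ^ k) \<partial>\<mu>)"
        by (rule nn_integral_cmult) measurable
      also have "(\<integral>\<^sup>+t. ennreal ((x / (x + (1 - t))) ^ k) \<partial>\<mu>) \<le> ennreal (2 ^ (k + 1) * (M * \<Phi> x))"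
      proof (rule nn_integral_kernel_le[OF M_plusD(4)[OF \<mu>] _ x, where D=D])
        show "AE s in \<mu>. s \<le> 1" by (rule AE_I2) (use M_plusD(2)[OF \<mu>] in auto)
        show "emeasure \<mu> {s \<in> space \<mu>. 1 - 2 ^ j * x \<le> s} \<le> ennreal (M * \<Phi> x * D ^ j)" for j
        proof -
          \<comment> \<open>A scale beyond 1 sees all of \<mu>; there the bound at y = 1 is combined
            with \<open>\<Phi>_ge_1\<close>.\<close>
          have "measure_tail \<mu> (max 0 (1 - 2 ^ j * x)) \<le> M * \<Phi> (2 ^ j * x)"
          proof (cases "2 ^ j * x \<le> 1")
            case True then show ?thesis using tail[of "2 ^ j * x"] x by simp
          next
            case False
            then have "M * \<Phi> 1 \<le> M * \<Phi> (2 ^ j * x)" using M \<Phi>_ge_1[of "2 ^ j * x"] by simp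
            then show ?thesis using tail[of 1] False by simp
          qed
          also have "\<dots> \<le> M * (D ^ j * \<Phi> x)" using D(2)[OF x, of j] M by simp
          finally show ?thesis unfolding tail_set_M_plus[OF \<mu>] by (simp add: ennreal_leI mult_ac)
        qed
      qed (use M \<Phi>_pos[OF x] D k in auto)
      also have "ennreal (fact k * exp 2) * ennreal (2 ^ (k + 1) * (M * \<Phi> x)) = ennreal (fact k * exp 2 * (2 ^ (k + 1) * (M * \<Phi> x)))"
        using M \<Phi>_pos[OF x] by (intro ennreal_mult[symmetric]) auto
      finally have "measure_moment \<mu> m \<le> fact k * exp 2 * (2 ^ (k + 1) * (M * \<Phi> x))"
        using M \<Phi>_pos[OF x] by (simp add: mult_left_mono)
      also have "\<dots> \<le> fact k * exp 2 * (2 ^ (k + 1) * (M * (K * \<Psi> m)))"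
        using K(2)[of m] M by (simp add: x_def)
      finally show ?thesis by (simp add: C_def mult_ac)
    qed
    then show "mu_ell_infty p q \<omega> \<nu> \<eta> \<mu> \<le> ennreal (C * M)"
      using M C by (subst mu_ell_infty_le_iff) auto
  qed
  then show ?thesis using C by blast
qed

end

section \<open>Lower bound: test functions\<close>

definition kernel_disc :: "(complex \<Rightarrow> real) \<Rightarrow> complex \<Rightarrow> complex" where
  "kernel_disc \<omega> w = (\<Sum>n. w ^ n / complex_of_real (2 * weight_moment \<omega> (2 * n + 1)))"

lemma kernel_disc_properties:
  assumes g: "doubling_profile \<omega> g"
  shows "kernel_disc \<omega> holomorphic_on ball 0 1"
    and "\<And>w. norm w < 1 \<Longrightarrow> norm (kernel_disc \<omega> w) \<le> kernel_real \<omega> (norm w)"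
    and "\<And>x. 0 \<le> x \<Longrightarrow> x < 1 \<Longrightarrow> kernel_disc \<omega> (of_real x) = of_real (kernel_real \<omega> x)"
    and "\<And>x. 0 \<le> x \<Longrightarrow> x < 1 \<Longrightarrow> 0 \<le> kernel_real \<omega> x"
proof -
  let ?w = "\<lambda>n. weight_moment \<omega> (2 * n + 1)"
  have nn: "0 \<le> ?w n" for n using weight_moment_nn(2)[OF g] .
  have s: "summable (\<lambda>n. x ^ n / (2 * ?w n))" if "0 \<le> x" "x < 1" for x using kernel_real_le[OF g] that by blast
  have ne: "norm (w ^ n / complex_of_real (2 * ?w n)) = norm w ^ n / (2 * ?w n)" for w :: complex and n
    using nn[of n] by (simp add: norm_divide norm_power)
  have sn: "summable (\<lambda>n. norm (w ^ n / complex_of_real (2 * ?w n)))" if "norm w < 1" for w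
    unfolding ne using s that by simp
  show "kernel_disc \<omega> holomorphic_on ball 0 1"
  proof (rule power_series_holomorphic[where a="\<lambda>n. 1 / complex_of_real (2 * ?w n)"])
    fix w :: complex assume "w \<in> ball 0 1"
    then have "(\<lambda>n. w ^ n / complex_of_real (2 * ?w n)) sums kernel_disc \<omega> w"
      unfolding kernel_disc_def by (intro summable_sums summable_norm_cancel[OF sn]) auto
    then show "(\<lambda>n. 1 / complex_of_real (2 * ?w n) * (w - 0) ^ n) sums kernel_disc \<omega> w" by simp
  qed
  show "norm (kernel_disc \<omega> w) \<le> kernel_real \<omega> (norm w)" if "norm w < 1" for w
    using summable_norm[OF sn[OF that]] unfolding kernel_disc_def kernel_real_def ne .
  show "kernel_disc \<omega> (of_real x) = of_real (kernel_real \<omega> x)" if "0 \<le> x" "x < 1" for x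
    unfolding kernel_disc_def kernel_real_def by (subst suminf_of_real[OF s[OF that]]) simp
  show "0 \<le> kernel_real \<omega> x" if "0 \<le> x" "x < 1" for x
    unfolding kernel_real_def by (rule suminf_nonneg[OF s[OF that]]) (use that nn in auto)
qed

lemma C_op_alt: "C_op \<mu> \<omega> f z = (\<integral>t. f (of_real t * z) * kernel_disc \<omega> (of_real t * z) \<partial>\<mu>)"
  unfolding C_op_def kernel_B_def kernel_disc_def ..

text \<open>On Taylor series \<open>C_op\<close> multiplies the coefficients of \<open>f B\<close> by the moments of \<open>\<mu>\<close>.\<close>

lemma C_op_holomorphic:
  assumes g: "doubling_profile \<omega> g" and \<mu>: "\<mu> \<in> M_plus" and f: "f holomorphic_on ball 0 1"
  shows "C_op \<mu> \<omega> f holomorphic_on ball 0 1"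
proof -
  interpret finite_measure \<mu> using M_plusD(1)[OF \<mu>] .
  note [measurable] = M_plusD(4)[OF \<mu>]
  define G where "G w = f w * kernel_disc \<omega> w" for w
  have G: "G holomorphic_on ball 0 1" unfolding G_def by (intro holomorphic_intros f kernel_disc_properties(1)[OF g])
  define c where "c m = (deriv ^^ m) G 0 / fact m" for m
  have ser: "(\<lambda>m. c m * w ^ m) sums G w" if "norm w < 1" for w
    using holomorphic_power_series[OF G, of w] that by (simp add: c_def)
  show ?thesis
  proof (rule power_series_holomorphic[where a="\<lambda>m. c m * of_real (measure_moment \<mu> m)"])
    fix z :: complex assume "z \<in> ball 0 1"
    then have z: "norm z < 1" by simp
    \<comment> \<open>A radius between |z| and 1 gives absolute convergence at z, and that series
      dominates those at t z for all t in [0,1).\<close>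
    define x where "x = (norm z + 1) / 2"
    have x: "norm z < x" "x < 1" using z by (auto simp: x_def)
    have x0: "0 < x" using x norm_ge_zero[of z] by linarith
    have sz: "summable (\<lambda>m. norm (c m * z ^ m))"
      by (rule powser_insidea[of c "of_real x" z]) (use ser[of "of_real x"] x x0 in \<open>auto simp: sums_iff\<close>)
    have le: "norm (c m * (of_real t * z) ^ m) \<le> norm (c m * z ^ m)" if "t \<in> space \<mu>" for t m
    proof -
      have t: "0 \<le> t" "t < 1" using that M_plusD(2)[OF \<mu>] by auto
      then have "t ^ m \<le> 1" by (intro power_le_one) auto
      then have "t ^ m * norm (c m * z ^ m) \<le> 1 * norm (c m * z ^ m)" by (rule mult_right_mono) simp
      then show ?thesis using t by (simp add: norm_mult norm_power power_mult_distrib mult_ac)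
    qed
    have int: "integrable \<mu> (\<lambda>t. c m * (of_real t * z) ^ m)" for m
      by (rule integrable_const_bound[OF AE_I2[OF le]]) measurable
    have s1: "(\<lambda>m. \<integral>t. c m * (of_real t * z) ^ m \<partial>\<mu>) sums (\<integral>t. (\<Sum>m. c m * (of_real t * z) ^ m) \<partial>\<mu>)"
    proof (rule sums_integral[OF int])
      show "AE t in \<mu>. summable (\<lambda>m. norm (c m * (of_real t * z) ^ m))"
        by (rule AE_I2, rule summable_comparison_test'[OF sz, of 0]) (use le in auto)
      show "summable (\<lambda>m. \<integral>t. norm (c m * (of_real t * z) ^ m) \<partial>\<mu>)"
      proof (rule summable_comparison_test'[OF summable_mult[OF sz, of "measure \<mu> (space \<mu>)"], of 0])
        fix m
        have "(\<integral>t. norm (c m * (of_real t * z) ^ m) \<partial>\<mu>) \<le> (\<integral>t. norm (c m * z ^ m) \<partial>\<mu>)"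
          by (rule integral_mono[OF integrable_norm[OF int]]) (use le in auto)
        moreover have "0 \<le> (\<integral>t. norm (c m * (of_real t * z) ^ m) \<partial>\<mu>)" by simp
        ultimately show "norm (\<integral>t. norm (c m * (of_real t * z) ^ m) \<partial>\<mu>) \<le> measure \<mu> (space \<mu>) * norm (c m * z ^ m)" by simp
      qed
    qed
    have s2: "(\<integral>t. (\<Sum>m. c m * (of_real t * z) ^ m) \<partial>\<mu>) = C_op \<mu> \<omega> f z" unfolding C_op_alt
    proof (rule Bochner_Integration.integral_cong[OF refl])
      fix t assume "t \<in> space \<mu>"
      then have "norm (of_real t * z) < 1" using z M_plusD(2)[OF \<mu>] mult_strict_mono'[of t 1 "norm z" 1] by (simp add: norm_mult)
      from ser[OF this] show "(\<Sum>m. c m * (of_real t * z) ^ m) = f (of_real t * z) * kernel_disc \<omega> (of_real t * z)"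
        by (simp add: sums_iff G_def)
    qed
    have s3: "(\<integral>t. c m * (of_real t * z) ^ m \<partial>\<mu>) = c m * of_real (measure_moment \<mu> m) * z ^ m" for m
    proof -
      have "(\<integral>t. c m * (of_real t * z) ^ m \<partial>\<mu>) = (\<integral>t. (c m * z ^ m) * of_real (t ^ m) \<partial>\<mu>)"
        by (simp add: power_mult_distrib mult_ac)
      also have "\<dots> = (c m * z ^ m) * (\<integral>t. complex_of_real (t ^ m) \<partial>\<mu>)" by (rule integral_mult_right_zero)
      also have "(\<integral>t. complex_of_real (t ^ m) \<partial>\<mu>) = of_real (measure_moment \<mu> m)"
        unfolding measure_moment_def by (rule integral_complex_of_real)
      finally show ?thesis by (simp add: mult_ac)
    qed
    show "(\<lambda>m. c m * of_real (measure_moment \<mu> m) * (z - 0) ^ m) sums C_op \<mu> \<omega> f z"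
      using s1 unfolding s2 s3 diff_zero .
  qed
qed

lemma norm_C_op_le:
  assumes g: "doubling_profile \<omega> g" and \<mu>: "\<mu> \<in> M_plus" and z: "norm z < 1"
  shows "ennreal (norm (C_op \<mu> \<omega> f z)) \<le> (\<integral>\<^sup>+t. ennreal (norm (f (of_real t * z)) * kernel_real \<omega> (t * norm z)) \<partial>\<mu>)"
proof -
  have "ennreal (norm (C_op \<mu> \<omega> f z)) \<le> (\<integral>\<^sup>+t. ennreal (norm (f (of_real t * z) * kernel_disc \<omega> (of_real t * z))) \<partial>\<mu>)"
  proof (cases "integrable \<mu> (\<lambda>t. f (of_real t * z) * kernel_disc \<omega> (of_real t * z))")
    case True then show ?thesis unfolding C_op_alt by (rule integral_norm_bound_ennreal)
  next
    \<comment> \<open>The Bochner integral of a non-integrable function is 0 by convention, and the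
      bound is then trivial.\<close>
    case False then show ?thesis unfolding C_op_alt by (simp add: not_integrable_integral_eq)
  qed
  also have "\<dots> \<le> (\<integral>\<^sup>+t. ennreal (norm (f (of_real t * z)) * kernel_real \<omega> (t * norm z)) \<partial>\<mu>)"
  proof (rule nn_integral_mono)
    fix t assume "t \<in> space \<mu>"
    then have t: "0 \<le> t" "t < 1" using M_plusD(2)[OF \<mu>] by auto
    have "norm (of_real t * z) < 1" using t z mult_strict_mono'[of t 1 "norm z" 1] by (simp add: norm_mult)
    from kernel_disc_properties(2)[OF g this]
    have "norm (kernel_disc \<omega> (of_real t * z)) \<le> kernel_real \<omega> (t * norm z)" using t by (simp add: norm_mult)
    then show "ennreal (norm (f (of_real t * z) * kernel_disc \<omega> (of_real t * z))) \<le> ennreal (norm (f (of_real t * z)) * kernel_real \<omega> (t * norm z))"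
      by (intro ennreal_leI) (simp add: norm_mult mult_left_mono)
  qed
  finally show ?thesis .
qed

text \<open>F is an explicit antiderivative: 1 - \<rho> cis \<theta> has positive real part, so
  minus its argument is the arctangent of a quotient and has no jump. Over a full turn the
  arctangent returns to its value and only the linear term contributes.\<close>

lemma poisson_integral:
  fixes \<rho> :: real
  assumes \<rho>: "0 \<le> \<rho>" "\<rho> < 1"
  shows "(\<integral>\<^sup>+\<theta>\<in>{0..2*pi}. ennreal (1 / norm (1 - of_real \<rho> * cis \<theta>) ^ 2) \<partial>lborel) = ennreal (2 * pi / (1 - \<rho>\<^sup>2))"
proof -
  have nrm: "norm (1 - of_real \<rho> * cis \<theta>) ^ 2 = (1 - \<rho> * cos \<theta>)\<^sup>2 + (\<rho> * sin \<theta>)\<^sup>2" for \<theta>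
    unfolding cmod_power2 by simp
  have \<rho>2: "\<rho>\<^sup>2 < 1" using \<rho> by (simp add: power_less_one_iff)
  have pos: "0 < 1 - \<rho> * cos \<theta>" for \<theta>
  proof -
    have "\<rho> * cos \<theta> \<le> \<rho> * 1" using \<rho> by (intro mult_left_mono) auto
    then show ?thesis using \<rho> by linarith
  qed
  define F where "F \<theta> = (\<theta> + 2 * arctan (\<rho> * sin \<theta> / (1 - \<rho> * cos \<theta>))) / (1 - \<rho>\<^sup>2)" for \<theta>
  have "(\<integral>\<^sup>+\<theta>\<in>{0..2*pi}. ennreal (1 / norm (1 - of_real \<rho> * cis \<theta>) ^ 2) \<partial>lborel) = ennreal (F (2 * pi) - F 0)"
  proof (rule nn_integral_FTC_Icc)
    fix \<theta> :: real
    define u where "u = 1 - \<rho> * cos \<theta>"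
    define v where "v = \<rho> * sin \<theta>"
    have u: "u > 0" using pos by (simp add: u_def)
    have uv: "u\<^sup>2 + v\<^sup>2 > 0" using u by (simp add: add_pos_nonneg)
    have sc: "(\<rho> * cos \<theta>)\<^sup>2 + v\<^sup>2 = \<rho>\<^sup>2" unfolding v_def power_mult_distrib distrib_left[symmetric] by simp
    have rc: "\<rho> * cos \<theta> = 1 - u" by (simp add: u_def)
    have "((\<lambda>\<theta>. \<rho> * sin \<theta> / (1 - \<rho> * cos \<theta>)) has_real_derivative (\<rho> * cos \<theta> * u - v * v) / (u * u)) (at \<theta>)"
      unfolding u_def v_def using pos[of \<theta>]
      by (intro DERIV_divide DERIV_cmult DERIV_sin) (auto intro!: derivative_eq_intros)
    from DERIV_chain2[OF DERIV_arctan this]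
    have "((\<lambda>\<theta>. arctan (\<rho> * sin \<theta> / (1 - \<rho> * cos \<theta>))) has_real_derivative (\<rho> * cos \<theta> * u - v * v) / (u * u) / (1 + (v / u)\<^sup>2)) (at \<theta>)"
      by (simp add: u_def v_def field_simps)
    then have "(F has_real_derivative (1 + 2 * ((\<rho> * cos \<theta> * u - v * v) / (u * u) / (1 + (v / u)\<^sup>2))) / (1 - \<rho>\<^sup>2)) (at \<theta>)"
      unfolding F_def by (intro DERIV_cdivide DERIV_add DERIV_ident DERIV_cmult)
    also have "(1 + 2 * ((\<rho> * cos \<theta> * u - v * v) / (u * u) / (1 + (v / u)\<^sup>2))) / (1 - \<rho>\<^sup>2) = 1 / (u\<^sup>2 + v\<^sup>2)"
    proof -
      have "(\<rho> * cos \<theta> * u - v * v) / (u * u) / (1 + (v / u)\<^sup>2) = (\<rho> * cos \<theta> * u - v\<^sup>2) / (u\<^sup>2 + v\<^sup>2)"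
        using u uv by (simp add: power_divide power2_eq_square divide_simps)
      moreover have "1 + 2 * ((\<rho> * cos \<theta> * u - v\<^sup>2) / (u\<^sup>2 + v\<^sup>2)) = (u\<^sup>2 + v\<^sup>2 + 2 * (\<rho> * cos \<theta> * u - v\<^sup>2)) / (u\<^sup>2 + v\<^sup>2)"
      proof -
        have "1 + 2 * (E / D) = (D + 2 * E) / D" if "0 < D" for D E :: real using that by (simp add: field_simps)
        then show ?thesis using uv by blast
      qed
      moreover have "u\<^sup>2 + v\<^sup>2 + 2 * (\<rho> * cos \<theta> * u - v\<^sup>2) = 1 - \<rho>\<^sup>2"
        unfolding sc[symmetric] rc by (simp add: power2_eq_square algebra_simps)
      ultimately show ?thesis using \<rho>2 by simp
    qed
    finally show "(F has_real_derivative 1 / norm (1 - of_real \<rho> * cis \<theta>) ^ 2) (at \<theta>)"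
      unfolding nrm u_def v_def .
  qed auto
  then show ?thesis by (simp add: F_def diff_divide_distrib[symmetric])
qed

text \<open>The test functions concentrate near the boundary point \<open>1\<close>, in a region of size \<open>y\<close>.\<close>

definition test_function :: "nat \<Rightarrow> real \<Rightarrow> complex \<Rightarrow> complex" where
  "test_function \<gamma> y z = (of_real y / (1 - of_real (1 - y) * z)) ^ \<gamma>"

lemma test_function_denominator:
  assumes "0 < y" "y \<le> 1" "norm z < 1"
  shows "1 - (1 - y) * norm z \<le> norm (1 - of_real (1 - y) * z)" "0 < 1 - (1 - y) * norm z"
    "1 - complex_of_real (1 - y) * z \<noteq> 0"
proof -
  have "norm (complex_of_real (1 - y) * z) = (1 - y) * norm z"
    unfolding norm_mult norm_of_real using assms by simp
  then show 1: "1 - (1 - y) * norm z \<le> norm (1 - of_real (1 - y) * z)"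
    using norm_triangle_ineq2[of 1 "of_real (1 - y) * z"] by simp
  have "(1 - y) * norm z \<le> 1 * norm z" using assms by (intro mult_right_mono) auto
  then show 2: "0 < 1 - (1 - y) * norm z" using assms by linarith
  show "1 - complex_of_real (1 - y) * z \<noteq> 0" using 1 2 by auto
qed

lemma test_function_holomorphic:
  assumes "0 < y" "y \<le> 1"
  shows "test_function \<gamma> y holomorphic_on ball 0 1"
  unfolding test_function_def 
  by (intro holomorphic_intros test_function_denominator(3)[OF assms]) auto

text \<open>With \<rho> = (1 - y) s, all powers of the denominator except two are bounded by means
  of its minimum 1 - \<rho>, and the last two give the Poisson integral. What remains is y times a
  power of y / (1 - \<rho>), at most twice y / (y + (1 - s)) in its base.\<close>

lemma circle_mean_test_function:
  assumes y: "0 < y" "y \<le> 1" and s: "0 < s" "s < 1" and p: "0 < p" and m: "1 \<le> m" "real m + 1 \<le> real \<gamma> * p"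
  shows "circle_mean p (test_function \<gamma> y) s \<le> ennreal (2 powr (real \<gamma> * p - 1) * y * (y / (y + (1 - s))) ^ m)"
proof -
  define \<sigma> where "\<sigma> = real \<gamma> * p"
  have \<sigma>: "2 \<le> \<sigma>" "real m \<le> \<sigma> - 1" using m by (auto simp: \<sigma>_def)
  define \<rho> where "\<rho> = (1 - y) * s"
  have "\<rho> \<le> 1 * s" unfolding \<rho>_def using y s by (intro mult_right_mono) auto
  moreover have "0 \<le> \<rho>" using y s by (simp add: \<rho>_def)
  ultimately have \<rho>: "0 \<le> \<rho>" "\<rho> < 1" using s by linarith+
  have pt: "norm (test_function \<gamma> y (of_real s * cis \<theta>)) powr p \<le> y powr \<sigma> * (1 - \<rho>) powr (2 - \<sigma>) * (1 / norm (1 - of_real \<rho> * cis \<theta>) ^ 2)" for \<theta>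
  proof -
    define d where "d = norm (1 - of_real \<rho> * cis \<theta>)"
    have d: "1 - \<rho> \<le> d"
      using norm_triangle_ineq2[of 1 "of_real \<rho> * cis \<theta>"] \<rho> by (simp add: d_def norm_mult)
    then have d0: "0 < d" using \<rho> by simp
    have "norm (test_function \<gamma> y (of_real s * cis \<theta>)) = (y / d) ^ \<gamma>"
      using y by (simp add: test_function_def norm_power norm_divide d_def \<rho>_def mult.assoc del: of_real_diff)
    also have "\<dots> powr p = (y / d) powr \<sigma>"
      using y d0 by (simp add: \<sigma>_def powr_powr flip: powr_realpow)
    also have "\<dots> = y powr \<sigma> * d powr (2 - \<sigma>) * (1 / d ^ 2)"
    proof -
      have "d powr \<sigma> = d powr (\<sigma> - 2) * d powr 2" by (simp flip: powr_add)
      then have "1 / d powr \<sigma> = d powr (2 - \<sigma>) * (1 / d ^ 2)"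
        using d0 by (simp add: powr_diff powr_numeral field_simps)
      moreover have "(y / d) powr \<sigma> = y powr \<sigma> * (1 / d powr \<sigma>)" using y d0 by (simp add: powr_divide)
      ultimately show ?thesis by (simp only: mult.assoc)
    qed
    also have "\<dots> \<le> y powr \<sigma> * (1 - \<rho>) powr (2 - \<sigma>) * (1 / d ^ 2)"
      using d d0 \<rho> \<sigma> by (intro mult_right_mono mult_left_mono powr_mono2') auto
    finally show ?thesis by (simp add: d_def)
  qed
  have "circle_mean p (test_function \<gamma> y) s \<le> ennreal (1 / (2 * pi)) *
     (\<integral>\<^sup>+\<theta>. ennreal (y powr \<sigma> * (1 - \<rho>) powr (2 - \<sigma>)) * (ennreal (1 / norm (1 - of_real \<rho> * cis \<theta>) ^ 2) * indicator {0..2*pi} \<theta>) \<partial>lborel)"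
    unfolding circle_mean_def
    by (intro mult_left_mono nn_integral_mono) (use pt in \<open>auto simp: indicator_def ennreal_mult[symmetric] intro!: ennreal_leI\<close>)
  also have "(\<integral>\<^sup>+\<theta>. ennreal (y powr \<sigma> * (1 - \<rho>) powr (2 - \<sigma>)) * (ennreal (1 / norm (1 - of_real \<rho> * cis \<theta>) ^ 2) * indicator {0..2*pi} \<theta>) \<partial>lborel)
    = ennreal (y powr \<sigma> * (1 - \<rho>) powr (2 - \<sigma>)) * ennreal (2 * pi / (1 - \<rho>\<^sup>2))"
    by (subst nn_integral_cmult) (simp_all add: poisson_integral[OF \<rho>])
  also have "ennreal (1 / (2 * pi)) * (ennreal (y powr \<sigma> * (1 - \<rho>) powr (2 - \<sigma>)) * ennreal (2 * pi / (1 - \<rho>\<^sup>2))) =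
     ennreal (y powr \<sigma> * (1 - \<rho>) powr (2 - \<sigma>) / (1 - \<rho>\<^sup>2))"
    using \<rho> by (simp add: ennreal_mult'[symmetric])
  also have "\<dots> \<le> ennreal (2 powr (\<sigma> - 1) * y * (y / (y + (1 - s))) ^ m)"
  proof (rule ennreal_leI)
    have "1 - \<rho> \<le> 1 - \<rho>\<^sup>2" using \<rho> by (simp add: power2_eq_square mult_left_le)
    then have "y powr \<sigma> * (1 - \<rho>) powr (2 - \<sigma>) / (1 - \<rho>\<^sup>2) \<le> y powr \<sigma> * (1 - \<rho>) powr (2 - \<sigma>) / (1 - \<rho>)"
      using \<rho> by (intro divide_left_mono) (auto intro!: mult_pos_pos simp: power_less_one_iff)
    also have "\<dots> = y powr \<sigma> * (1 - \<rho>) powr (1 - \<sigma>)"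
    proof -
      have "(1 - \<rho>) powr (2 - \<sigma>) = (1 - \<rho>) powr (1 - \<sigma>) * (1 - \<rho>)"
        using powr_add[of "1 - \<rho>" "1 - \<sigma>" 1] \<rho> by simp
      then show ?thesis using \<rho> by simp
    qed
    also have "\<dots> = y * (y / (1 - \<rho>)) powr (\<sigma> - 1)"
    proof -
      have "y powr \<sigma> = y * y powr (\<sigma> - 1)" using powr_add[of y 1 "\<sigma> - 1"] y by simp
      moreover have "(1 - \<rho>) powr (1 - \<sigma>) = 1 / (1 - \<rho>) powr (\<sigma> - 1)" by (simp add: powr_minus_divide[symmetric])
      ultimately show ?thesis using y \<rho> by (simp add: powr_divide)
    qed
    also have "\<dots> \<le> y * (2 * (y / (y + (1 - s)))) powr (\<sigma> - 1)"
    proof (intro mult_left_mono powr_mono2)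
      \<comment> \<open>This expression is exactly the difference of 2 (1 - \<rho>) and y + (1 -
        s).\<close>
      have "0 \<le> (1 - y) * (1 - s) + y * s" using y s by auto
      then have "y + (1 - s) \<le> 2 * (1 - \<rho>)" by (simp add: \<rho>_def algebra_simps)
      then have "y * (y + (1 - s)) \<le> y * (2 * (1 - \<rho>))" using y by (intro mult_left_mono) auto
      then show "y / (1 - \<rho>) \<le> 2 * (y / (y + (1 - s)))" using y s \<rho> by (simp add: field_simps)
    qed (use y \<rho> \<sigma> in auto)
    also have "\<dots> = y * (2 powr (\<sigma> - 1) * (y / (y + (1 - s))) powr (\<sigma> - 1))"
      using y s by (subst powr_mult) auto
    also have "\<dots> \<le> y * (2 powr (\<sigma> - 1) * (y / (y + (1 - s))) powr real m)"
      using y s \<sigma> by (intro mult_left_mono powr_mono') (auto simp: field_simps)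
    also have "(y / (y + (1 - s))) powr real m = (y / (y + (1 - s))) ^ m" using y s by (intro powr_realpow) auto
    finally show "y powr \<sigma> * (1 - \<rho>) powr (2 - \<sigma>) / (1 - \<rho>\<^sup>2) \<le> 2 powr (\<sigma> - 1) * y * (y / (y + (1 - s))) ^ m"
      by (simp add: mult_ac)
  qed
  finally show ?thesis by (simp add: \<sigma>_def)
qed

text \<open>\<gamma> is taken so large, independently of y, that the circle means decay with an
  order above the doubling exponent of \<nu>; \<open>kernel_integral_le\<close> then returns the
  tail at y. The further factor y reflects the arc of length about y where the test function is
  large.\<close>

lemma test_function_norm:
  assumes n: "doubling_profile \<nu> n" and p: "0 < p"
  shows "\<exists>\<gamma> K. K > 0 \<and> (\<forall>y. 0 < y \<longrightarrow> y \<le> 1 \<longrightarrow> bergman_integral p \<nu> (test_function \<gamma> y) \<le> ennreal (K * y * tail_mass n y))"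
proof -
  obtain k where k: "\<And>y j. 0 < y \<Longrightarrow> tail_mass n (2 ^ j * y) \<le> (2 ^ k) ^ j * tail_mass n y"
    using doubling_profile_constant[OF n] by blast
  define m where "m = Suc k"
  obtain \<gamma> :: nat where "(real m + 1) / p \<le> real \<gamma>" using real_arch_simple by blast
  then have \<gamma>: "real m + 1 \<le> real \<gamma> * p" using p by (simp add: field_simps)
  define K1 where "K1 = 2 powr (real \<gamma> * p - 1)"
  define K where "K = 2 * K1 * 2 ^ (m + 1)"
  have "bergman_integral p \<nu> (test_function \<gamma> y) \<le> ennreal (K * y * tail_mass n y)" if y: "0 < y" "y \<le> 1" for y
  proof -
    note [measurable] = doubling_profileD(6)[OF n]
    have "bergman_integral p \<nu> (test_function \<gamma> y) = 2 * (\<integral>\<^sup>+s. ennreal s * circle_mean p (test_function \<gamma> y) s * ennreal (n s) \<partial>lborel)"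
      by (rule bergman_integral_polar[OF doubling_profileD(1)[OF n] holomorphic_on_imp_continuous_on[OF test_function_holomorphic[OF y]]])
    also have "\<dots> \<le> 2 * (\<integral>\<^sup>+s. ennreal (K1 * y) * (ennreal ((y / (y + (1 - s))) ^ m) * ennreal (n s)) \<partial>lborel)"
    proof (intro mult_left_mono nn_integral_mono)
      fix s :: real
      show "ennreal s * circle_mean p (test_function \<gamma> y) s * ennreal (n s) \<le> ennreal (K1 * y) * (ennreal ((y / (y + (1 - s))) ^ m) * ennreal (n s))"
      proof (cases "s \<in> {0<..<1}")
        case True
        then have "circle_mean p (test_function \<gamma> y) s \<le> ennreal (K1 * y * (y / (y + (1 - s))) ^ m)"
          unfolding K1_def by (intro circle_mean_test_function y p \<gamma>) (auto simp: m_def)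
        also have "\<dots> = ennreal (K1 * y) * ennreal ((y / (y + (1 - s))) ^ m)" using y True by (intro ennreal_mult) (auto simp: K1_def)
        finally have "circle_mean p (test_function \<gamma> y) s \<le> ennreal (K1 * y) * ennreal ((y / (y + (1 - s))) ^ m)" .
        then have "ennreal s * circle_mean p (test_function \<gamma> y) s \<le> 1 * (ennreal (K1 * y) * ennreal ((y / (y + (1 - s))) ^ m))"
          using True by (intro mult_mono) auto
        from mult_right_mono[OF this, of "ennreal (n s)"] show ?thesis by (simp add: mult_ac)
      qed (use doubling_profileD(5)[OF n, of s] in simp)
    qed simp
    also have "\<dots> = 2 * (ennreal (K1 * y) * (\<integral>\<^sup>+s. ennreal ((y / (y + (1 - s))) ^ m) * ennreal (n s) \<partial>lborel))"
      by (subst nn_integral_cmult) auto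
    also have "\<dots> \<le> 2 * (ennreal (K1 * y) * ennreal (2 ^ (m + 1) * tail_mass n y))"
      by (intro mult_left_mono kernel_integral_le[OF n k _ y(1)]) (auto simp: m_def)
    also have "\<dots> = ennreal (2 * (K1 * y * (2 ^ (m + 1) * tail_mass n y)))"
    proof -
      have "2 * (ennreal a * ennreal b) = ennreal (2 * (a * b))" if "0 \<le> a" "0 \<le> b" for a b using that by (simp add: ennreal_mult)
      then show ?thesis using y doubling_profileD(3)[OF n y(1)] by (simp only: K1_def) simp
    qed
    finally show ?thesis by (simp add: K_def mult_ac)
  qed
  moreover have "K > 0" by (simp add: K_def K1_def)
  ultimately show ?thesis by blast
qed

text \<open>At the real point 1 - y/2 both factors of the integrand are nonnegative for every t, so
  nothing cancels and the part over t >= 1 - y may be kept alone. There the test function is at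
  least (2/5)^\<gamma> and the kernel at least a multiple of 1 / (y
  \<open>tail_mass g y\<close>).\<close>

lemma C_op_test_function_ge:
  assumes g: "doubling_profile \<omega> g"
  shows "\<exists>c>0. \<forall>\<mu>\<in>M_plus. \<forall>y. 0 < y \<longrightarrow> y \<le> 1 \<longrightarrow>
    c * measure_tail \<mu> (1 - y) / (y * tail_mass g y) \<le> norm (C_op \<mu> \<omega> (test_function \<gamma> y) (of_real (1 - y / 2)))"
proof -
  obtain c0 where c0: "c0 > 0" "\<And>x. 0 \<le> x \<Longrightarrow> x < 1 \<Longrightarrow> c0 / ((1 - x) * tail_mass g (1 - x)) \<le> kernel_real \<omega> x"
    using kernel_real_ge[OF g] by blast
  obtain k where k: "\<And>y j. 0 < y \<Longrightarrow> tail_mass g (2 ^ j * y) \<le> (2 ^ k) ^ j * tail_mass g y"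
    using doubling_profile_constant[OF g] by blast
  define c where "c = (2/5) ^ \<gamma> * (c0 / (3 / 2 * 2 ^ k))"
  have "c * measure_tail \<mu> (1 - y) / (y * tail_mass g y) \<le> norm (C_op \<mu> \<omega> (test_function \<gamma> y) (of_real (1 - y / 2)))"
    if \<mu>: "\<mu> \<in> M_plus" and y: "0 < y" "y \<le> 1" for \<mu> y
  proof -
    interpret finite_measure \<mu> using M_plusD(1)[OF \<mu>] .
    note [measurable] = M_plusD(4)[OF \<mu>]
    define w where "w = 1 - y / 2"
    have w: "1/2 \<le> w" "w < 1" using y by (auto simp: w_def)
    define T where "T = tail_mass g y"
    have T: "T > 0" using doubling_profileD(3)[OF g y(1)] by (simp add: T_def)
    define \<phi> where "\<phi> x = (y / (1 - (1 - y) * x)) ^ \<gamma> * kernel_real \<omega> x" for x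
    define L where "L = c / (y * T)"
    have L: "0 \<le> L" using c0 T y by (simp add: L_def c_def)
    have xw: "0 \<le> t * w" "t * w < 1" "t * w \<le> w" if "t \<in> {0..<1}" for t
      using that w mult_strict_mono'[of t 1 w 1] mult_right_mono[of t 1 w] by auto
    have den: "0 < 1 - (1 - y) * x" if "0 \<le> x" "x < 1" for x
      using test_function_denominator(2)[OF y, of "of_real x"] that by simp
    have nn: "0 \<le> \<phi> (t * w)" if "t \<in> {0..<1}" for t
      unfolding \<phi>_def using xw[OF that] den[of "t * w"] y that
      by (intro mult_nonneg_nonneg kernel_disc_properties(4)[OF g]) auto
    have ge: "L \<le> \<phi> (t * w)" if t: "t \<in> {1 - y..<1}" for t
    proof -
      have t': "t \<in> {0..<1}" using t y by auto
      define x where "x = t * w"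
      have x: "0 \<le> x" "x < 1" using xw[OF t'] by (auto simp: x_def)
      have "(1 - y) * (1 - y / 2) \<le> x" unfolding x_def w_def using t y by (intro mult_right_mono) auto
      moreover have "(1 - y) * (1 - y / 2) = 1 - 3 / 2 * y + y * y / 2" by (simp add: field_simps)
      \<comment> \<open>Origin of the constants: 3/2 from this bound, 2^k from one doubling of the
        tail at 1 - x, and 5/2, hence (2/5)^\<gamma>, from adding y x <= y to it.\<close>
      ultimately have x1: "1 - x \<le> 3 / 2 * y" using y mult_nonneg_nonneg[of y y] by linarith
      have "y * x \<le> y * 1" using x y by (intro mult_left_mono) auto
      then have "1 - (1 - y) * x \<le> 5 / 2 * y" using x1 by (simp add: algebra_simps)
      then have "2/5 \<le> y / (1 - (1 - y) * x)" using den[OF x] y by (simp add: field_simps)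
      then have 1: "(2/5) ^ \<gamma> \<le> (y / (1 - (1 - y) * x)) ^ \<gamma>" by (intro power_mono) auto
      have "tail_mass g (1 - x) \<le> tail_mass g (2 ^ 1 * y)"
        using x1 y by (intro tail_mass_mono[OF doubling_profileD(1,2)[OF g]]) auto
      also have "\<dots> \<le> 2 ^ k * T" using k[OF y(1), of 1] by (simp add: T_def)
      finally have "(1 - x) * tail_mass g (1 - x) \<le> (3 / 2 * y) * (2 ^ k * T)"
        using x1 x y doubling_profileD(3)[OF g, of "1 - x"] by (intro mult_mono) auto
      then have "c0 / ((3 / 2 * y) * (2 ^ k * T)) \<le> c0 / ((1 - x) * tail_mass g (1 - x))"
        using c0 x doubling_profileD(3)[OF g, of "1 - x"] y T by (intro divide_left_mono mult_pos_pos) auto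
      also have "\<dots> \<le> kernel_real \<omega> x" by (rule c0(2)[OF x])
      finally have "(2/5) ^ \<gamma> * (c0 / ((3 / 2 * y) * (2 ^ k * T))) \<le> \<phi> x"
        unfolding \<phi>_def using 1 c0 y T den[OF x] by (intro mult_mono) auto
      then show ?thesis by (simp add: L_def c_def x_def field_simps)
    qed
    have cont: "continuous_on {0..w} \<phi>"
    proof -
      have "continuous_on {0..w} (\<lambda>x. Re (kernel_disc \<omega> (of_real x)))"
        by (intro continuous_intros continuous_on_compose2[OF holomorphic_on_imp_continuous_on[OF kernel_disc_properties(1)[OF g]]])
          (use w in auto)
      then have "continuous_on {0..w} (kernel_real \<omega>)"
        by (rule continuous_on_eq) (use w kernel_disc_properties(3)[OF g] in auto)
      then show ?thesis unfolding \<phi>_def using den w by (intro continuous_intros) (auto simp: less_imp_neq[symmetric] dest: order.strict_trans1)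
    qed
    have comp: "C_op \<mu> \<omega> (test_function \<gamma> y) (of_real w) = (\<integral>t. of_real (\<phi> (t * w)) \<partial>\<mu>)"
      unfolding C_op_alt
    proof (rule Bochner_Integration.integral_cong[OF refl])
      fix t assume "t \<in> space \<mu>"
      then have t: "t \<in> {0..<1}" using M_plusD(2)[OF \<mu>] by auto
      show "test_function \<gamma> y (of_real t * of_real w) * kernel_disc \<omega> (of_real t * of_real w) = of_real (\<phi> (t * w))"
        using kernel_disc_properties(3)[OF g xw(1,2)[OF t]] by (simp add: test_function_def \<phi>_def)
    qed
    have meas: "(\<lambda>t. \<phi> (t * w)) \<in> borel_measurable \<mu>"
    proof -
      have "(\<lambda>x. indicator {0..w} x *\<^sub>R \<phi> x) \<in> borel_measurable borel"
        by (rule borel_measurable_continuous_on_indicator[OF _ cont]) simp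
      then have "(\<lambda>t. indicator {0..w} (t * w) *\<^sub>R \<phi> (t * w)) \<in> borel_measurable \<mu>"
        by (rule measurable_compose[rotated]) measurable
      then show ?thesis
        by (rule measurable_cong[THEN iffD1, rotated]) (use M_plusD(2)[OF \<mu>] xw in auto)
    qed
    have "bounded (\<phi> ` {0..w})" by (rule compact_imp_bounded[OF compact_continuous_image[OF cont compact_Icc]])
    then obtain B where "\<forall>x\<in>\<phi> ` {0..w}. norm x \<le> B" unfolding bounded_iff by blast
    then have B: "norm (\<phi> x) \<le> B" if "x \<in> {0..w}" for x using that by blast
    have int: "integrable \<mu> (\<lambda>t. \<phi> (t * w))"
      by (rule integrable_const_bound[where B=B, OF AE_I2 meas]) (use M_plusD(2)[OF \<mu>] xw B in auto)
    have "measure_tail \<mu> (1 - y) * L = (\<integral>t. indicator {1 - y..<1} t * L \<partial>\<mu>)"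
      using M_plusD(5)[OF \<mu>, of "1 - y"] y by (simp add: measure_tail_def M_plusD(2)[OF \<mu>] Int_absorb2)
    also have "\<dots> \<le> (\<integral>t. \<phi> (t * w) \<partial>\<mu>)"
    proof (rule integral_mono[OF _ int])
      show "integrable \<mu> (\<lambda>t. indicator {1 - y..<1} t * L)"
        using M_plusD(5)[OF \<mu>, of "1 - y"] y by (intro integrable_mult_left) (simp add: emeasure_eq_measure)
      fix t assume "t \<in> space \<mu>"
      then show "indicator {1 - y..<1} t * L \<le> \<phi> (t * w)" using ge[of t] nn[of t] M_plusD(2)[OF \<mu>] by (auto simp: indicator_def)
    qed
    also have "\<dots> \<le> norm (C_op \<mu> \<omega> (test_function \<gamma> y) (of_real w))"
      unfolding comp integral_of_real norm_of_real by simp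
    finally show ?thesis by (simp add: L_def T_def w_def mult_ac)
  qed
  moreover have "c > 0" using c0 by (simp add: c_def)
  ultimately show ?thesis by blast
qed

text \<open>The pointwise bound with \<delta> = y / 4 reaches the circle of radius 1 - y / 4,
  monotonicity carries it to all larger radii, and their total weight is
  \<open>tail_mass h (y / 4)\<close>, two doublings away from \<open>tail_mass h y\<close>.\<close>

lemma bergman_integral_ge:
  assumes h: "doubling_profile \<eta> h" and q: "0 < q"
  shows "\<exists>c>0. \<forall>F y. F holomorphic_on ball 0 1 \<longrightarrow> 0 < y \<longrightarrow> y \<le> 1 \<longrightarrow>
    ennreal (c * y * tail_mass h y * norm (F (of_real (1 - y / 2))) powr q) \<le> bergman_integral q \<eta> F"
proof -
  obtain k where k: "\<And>y j. 0 < y \<Longrightarrow> tail_mass h (2 ^ j * y) \<le> (2 ^ k) ^ j * tail_mass h y"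
    using doubling_profile_constant[OF h] by blast
  \<comment> \<open>3/32 is the product of the 2 in the polar formula, the lower bound 3/4 for s,
    and 1/16 from inverting the pointwise constant 16 / y. The denominator stands for the two
    doublings.\<close>
  define c where "c = (3 / 32 / (2 ^ k) ^ 2 :: real)"
  note [measurable] = doubling_profileD(6)[OF h]
  have "ennreal (c * y * tail_mass h y * norm (F (of_real (1 - y / 2))) powr q) \<le> bergman_integral q \<eta> F"
    if F: "F holomorphic_on ball 0 1" and y: "0 < y" "y \<le> 1" for F y
  proof -
    define v where "v = norm (F (of_real (1 - y / 2))) powr q"
    have v: "0 \<le> v" by (simp add: v_def)
    have nw: "norm (complex_of_real (1 - y / 2)) = 1 - y / 2" unfolding norm_of_real using y by simp
    have cm: "ennreal (y / 16 * v) \<le> circle_mean q F s" if s: "1 - y / 4 \<le> s" "s < 1" for s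
    proof -
      have "ennreal v \<le> ennreal (4 / (y / 4)) * circle_mean q F (1 - y / 2 + y / 4)"
        using pointwise_le_circle_mean[OF F q, of "y / 4" "of_real (1 - y / 2)"] y unfolding v_def nw by simp
      also have "\<dots> \<le> ennreal (4 / (y / 4)) * circle_mean q F s"
        using y s by (intro mult_left_mono circle_mean_mono[OF F q]) auto
      finally have "ennreal (y / 16) * ennreal v \<le> ennreal (y / 16) * (ennreal (4 / (y / 4)) * circle_mean q F s)" by (rule mult_left_mono) simp
      also have "\<dots> = ennreal (y / 16 * (4 / (y / 4))) * circle_mean q F s"
        unfolding mult.assoc[symmetric] using y by (subst ennreal_mult) auto
      also have "y / 16 * (4 / (y / 4)) = 1" using y by simp
      finally have "ennreal (y / 16) * ennreal v \<le> circle_mean q F s" by simp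
      moreover have "ennreal (y / 16 * v) = ennreal (y / 16) * ennreal v" using y v by (intro ennreal_mult) auto
      ultimately show ?thesis by (simp only:)
    qed
    have "tail_mass h y \<le> (2 ^ k) ^ 2 * tail_mass h (y / 4)" using k[of "y / 4" 2] y by simp
    then have "c * y * tail_mass h y * v \<le> c * y * ((2 ^ k) ^ 2 * tail_mass h (y / 4)) * v"
      using y v by (intro mult_right_mono mult_left_mono) (auto simp: c_def)
    also have "\<dots> = 2 * (3 / 4 * (y / 16 * v) * tail_mass h (y / 4))" by (simp add: c_def)
    finally have "ennreal (c * y * tail_mass h y * v) \<le> ennreal (2 * (3 / 4 * (y / 16 * v) * tail_mass h (y / 4)))"
      by (rule ennreal_leI)
    also have "\<dots> = 2 * (ennreal (3 / 4 * (y / 16 * v)) * ennreal (tail_mass h (y / 4)))"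
    proof -
      have "ennreal (2 * (a * b)) = 2 * (ennreal a * ennreal b)" if "0 \<le> a" "0 \<le> b" for a b using that by (simp add: ennreal_mult)
      then show ?thesis by this (use y v doubling_profileD(3)[OF h, of "y / 4"] in auto)
    qed
    also have "\<dots> = 2 * (\<integral>\<^sup>+s. ennreal (3 / 4 * (y / 16 * v)) * (ennreal (h s) * indicator {1 - y / 4..} s) \<partial>lborel)"
      by (subst nn_integral_cmult) (auto simp: tail_mass_nn[OF doubling_profileD(1,2)[OF h]])
    also have "\<dots> \<le> 2 * (\<integral>\<^sup>+s. ennreal s * circle_mean q F s * ennreal (h s) \<partial>lborel)"
    proof (intro mult_left_mono nn_integral_mono)
      fix s :: real
      show "ennreal (3 / 4 * (y / 16 * v)) * (ennreal (h s) * indicator {1 - y / 4..} s) \<le> ennreal s * circle_mean q F s * ennreal (h s)"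
      proof (cases "s \<in> {0<..<1} \<and> 1 - y / 4 \<le> s")
        case True
        have "ennreal (3 / 4 * (y / 16 * v)) = ennreal (3 / 4) * ennreal (y / 16 * v)" using y v by (intro ennreal_mult) auto
        also have "\<dots> \<le> ennreal s * circle_mean q F s" using True y by (intro mult_mono ennreal_leI cm) auto
        finally show ?thesis using True by (simp add: mult_right_mono)
      next
        case False
        then show ?thesis using doubling_profileD(5)[OF h, of s] by (auto simp: indicator_def)
      qed
    qed simp
    also have "\<dots> = bergman_integral q \<eta> F"
      by (rule bergman_integral_polar[OF doubling_profileD(1)[OF h] holomorphic_on_imp_continuous_on[OF F], symmetric])
    finally show ?thesis by (simp add: v_def)
  qed
  moreover have "c > 0" by (simp add: c_def)
  ultimately show ?thesis by blast
qed

section \<open>Upper bound: dyadic shells\<close>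

text \<open>The ratio K of \<open>D_check\<close> is enlarged to a power of 2, so that one step
  crosses exactly m dyadic shells.\<close>

definition reverse_doubling :: "(real \<Rightarrow> real) \<Rightarrow> bool" where
  "reverse_doubling g \<longleftrightarrow> (\<exists>C>1. \<exists>m>0. \<forall>y. 0 < y \<longrightarrow> y \<le> 1 \<longrightarrow> C * tail_mass g (y / 2 ^ m) \<le> tail_mass g y)"

lemma D_check_reverse_doubling:
  assumes "\<omega> \<in> D_check" "doubling_profile \<omega> g"
  shows "reverse_doubling g"
proof -
  obtain C K where CK: "C > 1" "K > 1" "\<And>y. 0 < y \<Longrightarrow> y \<le> 1 \<Longrightarrow> C * tail_mass g (y / K) \<le> tail_mass g y"
    using D_check_profile[OF assms] by blast
  obtain m where m: "K < 2 ^ m" using real_arch_pow[of 2 K] by auto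
  have "m > 0" using m CK(2) by (cases m) auto
  moreover have "C * tail_mass g (y / 2 ^ m) \<le> tail_mass g y" if y: "0 < y" "y \<le> 1" for y
  proof -
    have "y / 2 ^ m \<le> y / K" using m CK(2) y by (intro divide_left_mono) auto
    then have "tail_mass g (y / 2 ^ m) \<le> tail_mass g (y / K)"
      by (rule tail_mass_mono[OF doubling_profileD(1,2)[OF assms(2)]])
    then have "C * tail_mass g (y / 2 ^ m) \<le> C * tail_mass g (y / K)" using CK(1) by simp
    then show ?thesis using CK(3)[OF y] by linarith
  qed
  ultimately show ?thesis using CK(1) unfolding reverse_doubling_def by blast
qed

text \<open>A factor 1 / C is gained over every m shells, that is \<kappa> = C^(-1/m) per shell.
  Choosing A = C pays for the incomplete last group of fewer than m shells.\<close>

lemma reverse_doubling_geometric: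
  assumes g: "doubling_profile \<omega> g" and "reverse_doubling g"
  shows "\<exists>A>0. \<exists>\<kappa>. 0 < \<kappa> \<and> \<kappa> < 1 \<and> (\<forall>n k. k \<le> n \<longrightarrow> tail_mass g (1 / 2 ^ n) \<le> A * \<kappa> ^ (n - k) * tail_mass g (1 / 2 ^ k))"
proof -
  from assms(2) obtain C m where C: "C > 1" "m > 0"
    "\<And>y. 0 < y \<Longrightarrow> y \<le> 1 \<Longrightarrow> C * tail_mass g (y / 2 ^ m) \<le> tail_mass g y"
    unfolding reverse_doubling_def by blast
  define \<kappa> where "\<kappa> = (1 / C) powr (1 / real m)"
  have \<kappa>: "0 < \<kappa>" "\<kappa> < 1" using C powr_less_mono2[of "1 / real m" "1 / C" 1] by (auto simp: \<kappa>_def)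
  have \<kappa>m: "\<kappa> ^ m = 1 / C" using C by (simp add: \<kappa>_def powr_powr flip: powr_realpow)
  have it: "C ^ j * tail_mass g (y / (2 ^ m) ^ j) \<le> tail_mass g y" if y: "0 < y" "y \<le> 1" for y j
  proof (induction j)
    case (Suc j)
    have "1 \<le> ((2::real) ^ m) ^ j" by (intro one_le_power) simp
    then have "y \<le> (2 ^ m) ^ j" using y(2) by linarith
    then have "y / (2 ^ m) ^ j \<le> 1" by (simp add: divide_le_eq)
    then have "C * tail_mass g (y / (2 ^ m) ^ j / 2 ^ m) \<le> tail_mass g (y / (2 ^ m) ^ j)" using y by (intro C(3)) auto
    then have "C ^ j * (C * tail_mass g (y / (2 ^ m) ^ Suc j)) \<le> C ^ j * tail_mass g (y / (2 ^ m) ^ j)"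
      using C(1) by (intro mult_left_mono) (auto simp: mult_ac)
    then show ?case using Suc by (simp add: mult_ac)
  qed simp
  have "tail_mass g (1 / 2 ^ n) \<le> C * \<kappa> ^ (n - k) * tail_mass g (1 / 2 ^ k)" if "k \<le> n" for n k
  proof -
    define d where "d = n - k"
    define j where "j = d div m"
    have Tk: "0 < tail_mass g (1 / 2 ^ k)" by (intro doubling_profileD(3)[OF g]) simp
    have jm: "m * j \<le> d" "d \<le> m * Suc j" using C(2) by (auto simp: j_def less_imp_le dividend_less_times_div)
    have "(2::real) ^ k * 2 ^ (m * j) \<le> 2 ^ n"
      using jm(1) that unfolding d_def power_add[symmetric] by (intro power_increasing) auto
    then have "1 / 2 ^ n \<le> 1 / ((2::real) ^ k * 2 ^ (m * j))" by (intro divide_left_mono) auto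
    then have "1 / 2 ^ n \<le> 1 / 2 ^ k / ((2::real) ^ m) ^ j" by (simp add: power_mult)
    then have "tail_mass g (1 / 2 ^ n) \<le> tail_mass g (1 / 2 ^ k / (2 ^ m) ^ j)"
      by (rule tail_mass_mono[OF doubling_profileD(1,2)[OF g]])
    also have "\<dots> \<le> (1 / C ^ j) * tail_mass g (1 / 2 ^ k)" using it[of "1 / 2 ^ k" j] C(1) by (simp add: field_simps)
    also have "\<dots> \<le> (C * \<kappa> ^ d) * tail_mass g (1 / 2 ^ k)"
    proof (rule mult_right_mono)
      have "1 / C ^ j = C * \<kappa> ^ (m * Suc j)" using C(1) unfolding power_mult \<kappa>m by (simp add: power_divide)
      also have "\<dots> \<le> C * \<kappa> ^ d" using jm(2) \<kappa> C(1) by (intro mult_left_mono power_decreasing) auto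
      finally show "1 / C ^ j \<le> C * \<kappa> ^ d" .
    qed (use Tk in simp)
    finally show ?thesis by (simp add: d_def)
  qed
  then show ?thesis using C(1) \<kappa> by (intro exI[of _ C] conjI exI[of _ \<kappa>]) auto
qed

definition dyadic_shell :: "nat \<Rightarrow> real set" where
  "dyadic_shell k = {1 - 1 / 2 ^ k..<1 - 1 / 2 ^ Suc k}"

lemma dyadic_shell_borel [measurable]: "dyadic_shell k \<in> sets borel"
  by (simp add: dyadic_shell_def)

lemma disjoint_dyadic_shell: "disjoint_family dyadic_shell"
proof -
  have "dyadic_shell i \<inter> dyadic_shell j = {}" if "i < j" for i j
  proof -
    have "(2::real) ^ Suc i \<le> 2 ^ j" using that by (intro power_increasing) auto
    then have "1 / (2::real) ^ j \<le> 1 / 2 ^ Suc i" by (intro divide_left_mono) auto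
    then show ?thesis by (auto simp: dyadic_shell_def)
  qed
  then show ?thesis unfolding disjoint_family_on_def by (metis inf_commute linorder_neqE_nat)
qed

lemma dyadic_shell_cover:
  assumes "1 - 1 / 2 ^ k \<le> s" "s < 1 - 1 / 2 ^ (k + m)"
  shows "\<exists>i<m. s \<in> dyadic_shell (k + i)"
  using assms
proof (induction m)
  case (Suc m)
  show ?case
  proof (cases "s < 1 - 1 / 2 ^ (k + m)")
    case True then show ?thesis using Suc by (meson less_Suc_eq)
  next
    case False
    then have "s \<in> dyadic_shell (k + m)" using Suc.prems by (auto simp: dyadic_shell_def)
    then show ?thesis by auto
  qed
qed simp

lemma dyadic_shell_exists:
  assumes "0 \<le> s" "s < 1"
  shows "\<exists>k. s \<in> dyadic_shell k"
proof -
  obtain m where "(1 / 2::real) ^ m < 1 - s" using real_arch_pow_inv[of "1 - s" "1/2"] assms by auto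
  then show ?thesis using dyadic_shell_cover[of 0 s m] assms by (auto simp: power_one_over)
qed

text \<open>By reverse doubling a fixed portion of the tail at y = 2^(-k-2) lies in the annulus E k
  adjacent to it, and by monotonicity the mean at its inner radius is below the means inside. The
  annuli cover each point at most m times, so the series is bounded by one integral.\<close>

lemma circle_mean_tail_sum_le:
  assumes n: "doubling_profile \<nu> n" and rd: "reverse_doubling n" and p: "0 < p"
  shows "\<exists>K>0. \<forall>f. f holomorphic_on ball 0 1 \<longrightarrow>
    (\<Sum>k. ennreal (tail_mass n (1 / 2 ^ k)) * circle_mean p f (1 - 1 / 2 ^ (k + 2))) \<le> ennreal K * bergman_integral p \<nu> f"
proof -
  obtain d where d: "\<And>y j. 0 < y \<Longrightarrow> tail_mass n (2 ^ j * y) \<le> (2 ^ d) ^ j * tail_mass n y"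
    using doubling_profile_constant[OF n] by blast
  from rd obtain C m where C: "C > 1" "m > 0"
    "\<And>y. 0 < y \<Longrightarrow> y \<le> 1 \<Longrightarrow> C * tail_mass n (y / 2 ^ m) \<le> tail_mass n y"
    unfolding reverse_doubling_def by blast
  note D = doubling_profileD[OF n] and [measurable] = doubling_profileD(6)[OF n]
  note T = tail_mass_nn[OF D(1,2)]
  define K0 where "K0 = (2 ^ d) ^ 2 * (C / (C - 1))"
  have K0: "K0 > 0" using C by (simp add: K0_def)
  \<comment> \<open>The inner radius is two scales closer to 1 than the tail at 2^(-k): this leaves
    room for the radius shift in \<open>circle_mean_exponent\<close>, two doublings bridge the gap,
    and s stays away from 0, where the factor s of the polar form degenerates.\<close>
  define E where "E k = {1 - 1 / 2 ^ (k + 2)..<1 - 1 / (2::real) ^ (k + 2 + m)}" for k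
  have [measurable]: "E k \<in> sets borel" for k by (simp add: E_def)
  have "(\<Sum>k. ennreal (tail_mass n (1 / 2 ^ k)) * circle_mean p f (1 - 1 / 2 ^ (k + 2))) \<le> ennreal (K0 * real m) * bergman_integral p \<nu> f"
    if f: "f holomorphic_on ball 0 1" for f
  proof -
    define W where "W s = (circle_mean p f s * indicator {0<..<1} s) * ennreal (n s)" for s
    have [measurable]: "W \<in> borel_measurable borel"
    proof -
      define c where "c s = circle_mean p f s * indicator {0<..<1} s" for s
      have [measurable]: "c \<in> borel_measurable borel"
        using circle_mean_measurable[OF holomorphic_on_imp_continuous_on[OF f]] unfolding c_def .
      show ?thesis unfolding W_def c_def[symmetric] by measurable
    qed
    have part: "ennreal (tail_mass n (1 / 2 ^ k)) * circle_mean p f (1 - 1 / 2 ^ (k + 2)) \<le> ennreal K0 * (\<integral>\<^sup>+s\<in>E k. W s \<partial>lborel)" for k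
    proof -
      define y where "y = 1 / (2::real) ^ (k + 2)"
      have y: "0 < y" "y \<le> 1/4" by (auto simp: y_def field_simps)
      define \<Delta> where "\<Delta> = tail_mass n y - tail_mass n (y / 2 ^ m)"
      have mono: "tail_mass n (y / 2 ^ m) \<le> tail_mass n y"
        using y by (intro tail_mass_mono[OF D(1,2)]) (simp add: divide_le_eq)
      then have \<Delta>0: "0 \<le> \<Delta>" by (simp add: \<Delta>_def)
      have "C * tail_mass n (y / 2 ^ m) \<le> tail_mass n y" using y by (intro C(3)) auto
      \<comment> \<open>The deeper tail is at most 1 / C of the whole, so the annulus retains at
        least the portion (C - 1) / C.\<close>
      then have "(C - 1) * tail_mass n y \<le> C * \<Delta>" by (simp add: \<Delta>_def algebra_simps)
      then have 1: "tail_mass n y \<le> C / (C - 1) * \<Delta>" using C(1) by (simp add: field_simps)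
      have "tail_mass n (1 / 2 ^ k) = tail_mass n (2 ^ 2 * y)" by (simp add: y_def power_add)
      also have "\<dots> \<le> (2 ^ d) ^ 2 * tail_mass n y" by (rule d[OF y(1)])
      also have "\<dots> \<le> (2 ^ d) ^ 2 * (C / (C - 1) * \<Delta>)" by (intro mult_left_mono 1) auto
      finally have 2: "tail_mass n (1 / 2 ^ k) \<le> K0 * \<Delta>" by (simp add: K0_def)
      have E: "E k = {1 - y..<1 - y / 2 ^ m}" by (simp add: E_def y_def power_add mult.assoc)
      have "ennreal (tail_mass n y) = (\<integral>\<^sup>+s\<in>{1 - y..}. ennreal (n s) \<partial>lborel)" by (rule T(1)[symmetric])
      also have "\<dots> = (\<integral>\<^sup>+s. ennreal (n s) * indicator (E k) s + ennreal (n s) * indicator {1 - y / 2 ^ m..} s \<partial>lborel)"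
      proof (intro nn_integral_cong)
        fix s :: real
        have "y / 2 ^ m \<le> y" using y by (simp add: divide_le_eq)
        then show "ennreal (n s) * indicator {1 - y..} s = ennreal (n s) * indicator (E k) s + ennreal (n s) * indicator {1 - y / 2 ^ m..} s"
          by (auto simp: E indicator_def)
      qed
      also have "\<dots> = (\<integral>\<^sup>+s\<in>E k. ennreal (n s) \<partial>lborel) + ennreal (tail_mass n (y / 2 ^ m))"
        by (subst nn_integral_add) (auto simp: T(1))
      finally have "ennreal (tail_mass n y) - ennreal (tail_mass n (y / 2 ^ m)) = (\<integral>\<^sup>+s\<in>E k. ennreal (n s) \<partial>lborel)"
        by (simp only: ennreal_add_diff_cancel_right[OF ennreal_neq_top])
      then have 3: "ennreal \<Delta> = (\<integral>\<^sup>+s\<in>E k. ennreal (n s) \<partial>lborel)"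
        unfolding \<Delta>_def by (subst ennreal_minus[symmetric]) (use T(2) in auto)
      have "ennreal \<Delta> * circle_mean p f (1 - y) = (\<integral>\<^sup>+s. ennreal (n s) * indicator (E k) s * circle_mean p f (1 - y) \<partial>lborel)"
        unfolding 3 by (rule nn_integral_multc[symmetric]) measurable
      also have "\<dots> \<le> (\<integral>\<^sup>+s\<in>E k. W s \<partial>lborel)"
      proof (rule nn_integral_mono)
        fix s :: real
        have "circle_mean p f (1 - y) \<le> circle_mean p f s" if "s \<in> E k"
          using that y by (intro circle_mean_mono[OF f p]) (auto simp: E less_trans[of s "1 - y / 2 ^ m" 1])
        moreover have "0 < s" "s < 1" if "s \<in> E k" using that y by (auto simp: E less_trans[of s "1 - y / 2 ^ m" 1])
        ultimately show "ennreal (n s) * indicator (E k) s * circle_mean p f (1 - y) \<le> W s * indicator (E k) s"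
          by (cases "s \<in> E k") (auto simp: W_def mult.commute mult_left_mono)
      qed
      finally have 4: "ennreal \<Delta> * circle_mean p f (1 - y) \<le> (\<integral>\<^sup>+s\<in>E k. W s \<partial>lborel)" .
      have "ennreal (tail_mass n (1 / 2 ^ k)) * circle_mean p f (1 - y) \<le> ennreal (K0 * \<Delta>) * circle_mean p f (1 - y)"
        by (intro mult_right_mono ennreal_leI 2) auto
      also have "\<dots> = ennreal K0 * (ennreal \<Delta> * circle_mean p f (1 - y))" using K0 \<Delta>0 by (simp add: ennreal_mult mult.assoc)
      also have "\<dots> \<le> ennreal K0 * (\<integral>\<^sup>+s\<in>E k. W s \<partial>lborel)" by (rule mult_left_mono[OF 4]) simp
      finally show ?thesis by (simp add: y_def)
    qed
    \<comment> \<open>E k is covered by m consecutive shells, and for a fixed offset i these shells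
      are disjoint as k varies.\<close>
    have count: "(\<Sum>k. indicator (E k) s) \<le> (of_nat m :: ennreal)" for s
    proof -
      have "(\<Sum>k. indicator (E k) s :: ennreal) \<le> (\<Sum>k. \<Sum>i<m. indicator (dyadic_shell (k + 2 + i)) s)"
      proof (intro suminf_le summableI)
        fix k
        show "indicator (E k) s \<le> (\<Sum>i<m. indicator (dyadic_shell (k + 2 + i)) s :: ennreal)"
        proof (cases "s \<in> E k")
          case True
          then obtain i where i: "i < m" "s \<in> dyadic_shell (k + 2 + i)"
            using dyadic_shell_cover[of "k + 2" s m] by (auto simp: E_def)
          have "(\<Sum>i\<in>{i}. indicator (dyadic_shell (k + 2 + i)) s :: ennreal) \<le> (\<Sum>i<m. indicator (dyadic_shell (k + 2 + i)) s)"
            using i by (intro sum_mono2) auto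
          then show ?thesis using True i by simp
        qed simp
      qed
      also have "\<dots> = (\<Sum>i<m. \<Sum>k. indicator (dyadic_shell (k + 2 + i)) s)" by (rule suminf_sum) (rule summableI)
      also have "\<dots> \<le> (\<Sum>i<m. 1)"
      proof (rule sum_mono)
        fix i
        have "disjoint_family (\<lambda>k. dyadic_shell (k + 2 + i))"
          using disjoint_dyadic_shell by (auto simp: disjoint_family_on_def)
        from suminf_indicator[OF this, of s] show "(\<Sum>k. indicator (dyadic_shell (k + 2 + i)) s) \<le> (1::ennreal)"
          by (simp add: indicator_def)
      qed
      also have "\<dots> = of_nat m" by simp
      finally show ?thesis .
    qed
    have far: "s \<ge> 1/2" if "s \<in> E k" for s k
    proof -
      have "1 / (2::real) ^ (k + 2) \<le> 1 / 4" by (simp add: field_simps)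
      then show ?thesis using that unfolding E_def atLeastLessThan_iff by linarith
    qed
    have "(\<Sum>k. ennreal (tail_mass n (1 / 2 ^ k)) * circle_mean p f (1 - 1 / 2 ^ (k + 2))) \<le> (\<Sum>k. ennreal K0 * (\<integral>\<^sup>+s\<in>E k. W s \<partial>lborel))"
      by (intro suminf_le summableI part)
    also have "\<dots> = ennreal K0 * (\<integral>\<^sup>+s. (\<Sum>k. W s * indicator (E k) s) \<partial>lborel)"
      by (subst nn_integral_suminf) auto
    also have "\<dots> \<le> ennreal K0 * (\<integral>\<^sup>+s. of_nat m * (2 * (ennreal s * circle_mean p f s * ennreal (n s))) \<partial>lborel)"
    proof (intro mult_left_mono nn_integral_mono)
      fix s :: real
      show "(\<Sum>k. W s * indicator (E k) s) \<le> of_nat m * (2 * (ennreal s * circle_mean p f s * ennreal (n s)))"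
      proof (cases "\<exists>k. s \<in> E k")
        case True
        then have s: "s \<ge> 1/2" using far by blast
        have "1 \<le> 2 * ennreal s"
        proof -
          have "ennreal 1 \<le> ennreal (2 * s)" using s by (intro ennreal_leI) simp
          then show ?thesis using s by (simp add: ennreal_mult)
        qed
        have "(\<Sum>k. W s * indicator (E k) s) = W s * (\<Sum>k. indicator (E k) s)" by simp
        also have "\<dots> \<le> W s * of_nat m" by (rule mult_left_mono[OF count]) simp
        also have "\<dots> \<le> (circle_mean p f s * ennreal (n s)) * of_nat m"
          by (intro mult_right_mono) (auto simp: W_def indicator_def)
        also have "\<dots> \<le> (2 * ennreal s) * (circle_mean p f s * ennreal (n s) * of_nat m)"
          using mult_right_mono[OF \<open>1 \<le> 2 * ennreal s\<close>, of "circle_mean p f s * ennreal (n s) * of_nat m"] by simp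
        finally show ?thesis by (simp add: mult_ac)
      next
        case False
        then show ?thesis by simp
      qed
    qed simp
    also have "(\<integral>\<^sup>+s. of_nat m * (2 * (ennreal s * circle_mean p f s * ennreal (n s))) \<partial>lborel) =
        of_nat m * (2 * (\<integral>\<^sup>+s. ennreal s * circle_mean p f s * ennreal (n s) \<partial>lborel))"
    proof -
      have e: "ennreal s * circle_mean p f s * ennreal (n s) = ennreal s * W s" for s
        using D(5)[of s] by (cases "s \<in> {0<..<1}") (auto simp: W_def mult_ac)
      show ?thesis unfolding e by (subst nn_integral_cmult, simp, subst nn_integral_cmult, simp_all)
    qed
    also have "2 * (\<integral>\<^sup>+s. ennreal s * circle_mean p f s * ennreal (n s) \<partial>lborel) = bergman_integral p \<nu> f"
      by (rule bergman_integral_polar[OF D(1) holomorphic_on_imp_continuous_on[OF f], symmetric])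
    finally show ?thesis using K0 by (simp add: ennreal_mult mult.assoc ennreal_of_nat_eq_real_of_nat)
  qed
  moreover have "0 < K0 * real m" using K0 C by simp
  ultimately show ?thesis by blast
qed

text \<open>Weighted Hoelder inequality; the constant \<open>2\<^sup>q\<close> comes from optimizing \<open>c\<close> in
  \<open>h \<le> c v + c\<^sup>1\<^sup>-\<^sup>q h\<^sup>q v\<^sup>1\<^sup>-\<^sup>q\<close>.\<close>

lemma powr_le_of_young:
  fixes X V S q :: real
  assumes q: "1 < q" and X: "0 \<le> X" and V: "0 < V" and S: "0 \<le> S"
    and le: "\<And>c. 0 < c \<Longrightarrow> X \<le> c * V + c powr (1 - q) * S"
  shows "X powr q \<le> 2 powr q * V powr (q - 1) * S"
proof (cases "S = 0")
  case True
  \<comment> \<open>The balancing value of c would be 0, so c tends to 0 instead.\<close>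
  have "X \<le> 0"
  proof (rule field_le_epsilon)
    fix e :: real assume "e > 0"
    then show "X \<le> 0 + e" using le[of "e / V"] V True by simp
  qed
  then show ?thesis using X S V q by simp
next
  case False
  then have S: "0 < S" using S by simp
  define c where "c = (S / V) powr (1 / q)"
  have c: "0 < c" using S V by (simp add: c_def)
  have "c powr (1 - q) * S = c * V"
  proof -
    have "c powr (1 - q) = c * c powr (- q)" using c by (simp add: powr_diff powr_minus field_simps)
    also have "c powr (- q) = V / S" using S V q by (simp add: c_def powr_powr powr_minus field_simps)
    finally show ?thesis using S by simp
  qed
  then have "X \<le> 2 * (c * V)" using le[OF c] by linarith
  then have "X powr q \<le> (2 * (c * V)) powr q" using X q by (intro powr_mono2) auto
  also have "\<dots> = 2 powr q * (c powr q * V powr q)" using c V by (simp add: powr_mult)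
  also have "c powr q = S / V" using S V q by (simp add: c_def powr_powr)
  also have "S / V * V powr q = V powr (q - 1) * S" using V by (simp add: powr_diff)
  finally show ?thesis by (simp add: mult_ac)
qed

text \<open>If H exceeds c v, then H^(1-q) is at most (c v)^(1-q), the exponent being negative;
  multiply by H^q.\<close>

lemma young_pointwise:
  fixes H v c q :: real
  assumes "1 < q" "0 \<le> H" "0 < v" "0 < c"
  shows "H \<le> c * v + c powr (1 - q) * (v powr (1 - q) * H powr q)"
proof (cases "H \<le> c * v")
  case True
  then show ?thesis using assms by (simp add: add_increasing2)
next
  case False
  define r where "r = c * v"
  have r: "0 < r" "r < H" using False assms by (auto simp: r_def)
  have "H = H powr (1 - q) * H powr q" using r by (simp flip: powr_add)
  also have "\<dots> \<le> r powr (1 - q) * H powr q" using r assms by (intro mult_right_mono powr_mono2') auto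
  also have "r powr (1 - q) = c powr (1 - q) * v powr (1 - q)" using assms by (simp add: r_def powr_mult)
  finally show ?thesis using assms by (simp add: mult.assoc add_increasing)
qed

text \<open>Young's inequality is used pointwise on the pieces with weights v k and integrated;
  optimizing over the single parameter c comes last. The pieces may overlap, and an infinite right
  side is harmless because V > 0.\<close>

lemma weighted_hoelder:
  fixes H :: "real \<Rightarrow> real" and L :: "nat \<Rightarrow> real set" and v :: "nat \<Rightarrow> real"
  assumes q: "1 < q" and H: "\<And>t. t \<in> space \<mu> \<Longrightarrow> 0 \<le> H t" and [measurable]: "H \<in> borel_measurable \<mu>"
    and L[measurable]: "\<And>k. L k \<in> sets \<mu>" and cover: "space \<mu> \<subseteq> (\<Union>k\<le>N. L k)"
    and v: "\<And>k. 0 < v k" and V: "0 < V" "(\<Sum>k\<le>N. ennreal (v k) * emeasure \<mu> (L k)) \<le> ennreal V"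
    and X: "0 \<le> X" "ennreal X \<le> (\<integral>\<^sup>+t. ennreal (H t) \<partial>\<mu>)"
  shows "ennreal (X powr q) \<le> ennreal (2 powr q * V powr (q - 1)) *
    (\<Sum>k\<le>N. ennreal (v k powr (1 - q)) * (\<integral>\<^sup>+t\<in>L k. ennreal (H t powr q) \<partial>\<mu>))"
proof -
  define S where "S = (\<Sum>k\<le>N. ennreal (v k powr (1 - q)) * (\<integral>\<^sup>+t\<in>L k. ennreal (H t powr q) \<partial>\<mu>))"
  have young: "ennreal X \<le> ennreal (c * V) + ennreal (c powr (1 - q)) * S" if c: "0 < c" for c
  proof -
    have "ennreal X \<le> (\<integral>\<^sup>+t. ennreal (H t) \<partial>\<mu>)" by (rule X(2))
    also have "\<dots> \<le> (\<integral>\<^sup>+t. (\<Sum>k\<le>N. ennreal (c * v k) * indicator (L k) t +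
        ennreal (c powr (1 - q) * v k powr (1 - q)) * (ennreal (H t powr q) * indicator (L k) t)) \<partial>\<mu>)"
    proof (rule nn_integral_mono)
      fix t assume t: "t \<in> space \<mu>"
      then obtain k where k: "k \<le> N" "t \<in> L k" using cover by auto
      have "ennreal (H t) \<le> ennreal (c * v k + c powr (1 - q) * (v k powr (1 - q) * H t powr q))"
        by (intro ennreal_leI young_pointwise q H t v c)
      also have "\<dots> = ennreal (c * v k) + ennreal (c powr (1 - q) * v k powr (1 - q)) * ennreal (H t powr q)"
        using c v[of k] by (simp add: ennreal_plus ennreal_mult[symmetric] mult.assoc)
      also have "\<dots> = (\<Sum>k\<in>{k}. ennreal (c * v k) * indicator (L k) t +
        ennreal (c powr (1 - q) * v k powr (1 - q)) * (ennreal (H t powr q) * indicator (L k) t))" using k by simp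
      also have "\<dots> \<le> (\<Sum>k\<le>N. ennreal (c * v k) * indicator (L k) t +
        ennreal (c powr (1 - q) * v k powr (1 - q)) * (ennreal (H t powr q) * indicator (L k) t))"
        using k by (intro sum_mono2) auto
      finally show "ennreal (H t) \<le> (\<Sum>k\<le>N. ennreal (c * v k) * indicator (L k) t +
        ennreal (c powr (1 - q) * v k powr (1 - q)) * (ennreal (H t powr q) * indicator (L k) t))" .
    qed
    also have "\<dots> = (\<Sum>k\<le>N. ennreal (c * v k) * emeasure \<mu> (L k) +
        ennreal (c powr (1 - q) * v k powr (1 - q)) * (\<integral>\<^sup>+t\<in>L k. ennreal (H t powr q) \<partial>\<mu>))"
      by (simp add: nn_integral_sum nn_integral_add nn_integral_cmult)
    also have "\<dots> = ennreal c * (\<Sum>k\<le>N. ennreal (v k) * emeasure \<mu> (L k)) + ennreal (c powr (1 - q)) * S"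
      using c v unfolding S_def sum_distrib_left sum.distrib[symmetric]
      by (intro sum.cong refl) (simp add: ennreal_mult less_imp_le mult.assoc)
    also have "\<dots> \<le> ennreal c * ennreal V + ennreal (c powr (1 - q)) * S"
      by (intro add_mono mult_left_mono V(2)) auto
    finally show ?thesis using c V(1) by (simp add: ennreal_mult)
  qed
  show ?thesis
  proof (cases S)
    case (real s)
    have "X powr q \<le> 2 powr q * V powr (q - 1) * s"
    proof (rule powr_le_of_young[OF q X(1) V(1) real(1)])
      fix c :: real assume c: "0 < c"
      have "ennreal X \<le> ennreal (c * V + c powr (1 - q) * s)"
        using young[OF c] c V(1) real by (simp add: ennreal_plus ennreal_mult)
      then show "X \<le> c * V + c powr (1 - q) * s"
        by (rule ennreal_le_iff[THEN iffD1, rotated]) (use c V(1) real(1) in auto)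
    qed
    then have "ennreal (X powr q) \<le> ennreal (2 powr q * V powr (q - 1)) * ennreal s"
      using real(1) by (simp add: ennreal_mult[symmetric] ennreal_leI)
    then show ?thesis using real(2) by (simp add: S_def)
  next
    case top
    then show ?thesis using V(1) unfolding S_def[symmetric] by (simp add: ennreal_mult_top)
  qed
qed

section \<open>Circle means of \<open>C_op\<close> on a dyadic shell\<close>

lemma dyadic_shell_M_plus:
  assumes "\<mu> \<in> M_plus"
  shows "dyadic_shell k \<in> sets \<mu>" "emeasure \<mu> (dyadic_shell k) \<le> ennreal (measure_tail \<mu> (1 - 1 / 2 ^ k))"
    "emeasure \<mu> {1 - 1 / 2 ^ k..<1} = ennreal (measure_tail \<mu> (1 - 1 / 2 ^ k))"
proof -
  interpret finite_measure \<mu> using M_plusD(1)[OF assms] .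
  have S: "{1 - 1 / 2 ^ j..<1} \<in> sets \<mu>" for j :: nat by (rule M_plusD(5)[OF assms]) simp
  have "dyadic_shell k = {1 - 1 / 2 ^ k..<1} - {1 - 1 / 2 ^ Suc k..<1}"
  proof -
    have "1 - 1 / 2 ^ Suc k < (1::real)" by simp
    then show ?thesis by (auto simp: dyadic_shell_def)
  qed
  then show 1: "dyadic_shell k \<in> sets \<mu>" using S by (metis sets.Diff)
  have "1 - 1 / (2::real) ^ Suc k \<le> 1" by simp
  then have "dyadic_shell k \<subseteq> {1 - 1 / 2 ^ k..<1}" unfolding dyadic_shell_def by (intro ivl_subset[THEN iffD2]) auto
  then show "emeasure \<mu> (dyadic_shell k) \<le> ennreal (measure_tail \<mu> (1 - 1 / 2 ^ k))"
    unfolding measure_tail_def emeasure_eq_measure[symmetric] using S by (intro emeasure_mono)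
  show "emeasure \<mu> {1 - 1 / 2 ^ k..<1} = ennreal (measure_tail \<mu> (1 - 1 / 2 ^ k))"
    by (simp add: measure_tail_def emeasure_eq_measure)
qed

lemma kernel_real_dyadic:
  assumes g: "doubling_profile \<omega> g"
  shows "\<exists>C>0. \<forall>k x. 0 \<le> x \<longrightarrow> x < 1 \<longrightarrow> 1 / 2 ^ Suc k \<le> 1 - x \<longrightarrow> kernel_real \<omega> x \<le> C * (2 ^ k / tail_mass g (1 / 2 ^ k))"
proof -
  obtain K where K: "K > 0" "\<And>x. 0 \<le> x \<Longrightarrow> x < 1 \<Longrightarrow> kernel_real \<omega> x \<le> K / ((1 - x) * tail_mass g (1 - x))"
    using kernel_real_le[OF g] by blast
  obtain d where d: "\<And>y j. 0 < y \<Longrightarrow> tail_mass g (2 ^ j * y) \<le> (2 ^ d) ^ j * tail_mass g y"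
    using doubling_profile_constant[OF g] by blast
  have "kernel_real \<omega> x \<le> (K * (2 * 2 ^ d)) * (2 ^ k / tail_mass g (1 / 2 ^ k))"
    if x: "0 \<le> x" "x < 1" "1 / 2 ^ Suc k \<le> 1 - x" for k x
  proof -
    have T: "0 < tail_mass g (1 / 2 ^ k)" by (intro doubling_profileD(3)[OF g]) simp
    have "tail_mass g (1 / 2 ^ k) \<le> 2 ^ d * tail_mass g (1 / 2 ^ Suc k)" using d[of "1 / 2 ^ Suc k" 1] by simp
    also have "\<dots> \<le> 2 ^ d * tail_mass g (1 - x)"
      by (intro mult_left_mono tail_mass_mono[OF doubling_profileD(1,2)[OF g]] x) auto
    finally have 1: "tail_mass g (1 / 2 ^ k) / 2 ^ d \<le> tail_mass g (1 - x)" by (simp add: field_simps)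
    have "(1 / 2 ^ Suc k) * (tail_mass g (1 / 2 ^ k) / 2 ^ d) \<le> (1 - x) * tail_mass g (1 - x)"
      using 1 x T by (intro mult_mono) auto
    then have "K / ((1 - x) * tail_mass g (1 - x)) \<le> K / ((1 / 2 ^ Suc k) * (tail_mass g (1 / 2 ^ k) / 2 ^ d))"
      using K T x doubling_profileD(3)[OF g, of "1 - x"] by (intro divide_left_mono mult_pos_pos) auto
    also have "\<dots> = (K * (2 * 2 ^ d)) * (2 ^ k / tail_mass g (1 / 2 ^ k))" using T by (simp add: field_simps)
    finally show ?thesis using K(2)[OF x(1,2)] by linarith
  qed
  then show ?thesis using K(1) by (intro exI[of _ "K * (2 * 2 ^ d)"]) auto
qed

text \<open>After Fubini the inner average is the circle mean of f at radius t s, and monotonicity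
  replaces all these radii by r. Measurability in the angle is recorded because finite sums of such
  integrals are integrated later.\<close>

lemma circle_average_radial_integral:
  assumes \<mu>: "\<mu> \<in> M_plus" and f: "f holomorphic_on ball 0 1" and q: "0 < q" and s: "0 \<le> s" "s < 1"
    and L: "L \<in> sets \<mu>" and r: "0 \<le> r" "r < 1" and Lr: "\<And>t. t \<in> L \<Longrightarrow> t * s \<le> r"
  shows "ennreal (1 / (2 * pi)) * (\<integral>\<^sup>+\<theta>\<in>{0..2*pi}. (\<integral>\<^sup>+t\<in>L. ennreal (norm (f (of_real t * (of_real s * cis \<theta>))) powr q) \<partial>\<mu>) \<partial>lborel)
    \<le> circle_mean q f r * emeasure \<mu> L"
    "(\<lambda>\<theta>. \<integral>\<^sup>+t\<in>L. ennreal (norm (f (of_real t * (of_real s * cis \<theta>))) powr q) \<partial>\<mu>) \<in> borel_measurable lborel"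
proof -
  interpret finite_measure \<mu> using M_plusD(1)[OF \<mu>] .
  interpret P: pair_sigma_finite "lborel :: real measure" \<mu> ..
  note [measurable] = M_plusD(4)[OF \<mu>] L
  define f' where "f' z = indicator (ball 0 1) z *\<^sub>R f z" for z
  have [measurable]: "f' \<in> borel_measurable borel"
    using borel_measurable_disc_extension[OF holomorphic_on_imp_continuous_on[OF f]] unfolding f'_def .
  have tl: "t * s < 1" "0 \<le> t" if "t \<in> space \<mu>" for t
    using that s M_plusD(2)[OF \<mu>] mult_strict_mono'[of t 1 s 1] by auto
  have eq: "f (of_real t * (of_real s * cis \<theta>)) = f' (of_real t * (of_real s * cis \<theta>))" if "t \<in> space \<mu>" for t \<theta>
    using tl[OF that] s by (simp add: f'_def norm_mult)
  define F where "F \<theta> t = ennreal (norm (f' (of_real t * (of_real s * cis \<theta>))) powr q) * indicator L t * indicator {0..2*pi} \<theta>" for \<theta> t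
  have [measurable]: "(\<lambda>p. snd p) \<in> borel_measurable (lborel \<Otimes>\<^sub>M \<mu>)"
    by (rule measurable_compose[OF measurable_snd M_plusD(4)[OF \<mu>]])
  have [measurable]: "(\<lambda>p. indicator L (snd p) :: ennreal) \<in> borel_measurable (lborel \<Otimes>\<^sub>M \<mu>)"
    by (rule measurable_compose[OF measurable_snd]) measurable
  have mF: "case_prod F \<in> borel_measurable (lborel \<Otimes>\<^sub>M \<mu>)"
    unfolding F_def case_prod_beta by measurable
  have mF': "(\<lambda>p. ennreal (norm (f' (of_real (snd p) * (of_real s * cis (fst p)))) powr q) * indicator L (snd p)) \<in> borel_measurable (lborel \<Otimes>\<^sub>M \<mu>)"
    by measurable
  have e: "(\<integral>\<^sup>+t\<in>L. ennreal (norm (f (of_real t * (of_real s * cis \<theta>))) powr q) \<partial>\<mu>)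
      = (\<integral>\<^sup>+t\<in>L. ennreal (norm (f' (of_real t * (of_real s * cis \<theta>))) powr q) \<partial>\<mu>)" for \<theta>
    by (intro nn_integral_cong) (simp add: eq)
  show "(\<lambda>\<theta>. \<integral>\<^sup>+t\<in>L. ennreal (norm (f (of_real t * (of_real s * cis \<theta>))) powr q) \<partial>\<mu>) \<in> borel_measurable lborel"
    unfolding e using borel_measurable_nn_integral_fst[OF mF'] by simp
  have "(\<integral>\<^sup>+\<theta>\<in>{0..2*pi}. (\<integral>\<^sup>+t\<in>L. ennreal (norm (f (of_real t * (of_real s * cis \<theta>))) powr q) \<partial>\<mu>) \<partial>lborel)
      = (\<integral>\<^sup>+\<theta>. (\<integral>\<^sup>+t. F \<theta> t \<partial>\<mu>) \<partial>lborel)"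
    unfolding e F_def
  proof (intro nn_integral_cong)
    fix \<theta> :: real
    have "(\<lambda>t. ennreal (norm (f' (of_real t * (of_real s * cis \<theta>))) powr q) * indicator L t) \<in> borel_measurable \<mu>" by measurable
    then show "(\<integral>\<^sup>+t\<in>L. ennreal (norm (f' (of_real t * (of_real s * cis \<theta>))) powr q) \<partial>\<mu>) * indicator {0..2*pi} \<theta> =
      (\<integral>\<^sup>+t. ennreal (norm (f' (of_real t * (of_real s * cis \<theta>))) powr q) * indicator L t * indicator {0..2*pi} \<theta> \<partial>\<mu>)"
      by (rule nn_integral_multc[symmetric])
  qed
  also have "\<dots> = (\<integral>\<^sup>+t. (\<integral>\<^sup>+\<theta>. F \<theta> t \<partial>lborel) \<partial>\<mu>)" by (rule P.Fubini'[OF mF, symmetric])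
  finally have "ennreal (1 / (2 * pi)) * (\<integral>\<^sup>+\<theta>\<in>{0..2*pi}. (\<integral>\<^sup>+t\<in>L. ennreal (norm (f (of_real t * (of_real s * cis \<theta>))) powr q) \<partial>\<mu>) \<partial>lborel)
     = ennreal (1 / (2 * pi)) * (\<integral>\<^sup>+t. (\<integral>\<^sup>+\<theta>. F \<theta> t \<partial>lborel) \<partial>\<mu>)" by simp
  also have "\<dots> \<le> ennreal (1 / (2 * pi)) * (\<integral>\<^sup>+t. (ennreal (2 * pi) * circle_mean q f r) * indicator L t \<partial>\<mu>)"
  proof (intro mult_left_mono nn_integral_mono)
    fix t assume t: "t \<in> space \<mu>"
    show "(\<integral>\<^sup>+\<theta>. F \<theta> t \<partial>lborel) \<le> (ennreal (2 * pi) * circle_mean q f r) * indicator L t"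
    proof (cases "t \<in> L")
      case True
      have "(\<integral>\<^sup>+\<theta>. F \<theta> t \<partial>lborel) = (\<integral>\<^sup>+\<theta>\<in>{0..2*pi}. ennreal (norm (f (of_real (t * s) * cis \<theta>)) powr q) \<partial>lborel)"
        using True t by (intro nn_integral_cong) (simp add: F_def eq[symmetric] mult.assoc)
      also have "\<dots> = ennreal (2 * pi) * circle_mean q f (t * s)"
        unfolding circle_mean_def by (simp add: mult.assoc[symmetric] ennreal_mult[symmetric])
      also have "\<dots> \<le> ennreal (2 * pi) * circle_mean q f r"
        using tl[OF t] s Lr[OF True] r by (intro mult_left_mono circle_mean_mono[OF f q]) auto
      finally show ?thesis using True by simp
    qed (simp add: F_def)
  qed simp
  also have "\<dots> = circle_mean q f r * emeasure \<mu> L"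
    by (subst nn_integral_cmult_indicator[OF L]) (simp add: mult.assoc[symmetric] ennreal_mult[symmetric])
  finally show "ennreal (1 / (2 * pi)) * (\<integral>\<^sup>+\<theta>\<in>{0..2*pi}. (\<integral>\<^sup>+t\<in>L. ennreal (norm (f (of_real t * (of_real s * cis \<theta>))) powr q) \<partial>\<mu>) \<partial>lborel)
    \<le> circle_mean q f r * emeasure \<mu> L" .
qed

context exponents_and_profiles
begin

text \<open>The k-th term of the series in \<open>circle_mean_tail_sum_le\<close> as a real number;
  circle means of holomorphic functions are finite inside the disc, so \<open>enn2real\<close> loses
  nothing.\<close>

definition block_norm :: "(complex \<Rightarrow> complex) \<Rightarrow> nat \<Rightarrow> real" where
  "block_norm f k = tail_mass n (1 / 2 ^ k) * enn2real (circle_mean p f (1 - 1 / 2 ^ (k + 2)))"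

text \<open>Exponent bookkeeping, applied with X = 2^k and j = N - k. The kernel cancels the
  \<omega>-tail of \<open>\<Phi>\<close>, the powers of X cancel because (1 - a) q = 1 - q / p, the
  \<nu>-tail joins P, and the \<eta>-tail leaves 1 / T. The exponent 1 / (q - 1) in \<delta> is set
  so that (\<delta>^j)^(1 - q) equals (1 / \<beta>)^j.\<close>

lemma block_identity:
  assumes \<beta>: "0 < \<beta>" and M: "0 < M" and C: "0 < C" and P: "0 \<le> P" and X: "1 \<le> X"
  defines "T \<equiv> tail_mass h (1 / X)"
  defines "\<delta> \<equiv> \<beta> powr (1 / (q - 1))"
  shows "(\<delta> ^ j / (M * \<Phi> (1 / X))) powr (1 - q) * (C * (X / tail_mass g (1 / X))) powr q *
     ((4 * (4 * X)) powr (q / p - 1) * P powr (q / p) * (M * \<Phi> (1 / X))) =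
     (C powr q * 16 powr (q / p - 1)) * M powr q * ((1 / \<beta>) ^ j * ((tail_mass n (1 / X) * P) powr (q / p) / T))"
proof -
  have \<delta>: "0 < \<delta>" using \<beta> by (simp add: \<delta>_def)
  define G where "G = tail_mass g (1 / X)"
  define Y where "Y = tail_mass n (1 / X)"
  have pos: "0 < G" "0 < Y" "0 < T"
    using X doubling_profileD(3)[OF g, of "1 / X"] doubling_profileD(3)[OF n, of "1 / X"] doubling_profileD(3)[OF h, of "1 / X"]
    by (auto simp: G_def Y_def T_def)
  define R where "R = M * \<Phi> (1 / X)"
  have R: "0 < R" using M \<Phi>_pos[of "1 / X"] X by (simp add: R_def)
  have d: "(\<delta> ^ j) powr (1 - q) = (1 / \<beta>) ^ j"
  proof -
    have "(\<delta> ^ j) powr (1 - q) = \<beta> powr (1 / (q - 1) * real j * (1 - q))"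
      using \<beta> by (simp add: \<delta>_def powr_powr flip: powr_realpow)
    also have "1 / (q - 1) * real j * (1 - q) = - real j" using pq by (simp add: field_simps)
    finally show ?thesis using \<beta> by (simp add: powr_minus powr_realpow power_one_over field_simps)
  qed
  have "(\<delta> ^ j / R) powr (1 - q) * R = (1 / \<beta>) ^ j * (R powr (q - 1) * R)"
  proof -
    have "(\<delta> ^ j / R) powr (1 - q) = (\<delta> ^ j) powr (1 - q) / R powr (1 - q)" using \<delta> R by (simp add: powr_divide)
    also have "\<dots> = (1 / \<beta>) ^ j * (1 / R powr (1 - q))" unfolding d by simp
    also have "1 / R powr (1 - q) = R powr (q - 1)" using powr_minus_divide[of R "1 - q"] by simp
    finally show ?thesis by (simp only: mult.assoc)
  qed
  also have "R powr (q - 1) * R = R powr q" using R powr_add[of R "q - 1" 1] by simp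
  finally have 1: "(\<delta> ^ j / R) powr (1 - q) * R = (1 / \<beta>) ^ j * R powr q" .
  have 2: "R powr q = M powr q * \<Phi> (1 / X) powr q" using M \<Phi>_pos[of "1 / X"] X by (simp add: R_def powr_mult)
  have 3: "(C * (X / G)) powr q = C powr q * (X / G) powr q" by (rule powr_mult)
  have 4: "(4 * (4 * X)) powr (q / p - 1) = 16 powr (q / p - 1) * X powr (q / p - 1)" using X powr_mult[of 16 X "q / p - 1"] by simp
  have 5: "(Y * P) powr (q / p) = Y powr (q / p) * P powr (q / p)" using pos P by (simp add: powr_mult)
  have "X / G * \<Phi> (1 / X) = X powr (1 - a) * Y powr (1 / p) / T powr (1 / q)"
  proof -
    have i: "(1 / X) powr e = 1 / X powr e" for e using X by (simp add: powr_divide)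
    have d: "X powr (1 - e) = X / X powr e" for e using powr_diff[of X 1 e] X by simp
    show ?thesis unfolding tail_ratio_def G_def[symmetric] Y_def[symmetric] T_def[symmetric] i d
      using pos(1) by simp
  qed
  then have "(X / G * \<Phi> (1 / X)) powr q = (X powr (1 - a) * Y powr (1 / p) / T powr (1 / q)) powr q" by simp
  also have "\<dots> = X powr ((1 - a) * q) * Y powr (q / p) / T"
    using pos X pq by (simp add: powr_mult powr_divide powr_powr)
  also have "(1 - a) * q = - (q / p - 1)" using pq by (simp add: field_simps)
  finally have "(X / G) powr q * \<Phi> (1 / X) powr q = X powr (- (q / p - 1)) * Y powr (q / p) / T"
    unfolding powr_mult .
  then have "(X / G) powr q * \<Phi> (1 / X) powr q * X powr (q / p - 1) = (X powr (- (q / p - 1)) * X powr (q / p - 1)) * (Y powr (q / p) / T)" by simp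
  also have "X powr (- (q / p - 1)) * X powr (q / p - 1) = 1" using X by (subst powr_add[symmetric]) simp
  finally have 6: "(X / G) powr q * \<Phi> (1 / X) powr q * X powr (q / p - 1) = Y powr (q / p) / T" by simp
  have "(\<delta> ^ j / R) powr (1 - q) * (C * (X / G)) powr q * ((4 * (4 * X)) powr (q / p - 1) * P powr (q / p) * R)
     = ((\<delta> ^ j / R) powr (1 - q) * R) * (C * (X / G)) powr q * ((4 * (4 * X)) powr (q / p - 1) * P powr (q / p))" by (simp only: mult_ac)
  also have "\<dots> = (C powr q * 16 powr (q / p - 1)) * M powr q * ((1 / \<beta>) ^ j * (((X / G) powr q * \<Phi> (1 / X) powr q * X powr (q / p - 1)) * P powr (q / p)))"
    unfolding 1 2 3 4 by (simp only: mult_ac)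
  also have "\<dots> = (C powr q * 16 powr (q / p - 1)) * M powr q * ((1 / \<beta>) ^ j * ((Y * P) powr (q / p) / T))"
    unfolding 6 5 by simp
  finally show ?thesis unfolding R_def G_def Y_def .
qed

text \<open>The Hoelder weight of piece k is the inverse of the bound R k for its \<mu>-mass, damped
  by \<delta>^(N - k). The weighted total mass is then at most V for every N, \<mu> and M, at the
  price of the growing factor (1 / \<beta>)^(N - k).\<close>

lemma circle_mean_C_op_le:
  assumes \<beta>: "0 < \<beta>" "\<beta> < 1"
  shows "\<exists>K>0. \<forall>\<mu>\<in>M_plus. \<forall>M>0. (\<forall>y. 0 < y \<longrightarrow> y \<le> 1 \<longrightarrow> measure_tail \<mu> (1 - y) \<le> M * \<Phi> y) \<longrightarrow>
    (\<forall>f. f holomorphic_on ball 0 1 \<longrightarrow> (\<forall>N. \<forall>s\<in>dyadic_shell N. circle_mean q (C_op \<mu> \<omega> f) s \<le>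
      ennreal (K * M powr q * (\<Sum>k\<le>N. (1 / \<beta>) ^ (N - k) * (block_norm f k powr (q / p) / tail_mass h (1 / 2 ^ k))))))"
proof -
  obtain C where C: "C > 0" "\<And>k x. 0 \<le> x \<Longrightarrow> x < 1 \<Longrightarrow> 1 / 2 ^ Suc k \<le> 1 - x \<Longrightarrow> kernel_real \<omega> x \<le> C * (2 ^ k / tail_mass g (1 / 2 ^ k))"
    using kernel_real_dyadic[OF g] by blast
  define \<delta> where "\<delta> = \<beta> powr (1 / (q - 1))"
  have \<delta>: "0 < \<delta>" "\<delta> < 1" using \<beta> pq powr_less_mono2[of "1 / (q - 1)" \<beta> 1] by (auto simp: \<delta>_def)
  define V where "V = 1 / (1 - \<delta>)"
  have V: "0 < V" using \<delta> by (simp add: V_def)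
  define c0 where "c0 = 2 powr q * V powr (q - 1)"
  have c0: "0 < c0" using V by (simp add: c0_def)
  define K where "K = c0 * (C powr q * 16 powr (q / p - 1))"
  have "circle_mean q (C_op \<mu> \<omega> f) s \<le>
      ennreal (K * M powr q * (\<Sum>k\<le>N. (1 / \<beta>) ^ (N - k) * (block_norm f k powr (q / p) / tail_mass h (1 / 2 ^ k))))"
    if \<mu>: "\<mu> \<in> M_plus" and M: "0 < M" and tail: "\<And>y. 0 < y \<Longrightarrow> y \<le> 1 \<Longrightarrow> measure_tail \<mu> (1 - y) \<le> M * \<Phi> y"
      and f: "f holomorphic_on ball 0 1" and s: "s \<in> dyadic_shell N" for \<mu> M f N s
  proof -
    interpret finite_measure \<mu> using M_plusD(1)[OF \<mu>] .
    note [measurable] = M_plusD(4)[OF \<mu>]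
    have "1 - 1 / (2::real) ^ N \<ge> 0" "1 - 1 / (2::real) ^ Suc N < 1" by simp_all
    then have s01: "0 \<le> s" "s < 1" using s unfolding dyadic_shell_def atLeastLessThan_iff by linarith+
    \<comment> \<open>The last piece takes all t beyond 1 - 2^(-N): there s keeps t s away from 1,
      while in the earlier shells t does. Either way 1 - t s is at least 2^(-k-1), as
      \<open>far\<close> records.\<close>
    define L where "L k = (if k < N then dyadic_shell k else {1 - 1 / 2 ^ k..<1})" for k
    have L[measurable]: "L k \<in> sets \<mu>" for k
      using dyadic_shell_M_plus(1)[OF \<mu>] M_plusD(5)[OF \<mu>, of "1 - 1 / 2 ^ k"] by (simp add: L_def)
    define R where "R k = M * \<Phi> (1 / 2 ^ k)" for k :: nat
    have R: "0 < R k" for k using M \<Phi>_pos[of "1 / 2 ^ k"] by (simp add: R_def)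
    have L\<mu>: "emeasure \<mu> (L k) \<le> ennreal (R k)" for k
    proof -
      have "emeasure \<mu> (L k) \<le> ennreal (measure_tail \<mu> (1 - 1 / 2 ^ k))"
        using dyadic_shell_M_plus(2,3)[OF \<mu>, of k] by (simp add: L_def)
      also have "\<dots> \<le> ennreal (R k)" unfolding R_def by (intro ennreal_leI tail) auto
      finally show ?thesis .
    qed
    have cover: "space \<mu> \<subseteq> (\<Union>k\<le>N. L k)"
    proof
      fix t assume "t \<in> space \<mu>"
      then have t: "0 \<le> t" "t < 1" using M_plusD(2)[OF \<mu>] by auto
      show "t \<in> (\<Union>k\<le>N. L k)"
      proof (cases "t < 1 - 1 / 2 ^ (0 + N)")
        case True
        then obtain i where "i < N" "t \<in> dyadic_shell (0 + i)" using dyadic_shell_cover[of 0 t N] t by auto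
        then show ?thesis by (auto simp: L_def intro!: bexI[of _ i])
      next
        case False
        then show ?thesis using t by (auto simp: L_def intro!: bexI[of _ N])
      qed
    qed
    have far: "1 / 2 ^ Suc k \<le> 1 - t * s" if "t \<in> L k" "t \<in> space \<mu>" "k \<le> N" for k t
    proof -
      have t: "0 \<le> t" "t < 1" using that(2) M_plusD(2)[OF \<mu>] by auto
      show ?thesis
      proof (cases "k < N")
        case True
        have "t * s \<le> t * 1" using t s01 by (intro mult_left_mono) auto
        then show ?thesis using True that(1) by (auto simp: L_def dyadic_shell_def)
      next
        case False
        then have "k = N" using that(3) by simp
        have "t * s \<le> 1 * s" using t s01 by (intro mult_right_mono) auto
        then show ?thesis using \<open>k = N\<close> s by (auto simp: dyadic_shell_def)
      qed
    qed
    have ts: "0 \<le> t * s" "t * s < 1" if "t \<in> space \<mu>" for t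
      using that s01 M_plusD(2)[OF \<mu>] mult_strict_mono'[of t 1 s 1] by auto
    define v where "v k = \<delta> ^ (N - k) / R k" for k
    have v: "0 < v k" for k using \<delta> R by (simp add: v_def)
    have sumV: "(\<Sum>k\<le>N. ennreal (v k) * emeasure \<mu> (L k)) \<le> ennreal V"
    proof -
      have "(\<Sum>k\<le>N. ennreal (v k) * emeasure \<mu> (L k)) \<le> (\<Sum>k\<le>N. ennreal (v k) * ennreal (R k))"
        by (intro sum_mono mult_left_mono L\<mu>) auto
      also have "\<dots> = (\<Sum>k\<le>N. ennreal (\<delta> ^ (N - k)))"
        using R v by (intro sum.cong refl) (simp add: ennreal_mult[symmetric] less_imp_le v_def less_imp_neq[symmetric])
      also have "\<dots> = ennreal (\<Sum>k\<le>N. \<delta> ^ (N - k))" using \<delta> by (intro sum_ennreal) auto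
      also have "(\<Sum>k\<le>N. \<delta> ^ (N - k)) = (\<Sum>k\<le>N. \<delta> ^ k)" by (rule sum.nat_diff_reindex[of "\<lambda>k. \<delta> ^ k" "Suc N", simplified lessThan_Suc_atMost, simplified])
      also have "(\<Sum>k\<le>N. \<delta> ^ k) \<le> (\<Sum>k. \<delta> ^ k)" using \<delta> by (intro sum_le_suminf summable_geometric) auto
      also have "\<dots> = V" using \<delta> by (simp add: V_def suminf_geometric)
      finally show ?thesis by (simp add: ennreal_leI)
    qed
    define A where "A k = C * (2 ^ k / tail_mass g (1 / 2 ^ k))" for k :: nat
    have A: "0 < A k" for k using C(1) doubling_profileD(3)[OF g, of "1 / 2 ^ k"] by (simp add: A_def)
    define f' where "f' z = indicator (ball 0 1) z *\<^sub>R f z" for z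
    have [measurable]: "f' \<in> borel_measurable borel"
      using borel_measurable_disc_extension[OF holomorphic_on_imp_continuous_on[OF f]] unfolding f'_def .
    define B' where "B' z = indicator (ball 0 1) z *\<^sub>R kernel_disc \<omega> z" for z
    have [measurable]: "B' \<in> borel_measurable borel"
      using borel_measurable_disc_extension[OF holomorphic_on_imp_continuous_on[OF kernel_disc_properties(1)[OF g]]] unfolding B'_def .
    have point: "ennreal (norm (C_op \<mu> \<omega> f (of_real s * cis \<theta>)) powr q) \<le> ennreal c0 * (\<Sum>k\<le>N. ennreal (v k powr (1 - q) * A k powr q) *
       (\<integral>\<^sup>+t\<in>L k. ennreal (norm (f (of_real t * (of_real s * cis \<theta>))) powr q) \<partial>\<mu>))" for \<theta>
    proof -
      define z where "z = of_real s * cis \<theta>"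
      have nz: "norm z = s" using s01 by (simp add: z_def norm_mult)
      \<comment> \<open>The cut-off functions make H measurable; on the space of \<mu> it is |f (t
        z)| times the kernel at t s.\<close>
      define H where "H t = norm (f' (of_real t * z)) * Re (B' (of_real (t * s)))" for t :: real
      have Heq: "H t = norm (f (of_real t * z)) * kernel_real \<omega> (t * s)" if "t \<in> space \<mu>" for t
      proof -
        have "norm (of_real t * z) < 1" using ts[OF that] nz that M_plusD(2)[OF \<mu>] by (simp add: norm_mult)
        moreover have "B' (of_real (t * s)) = of_real (kernel_real \<omega> (t * s))"
        proof -
          have "complex_of_real (t * s) \<in> ball 0 1" unfolding mem_ball_0 norm_of_real using ts[OF that] by simp
          then show ?thesis unfolding B'_def kernel_disc_properties(3)[OF g ts[OF that]] by simp
        qed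
        ultimately show ?thesis by (simp add: H_def f'_def)
      qed
      have H0: "0 \<le> H t" if "t \<in> space \<mu>" for t
        unfolding Heq[OF that] using kernel_disc_properties(4)[OF g ts[OF that]] by simp
      have "ennreal (norm (C_op \<mu> \<omega> f z) powr q) \<le> ennreal c0 * (\<Sum>k\<le>N. ennreal (v k powr (1 - q)) * (\<integral>\<^sup>+t\<in>L k. ennreal (H t powr q) \<partial>\<mu>))"
        unfolding c0_def
      proof (rule weighted_hoelder[OF pq(3) H0 _ L cover v V sumV])
        show "H \<in> borel_measurable \<mu>" unfolding H_def by measurable
        have "(\<integral>\<^sup>+t. ennreal (norm (f (of_real t * z)) * kernel_real \<omega> (t * norm z)) \<partial>\<mu>) = (\<integral>\<^sup>+t. ennreal (H t) \<partial>\<mu>)"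
          unfolding nz by (intro nn_integral_cong) (simp add: Heq)
        then show "ennreal (norm (C_op \<mu> \<omega> f z)) \<le> (\<integral>\<^sup>+t. ennreal (H t) \<partial>\<mu>)"
          using norm_C_op_le[OF g \<mu>, of z f] nz s01 by simp
      qed auto
      also have "\<dots> \<le> ennreal c0 * (\<Sum>k\<le>N. ennreal (v k powr (1 - q) * A k powr q) * (\<integral>\<^sup>+t\<in>L k. ennreal (norm (f (of_real t * z)) powr q) \<partial>\<mu>))"
      proof (intro mult_left_mono sum_mono)
        fix k assume k: "k \<in> {..N}"
        have "(\<integral>\<^sup>+t\<in>L k. ennreal (H t powr q) \<partial>\<mu>) \<le> (\<integral>\<^sup>+t. ennreal (A k powr q) * (ennreal (norm (f' (of_real t * z)) powr q) * indicator (L k) t) \<partial>\<mu>)"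
        proof (rule nn_integral_mono)
          fix t assume t: "t \<in> space \<mu>"
          have e: "f' (of_real t * z) = f (of_real t * z)"
            using ts[OF t] nz t M_plusD(2)[OF \<mu>] by (simp add: f'_def norm_mult)
          have "H t powr q \<le> A k powr q * norm (f (of_real t * z)) powr q" if "t \<in> L k"
          proof -
            have "kernel_real \<omega> (t * s) \<le> A k" unfolding A_def using far[OF that t] k ts[OF t] by (intro C(2)) auto
            from mult_right_mono[OF this norm_ge_zero, of "f (of_real t * z)"]
            have "H t \<le> A k * norm (f (of_real t * z))" unfolding Heq[OF t] by (simp only: mult.commute)
            then have "H t powr q \<le> (A k * norm (f (of_real t * z))) powr q" using H0[OF t] pq by (intro powr_mono2) auto
            then show ?thesis using A[of k] by (simp add: powr_mult)
          qed
          then show "ennreal (H t powr q) * indicator (L k) t \<le> ennreal (A k powr q) * (ennreal (norm (f' (of_real t * z)) powr q) * indicator (L k) t)"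
            unfolding e by (auto simp: indicator_def ennreal_mult[symmetric] intro!: ennreal_leI)
        qed
        also have "\<dots> = ennreal (A k powr q) * (\<integral>\<^sup>+t\<in>L k. ennreal (norm (f' (of_real t * z)) powr q) \<partial>\<mu>)"
          by (rule nn_integral_cmult) measurable
        also have "(\<integral>\<^sup>+t\<in>L k. ennreal (norm (f' (of_real t * z)) powr q) \<partial>\<mu>) = (\<integral>\<^sup>+t\<in>L k. ennreal (norm (f (of_real t * z)) powr q) \<partial>\<mu>)"
        proof (rule nn_integral_cong)
          fix t assume t: "t \<in> space \<mu>"
          have "f' (of_real t * z) = f (of_real t * z)"
            using ts[OF t] nz t M_plusD(2)[OF \<mu>] by (simp add: f'_def norm_mult)
          then show "ennreal (norm (f' (of_real t * z)) powr q) * indicator (L k) t = ennreal (norm (f (of_real t * z)) powr q) * indicator (L k) t" by simp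
        qed
        finally have "ennreal (v k powr (1 - q)) * (\<integral>\<^sup>+t\<in>L k. ennreal (H t powr q) \<partial>\<mu>) \<le>
          ennreal (v k powr (1 - q)) * (ennreal (A k powr q) * (\<integral>\<^sup>+t\<in>L k. ennreal (norm (f (of_real t * z)) powr q) \<partial>\<mu>))"
          by (rule mult_left_mono) simp
        then show "ennreal (v k powr (1 - q)) * (\<integral>\<^sup>+t\<in>L k. ennreal (H t powr q) \<partial>\<mu>) \<le>
          ennreal (v k powr (1 - q) * A k powr q) * (\<integral>\<^sup>+t\<in>L k. ennreal (norm (f (of_real t * z)) powr q) \<partial>\<mu>)"
          by (simp add: ennreal_mult mult.assoc)
      qed simp
      finally show ?thesis by (simp add: z_def)
    qed
    define I where "I k \<theta> = (\<integral>\<^sup>+t\<in>L k. ennreal (norm (f (of_real t * (of_real s * cis \<theta>))) powr q) \<partial>\<mu>)" for k \<theta>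
    define r where "r k = 1 - 1 / (2::real) ^ Suc k" for k :: nat
    have r: "0 \<le> r k" "r k < 1" for k
      using one_le_power[of "2::real" "Suc k"] by (simp_all add: r_def del: power_Suc)
    have I: "ennreal (1 / (2 * pi)) * (\<integral>\<^sup>+\<theta>\<in>{0..2*pi}. I k \<theta> \<partial>lborel) \<le> circle_mean q f (r k) * emeasure \<mu> (L k)"
      "I k \<in> borel_measurable lborel" if "k \<le> N" for k
    proof -
      have Lr: "t * s \<le> r k" if "t \<in> L k" for t
        using far[OF that _ \<open>k \<le> N\<close>] sets.sets_into_space[OF L[of k]] that by (auto simp: r_def)
      show "ennreal (1 / (2 * pi)) * (\<integral>\<^sup>+\<theta>\<in>{0..2*pi}. I k \<theta> \<partial>lborel) \<le> circle_mean q f (r k) * emeasure \<mu> (L k)"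
        "I k \<in> borel_measurable lborel"
        using circle_average_radial_integral[OF \<mu> f _ s01 L r Lr, of q k] pq unfolding I_def[abs_def] by auto
    qed
    \<comment> \<open>The radius moves from 1 - 2^(-k-1) to 1 - 2^(-k-2). The step is 2^(-k-2), and
      4 divided by it is the base 16 times 2^k of the first power.\<close>
    have Q: "circle_mean q f (r k) \<le> ennreal ((4 * (4 * 2 ^ k)) powr (q / p - 1) * enn2real (circle_mean p f (1 - 1 / 2 ^ (k + 2))) powr (q / p))" for k
    proof -
      have "1 - 1 / (2::real) ^ Suc k + 1 / 2 ^ (k + 2) = 1 - 1 / 2 ^ (k + 2)" by (simp add: power_add field_simps)
      then show ?thesis using circle_mean_exponent[OF f pq(1,2), of "1 / 2 ^ (k + 2)" "r k"] r[of k]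
        by (simp add: r_def power_add mult_ac)
    qed
    have meas_I: "(\<lambda>\<theta>. I k \<theta> * indicator {0..2*pi} \<theta>) \<in> borel_measurable lborel" if "k \<le> N" for k
    proof -
      note [measurable] = I(2)[OF that]
      show ?thesis by measurable
    qed
    have "circle_mean q (C_op \<mu> \<omega> f) s \<le> ennreal (1 / (2 * pi)) * (\<integral>\<^sup>+\<theta>. ennreal c0 * (\<Sum>k\<le>N. ennreal (v k powr (1 - q) * A k powr q) * (I k \<theta> * indicator {0..2*pi} \<theta>)) \<partial>lborel)"
      unfolding circle_mean_def
    proof (intro mult_left_mono nn_integral_mono)
      fix \<theta> :: real
      show "ennreal (norm (C_op \<mu> \<omega> f (of_real s * cis \<theta>)) powr q) * indicator {0..2*pi} \<theta> \<le>
        ennreal c0 * (\<Sum>k\<le>N. ennreal (v k powr (1 - q) * A k powr q) * (I k \<theta> * indicator {0..2*pi} \<theta>))"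
        using point[of \<theta>] unfolding I_def[symmetric] by (cases "\<theta> \<in> {0..2*pi}") auto
    qed simp
    also have "(\<integral>\<^sup>+\<theta>. ennreal c0 * (\<Sum>k\<le>N. ennreal (v k powr (1 - q) * A k powr q) * (I k \<theta> * indicator {0..2*pi} \<theta>)) \<partial>lborel)
       = ennreal c0 * (\<Sum>k\<le>N. ennreal (v k powr (1 - q) * A k powr q) * (\<integral>\<^sup>+\<theta>\<in>{0..2*pi}. I k \<theta> \<partial>lborel))"
    proof -
      have m: "(\<lambda>\<theta>. ennreal (v k powr (1 - q) * A k powr q) * (I k \<theta> * indicator {0..2*pi} \<theta>)) \<in> borel_measurable lborel"
        if "k \<in> {..N}" for k
        by (intro borel_measurable_times_ennreal borel_measurable_const meas_I) (use that in simp)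
      have "(\<integral>\<^sup>+\<theta>. ennreal c0 * (\<Sum>k\<le>N. ennreal (v k powr (1 - q) * A k powr q) * (I k \<theta> * indicator {0..2*pi} \<theta>)) \<partial>lborel)
        = ennreal c0 * (\<integral>\<^sup>+\<theta>. (\<Sum>k\<le>N. ennreal (v k powr (1 - q) * A k powr q) * (I k \<theta> * indicator {0..2*pi} \<theta>)) \<partial>lborel)"
        by (rule nn_integral_cmult[OF borel_measurable_sum[OF m]])
      also have "(\<integral>\<^sup>+\<theta>. (\<Sum>k\<le>N. ennreal (v k powr (1 - q) * A k powr q) * (I k \<theta> * indicator {0..2*pi} \<theta>)) \<partial>lborel)
        = (\<Sum>k\<le>N. \<integral>\<^sup>+\<theta>. ennreal (v k powr (1 - q) * A k powr q) * (I k \<theta> * indicator {0..2*pi} \<theta>) \<partial>lborel)"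
        by (rule nn_integral_sum[OF m])
      also have "\<dots> = (\<Sum>k\<le>N. ennreal (v k powr (1 - q) * A k powr q) * (\<integral>\<^sup>+\<theta>\<in>{0..2*pi}. I k \<theta> \<partial>lborel))"
        by (intro sum.cong refl nn_integral_cmult meas_I) simp
      finally show ?thesis .
    qed
    also have "ennreal (1 / (2 * pi)) * (ennreal c0 * (\<Sum>k\<le>N. ennreal (v k powr (1 - q) * A k powr q) * (\<integral>\<^sup>+\<theta>\<in>{0..2*pi}. I k \<theta> \<partial>lborel)))
       = ennreal c0 * (\<Sum>k\<le>N. ennreal (v k powr (1 - q) * A k powr q) * (ennreal (1 / (2 * pi)) * (\<integral>\<^sup>+\<theta>\<in>{0..2*pi}. I k \<theta> \<partial>lborel)))"
      unfolding sum_distrib_left by (intro sum.cong refl) (simp only: mult_ac)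
    also have "\<dots> \<le> ennreal c0 * (\<Sum>k\<le>N. ennreal (v k powr (1 - q) * A k powr q) * (circle_mean q f (r k) * emeasure \<mu> (L k)))"
      by (intro mult_left_mono sum_mono I(1)) auto
    also have "\<dots> \<le> ennreal c0 * (\<Sum>k\<le>N. ennreal (v k powr (1 - q) * A k powr q) *
       (ennreal ((4 * (4 * 2 ^ k)) powr (q / p - 1) * enn2real (circle_mean p f (1 - 1 / 2 ^ (k + 2))) powr (q / p)) * ennreal (R k)))"
      by (intro mult_left_mono sum_mono mult_mono Q L\<mu>) auto
    also have "\<dots> = ennreal c0 * (\<Sum>k\<le>N. ennreal ((C powr q * 16 powr (q / p - 1)) * M powr q * ((1 / \<beta>) ^ (N - k) * (block_norm f k powr (q / p) / tail_mass h (1 / 2 ^ k)))))"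
    proof (intro arg_cong2[where f="(*)"] refl sum.cong)
      fix k
      have "(1::real) \<le> 2 ^ k" by simp
      from block_identity[OF \<beta>(1) M C(1) _ this, of "enn2real (circle_mean p f (1 - 1 / 2 ^ (k + 2)))" "N - k"]
      show "ennreal (v k powr (1 - q) * A k powr q) *
       (ennreal ((4 * (4 * 2 ^ k)) powr (q / p - 1) * enn2real (circle_mean p f (1 - 1 / 2 ^ (k + 2))) powr (q / p)) * ennreal (R k)) =
        ennreal ((C powr q * 16 powr (q / p - 1)) * M powr q * ((1 / \<beta>) ^ (N - k) * (block_norm f k powr (q / p) / tail_mass h (1 / 2 ^ k))))"
        unfolding v_def A_def R_def \<delta>_def block_norm_def
        using M \<Phi>_pos[of "1 / 2 ^ k"] by (simp add: ennreal_mult''[symmetric])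
    qed
    also have "\<dots> = ennreal c0 * ennreal (\<Sum>k\<le>N. (C powr q * 16 powr (q / p - 1)) * M powr q * ((1 / \<beta>) ^ (N - k) * (block_norm f k powr (q / p) / tail_mass h (1 / 2 ^ k))))"
      using \<beta> doubling_profileD(3)[OF h] by (subst sum_ennreal) (auto simp: less_imp_le)
    also have "\<dots> = ennreal (K * M powr q * (\<Sum>k\<le>N. (1 / \<beta>) ^ (N - k) * (block_norm f k powr (q / p) / tail_mass h (1 / 2 ^ k))))"
      using c0 by (simp add: ennreal_mult'[symmetric] K_def sum_distrib_left mult.assoc)
    finally show ?thesis .
  qed
  moreover have "K > 0" using c0 C(1) by (simp add: K_def)
  ultimately show ?thesis by blast
qed

end

text \<open>Each term is at most the sum X, so x^r <= X^(r-1) x. It is applied with r = q /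
  p.\<close>

lemma sum_powr_le_powr_sum:
  fixes x :: "nat \<Rightarrow> real"
  assumes x: "\<And>k. 0 \<le> x k" "summable x" and r: "1 \<le> r"
  shows "summable (\<lambda>k. x k powr r)" "(\<Sum>k. x k powr r) \<le> (\<Sum>k. x k) powr r"
proof -
  define X where "X = (\<Sum>k. x k)"
  have X: "0 \<le> X" unfolding X_def by (rule suminf_nonneg[OF x(2,1)])
  have split: "t powr r = t powr (r - 1) * t" if "0 \<le> t" for t :: real
    using powr_add[of t "r - 1" 1] that by (cases "t = 0") auto
  have le: "x k powr r \<le> X powr (r - 1) * x k" for k
  proof -
    have "x k \<le> X" using sum_le_suminf[OF x(2), of "{k}"] x(1) by (simp add: X_def)
    then have "x k powr (r - 1) \<le> X powr (r - 1)" using x(1) r by (intro powr_mono2) auto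
    then show ?thesis unfolding split[OF x(1)] using x(1) by (rule mult_right_mono)
  qed
  have s: "summable (\<lambda>k. X powr (r - 1) * x k)" by (rule summable_mult[OF x(2)])
  show s': "summable (\<lambda>k. x k powr r)" by (rule summable_comparison_test'[OF s, of 0]) (use le in auto)
  have "(\<Sum>k. x k powr r) \<le> (\<Sum>k. X powr (r - 1) * x k)" by (rule suminf_le[OF le s' s])
  also have "\<dots> = X powr (r - 1) * X" unfolding X_def by (rule suminf_mult[OF x(2)])
  finally show "(\<Sum>k. x k powr r) \<le> (\<Sum>k. x k) powr r" using split[OF X] by (simp add: X_def)
qed

section \<open>Boundedness of the operator in terms of the tails of the measure\<close>

context exponents_and_profiles
begin

lemma bergman_bound_of_tail:
  assumes rn: "reverse_doubling n" and rh: "reverse_doubling h"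
  shows "\<exists>K>0. \<forall>\<mu>\<in>M_plus. \<forall>M>0. (\<forall>y. 0 < y \<longrightarrow> y \<le> 1 \<longrightarrow> measure_tail \<mu> (1 - y) \<le> M * \<Phi> y) \<longrightarrow>
    bergman_bound (C_op \<mu> \<omega>) p \<nu> q \<eta> (K * M)"
proof -
  obtain A \<kappa> where A: "A > 0" and \<kappa>: "0 < \<kappa>" "\<kappa> < 1"
    and geo: "\<And>m k. k \<le> m \<Longrightarrow> tail_mass h (1 / 2 ^ m) \<le> A * \<kappa> ^ (m - k) * tail_mass h (1 / 2 ^ k)"
    using reverse_doubling_geometric[OF h rh] by blast
  \<comment> \<open>The Hoelder step costs \<beta>^(-(N - k)) and the tail of \<eta> gains
    \<kappa>^(N - k) = \<beta>^(2 (N - k)), so \<beta>^(N - k) is left for the summation over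
    N.\<close>
  define \<beta> where "\<beta> = sqrt \<kappa>"
  have \<beta>: "0 < \<beta>" "\<beta> < 1" "\<kappa> = \<beta> * \<beta>" using \<kappa> by (auto simp: \<beta>_def)
  obtain K1 where K1: "K1 > 0" "\<And>\<mu> M f N s. \<mu> \<in> M_plus \<Longrightarrow> 0 < M \<Longrightarrow>
      (\<forall>y. 0 < y \<longrightarrow> y \<le> 1 \<longrightarrow> measure_tail \<mu> (1 - y) \<le> M * \<Phi> y) \<Longrightarrow> f holomorphic_on ball 0 1 \<Longrightarrow> s \<in> dyadic_shell N \<Longrightarrow>
      circle_mean q (C_op \<mu> \<omega> f) s \<le>
      ennreal (K1 * M powr q * (\<Sum>k\<le>N. (1 / \<beta>) ^ (N - k) * (block_norm f k powr (q / p) / tail_mass h (1 / 2 ^ k))))"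
    using circle_mean_C_op_le[OF \<beta>(1,2)] by meson
  obtain K2 where K2: "K2 > 0" "\<And>f. f holomorphic_on ball 0 1 \<Longrightarrow>
      (\<Sum>k. ennreal (tail_mass n (1 / 2 ^ k)) * circle_mean p f (1 - 1 / 2 ^ (k + 2))) \<le> ennreal K2 * bergman_integral p \<nu> f"
    using circle_mean_tail_sum_le[OF n rn pq(1)] by blast
  \<comment> \<open>2 comes from the polar formula, A from \<open>geo\<close>, the power of K2 from
    the sum of the block norms, and 1 / (1 - \<beta>) from the geometric series.\<close>
  define K3 where "K3 = 2 * (K1 * A * K2 powr (q / p) / (1 - \<beta>))"
  have K3: "K3 > 0" using K1 A K2 \<beta> by (simp add: K3_def)
  note [measurable] = doubling_profileD(6)[OF h]
  have main: "bergman_integral q \<eta> (C_op \<mu> \<omega> f) \<le> ennreal (K3 * M powr q * enn2real (bergman_integral p \<nu> f) powr (q / p))"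
    if \<mu>: "\<mu> \<in> M_plus" and M: "0 < M" and tail: "\<forall>y. 0 < y \<longrightarrow> y \<le> 1 \<longrightarrow> measure_tail \<mu> (1 - y) \<le> M * \<Phi> y"
      and f: "f holomorphic_on ball 0 1" and fin: "bergman_integral p \<nu> f < \<infinity>" for \<mu> M f
  proof -
    define i where "i = enn2real (bergman_integral p \<nu> f)"
    have i: "bergman_integral p \<nu> f = ennreal i" "0 \<le> i" using fin by (auto simp: i_def)
    have x0: "0 \<le> block_norm f k" for k
      unfolding block_norm_def using doubling_profileD(3)[OF n, of "1 / 2 ^ k"] by simp
    have "ennreal (block_norm f k) = ennreal (tail_mass n (1 / 2 ^ k)) * circle_mean p f (1 - 1 / 2 ^ (k + 2))" for k
    proof -
      have r: "0 \<le> 1 - 1 / (2::real) ^ (k + 2)" "1 - 1 / (2::real) ^ (k + 2) < 1"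
        using one_le_power[of "2::real" "k + 2"] by simp_all
      show ?thesis unfolding block_norm_def
        using doubling_profileD(3)[OF n, of "1 / 2 ^ k"] circle_mean_real[OF f r pq(1)] by (subst ennreal_mult) auto
    qed
    then have "(\<Sum>k. ennreal (block_norm f k)) \<le> ennreal K2 * ennreal i" using K2(2)[OF f] unfolding i by simp
    also have "\<dots> = ennreal (K2 * i)" using K2(1) i(2) by (simp add: ennreal_mult)
    finally have le: "(\<Sum>k. ennreal (block_norm f k)) \<le> ennreal (K2 * i)" .
    have "(\<Sum>k. ennreal (block_norm f k)) \<noteq> top" by (rule neq_top_trans[OF ennreal_neq_top le])
    \<comment> \<open>A finite sum in [0,\<infinity>] gives convergence of the real series, on which
      the power inequality operates.\<close>
    then have sx: "summable (block_norm f)" by (intro summable_suminf_not_top x0)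
    have X: "(\<Sum>k. block_norm f k) \<le> K2 * i" using le K2(1) i(2) by (simp add: suminf_ennreal2[OF x0 sx])
    define \<Theta> where "\<Theta> k = block_norm f k powr (q / p)" for k
    have qp: "1 \<le> q / p" using pq by simp
    have \<Theta>: "summable \<Theta>" "(\<Sum>k. \<Theta> k) \<le> (K2 * i) powr (q / p)" "\<And>k. 0 \<le> \<Theta> k"
    proof -
      show "summable \<Theta>" unfolding \<Theta>_def by (rule sum_powr_le_powr_sum(1)[OF x0 sx qp])
      have "(\<Sum>k. \<Theta> k) \<le> (\<Sum>k. block_norm f k) powr (q / p)" unfolding \<Theta>_def by (rule sum_powr_le_powr_sum(2)[OF x0 sx qp])
      also have "\<dots> \<le> (K2 * i) powr (q / p)" using X qp by (intro powr_mono2 suminf_nonneg[OF sx x0]) auto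
      finally show "(\<Sum>k. \<Theta> k) \<le> (K2 * i) powr (q / p)" .
    qed (simp add: \<Theta>_def)
    define U where "U N = K1 * M powr q * (\<Sum>k\<le>N. (1 / \<beta>) ^ (N - k) * (\<Theta> k / tail_mass h (1 / 2 ^ k)))" for N
    have Th: "0 < tail_mass h (1 / 2 ^ k)" for k :: nat by (intro doubling_profileD(3)[OF h]) simp
    have U0: "0 \<le> U N" for N
      unfolding U_def using K1(1) \<beta> \<Theta>(3) Th by (intro mult_nonneg_nonneg sum_nonneg divide_nonneg_pos) auto
    have U: "circle_mean q (C_op \<mu> \<omega> f) s \<le> ennreal (U N)" if "s \<in> dyadic_shell N" for s N
      using K1(2)[OF \<mu> M tail f that] by (simp add: U_def \<Theta>_def)
    define W where "W N = (\<Sum>k\<le>N. \<Theta> k * \<beta> ^ (N - k))" for N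
    have UW: "U N * tail_mass h (1 / 2 ^ N) \<le> K1 * M powr q * A * W N" for N
    proof -
      have "(\<Sum>k\<le>N. (1 / \<beta>) ^ (N - k) * (\<Theta> k / tail_mass h (1 / 2 ^ k))) * tail_mass h (1 / 2 ^ N) \<le> (\<Sum>k\<le>N. A * (\<Theta> k * \<beta> ^ (N - k)))"
        unfolding sum_distrib_right
      proof (rule sum_mono)
        fix k assume "k \<in> {..N}"
        then have "(1 / \<beta>) ^ (N - k) * (\<Theta> k / tail_mass h (1 / 2 ^ k)) * tail_mass h (1 / 2 ^ N)
          \<le> (1 / \<beta>) ^ (N - k) * (\<Theta> k / tail_mass h (1 / 2 ^ k)) * (A * \<kappa> ^ (N - k) * tail_mass h (1 / 2 ^ k))"
          using \<beta> \<Theta>(3) less_imp_le[OF Th] by (intro mult_left_mono geo mult_nonneg_nonneg divide_nonneg_nonneg) auto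
        also have "\<dots> = A * (\<Theta> k * ((1 / \<beta>) ^ (N - k) * \<kappa> ^ (N - k)))" using Th[of k] by simp
        also have "(1 / \<beta>) ^ (N - k) * \<kappa> ^ (N - k) = \<beta> ^ (N - k)" using \<beta> by (simp flip: power_mult_distrib)
        finally show "(1 / \<beta>) ^ (N - k) * (\<Theta> k / tail_mass h (1 / 2 ^ k)) * tail_mass h (1 / 2 ^ N) \<le> A * (\<Theta> k * \<beta> ^ (N - k))" .
      qed
      also have "\<dots> = A * W N" by (simp add: W_def sum_distrib_left)
      finally have "(K1 * M powr q) * ((\<Sum>k\<le>N. (1 / \<beta>) ^ (N - k) * (\<Theta> k / tail_mass h (1 / 2 ^ k))) * tail_mass h (1 / 2 ^ N)) \<le> (K1 * M powr q) * (A * W N)"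
        using K1(1) by (intro mult_left_mono) auto
      then show ?thesis by (simp add: U_def mult.assoc)
    qed
    have W: "W sums ((\<Sum>k. \<Theta> k) * (1 / (1 - \<beta>)))"
    proof -
      have "(\<lambda>N. \<Sum>k\<le>N. \<Theta> k * \<beta> ^ (N - k)) sums ((\<Sum>k. \<Theta> k) * (\<Sum>k. \<beta> ^ k))"
        using \<Theta> \<beta> by (intro Cauchy_product_sums) (auto intro: summable_geometric)
      then show ?thesis using \<beta> by (simp add: W_def[abs_def] suminf_geometric)
    qed
    have "bergman_integral q \<eta> (C_op \<mu> \<omega> f) = 2 * (\<integral>\<^sup>+s. ennreal s * circle_mean q (C_op \<mu> \<omega> f) s * ennreal (h s) \<partial>lborel)"
      by (rule bergman_integral_polar[OF doubling_profileD(1)[OF h] holomorphic_on_imp_continuous_on[OF C_op_holomorphic[OF g \<mu> f]]])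
    \<comment> \<open>The shell N is enlarged to the whole tail from 1 - 2^(-N) on, the quantity
      whose decay \<open>geo\<close> controls.\<close>
    also have "\<dots> \<le> 2 * (\<integral>\<^sup>+s. (\<Sum>N. ennreal (U N) * (ennreal (h s) * indicator {1 - 1 / 2 ^ N..} s)) \<partial>lborel)"
    proof (intro mult_left_mono nn_integral_mono)
      fix s :: real
      show "ennreal s * circle_mean q (C_op \<mu> \<omega> f) s * ennreal (h s) \<le> (\<Sum>N. ennreal (U N) * (ennreal (h s) * indicator {1 - 1 / 2 ^ N..} s))"
      proof (cases "s \<in> {0<..<1}")
        case True
        then obtain N where N: "s \<in> dyadic_shell N" using dyadic_shell_exists[of s] by auto
        have "ennreal s * circle_mean q (C_op \<mu> \<omega> f) s \<le> 1 * ennreal (U N)" using True by (intro mult_mono U N) auto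
        then have "ennreal s * circle_mean q (C_op \<mu> \<omega> f) s * ennreal (h s) \<le> 1 * ennreal (U N) * ennreal (h s)" by (rule mult_right_mono) simp
        also have "\<dots> = (\<Sum>N\<in>{N}. ennreal (U N) * (ennreal (h s) * indicator {1 - 1 / 2 ^ N..} s))"
          using N by (simp add: dyadic_shell_def)
        also have "\<dots> \<le> (\<Sum>N. ennreal (U N) * (ennreal (h s) * indicator {1 - 1 / 2 ^ N..} s))"
          by (rule sum_le_suminf[OF summableI]) auto
        finally show ?thesis .
      qed (use doubling_profileD(5)[OF h, of s] in simp)
    qed simp
    also have "(\<integral>\<^sup>+s. (\<Sum>N. ennreal (U N) * (ennreal (h s) * indicator {1 - 1 / 2 ^ N..} s)) \<partial>lborel)
       = (\<Sum>N. ennreal (U N) * ennreal (tail_mass h (1 / 2 ^ N)))"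
      by (subst nn_integral_suminf, simp)
        (simp add: nn_integral_cmult tail_mass_nn(1)[OF doubling_profileD(1,2)[OF h]])
    also have "\<dots> \<le> (\<Sum>N. ennreal (K1 * M powr q * A * W N))"
    proof (intro suminf_le summableI)
      fix N
      show "ennreal (U N) * ennreal (tail_mass h (1 / 2 ^ N)) \<le> ennreal (K1 * M powr q * A * W N)"
        using UW[of N] U0[of N] Th[of N] by (simp add: ennreal_mult[symmetric] ennreal_leI)
    qed
    also have "\<dots> = ennreal (K1 * M powr q * A * ((\<Sum>k. \<Theta> k) * (1 / (1 - \<beta>))))"
    proof -
      have W0: "0 \<le> K1 * M powr q * A * W N" for N
        unfolding W_def using K1(1) A \<Theta>(3) \<beta> by (intro mult_nonneg_nonneg sum_nonneg) auto
      have s: "(\<lambda>N. K1 * M powr q * A * W N) sums (K1 * M powr q * A * ((\<Sum>k. \<Theta> k) * (1 / (1 - \<beta>))))" by (rule sums_mult[OF W])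
      show ?thesis using suminf_ennreal2[OF W0 sums_summable[OF s]] sums_unique[OF s] by simp
    qed
    also have "\<dots> \<le> ennreal (K1 * M powr q * A * ((K2 * i) powr (q / p) * (1 / (1 - \<beta>))))"
      using K1(1) A \<beta> by (intro ennreal_leI mult_left_mono mult_right_mono \<Theta>(2)) auto
    also have "2 * ennreal (K1 * M powr q * A * ((K2 * i) powr (q / p) * (1 / (1 - \<beta>)))) = ennreal (K3 * M powr q * i powr (q / p))"
    proof -
      have "(K2 * i) powr (q / p) = K2 powr (q / p) * i powr (q / p)" by (rule powr_mult)
      then have "K3 * M powr q * i powr (q / p) = 2 * (K1 * M powr q * A * ((K2 * i) powr (q / p) * (1 / (1 - \<beta>))))"
        by (simp add: K3_def mult_ac)
      moreover have "ennreal (2 * t) = 2 * ennreal t" if "0 \<le> t" for t using that by (simp add: ennreal_mult)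
      moreover have "0 \<le> K1 * M powr q * A * ((K2 * i) powr (q / p) * (1 / (1 - \<beta>)))" using K1(1) A \<beta> by simp
      ultimately show ?thesis by metis
    qed
    finally show ?thesis by (simp add: i_def mult_left_mono)
  qed
  \<comment> \<open>The q-th root turns M^q into M, so that the bound is linear in M as the
    comparison of norms requires.\<close>
  have "bergman_bound (C_op \<mu> \<omega>) p \<nu> q \<eta> (K3 powr (1 / q) * M)"
    if \<mu>: "\<mu> \<in> M_plus" and M: "0 < M" and tail: "\<forall>y. 0 < y \<longrightarrow> y \<le> 1 \<longrightarrow> measure_tail \<mu> (1 - y) \<le> M * \<Phi> y" for \<mu> M
    unfolding bergman_bound_def
  proof (intro conjI ballI)
    show "0 \<le> K3 powr (1 / q) * M" using M by simp
    fix f assume "f \<in> bergman_space p \<nu>"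
    then have f: "f holomorphic_on ball 0 1" "bergman_integral p \<nu> f < \<infinity>" by (auto simp: bergman_space_def)
    define i where "i = enn2real (bergman_integral p \<nu> f)"
    have b: "bergman_integral q \<eta> (C_op \<mu> \<omega> f) \<le> ennreal (K3 * M powr q * i powr (q / p))"
      unfolding i_def by (rule main[OF \<mu> M tail f])
    then have "bergman_integral q \<eta> (C_op \<mu> \<omega> f) < \<infinity>" using ennreal_less_top le_less_trans by (metis infinity_ennreal_def)
    then show "C_op \<mu> \<omega> f \<in> bergman_space q \<eta>"
      using C_op_holomorphic[OF g \<mu> f(1)] by (simp add: bergman_space_def)
    have "enn2real (bergman_integral q \<eta> (C_op \<mu> \<omega> f)) \<le> K3 * M powr q * i powr (q / p)"
      using b K3 by (intro enn2real_leI) auto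
    then have "bergman_norm q \<eta> (C_op \<mu> \<omega> f) \<le> (K3 * M powr q * i powr (q / p)) powr (1 / q)"
      unfolding bergman_norm_def using pq by (intro powr_mono2) auto
    also have "\<dots> = K3 powr (1 / q) * M * i powr (1 / p)"
      using pq M by (simp add: powr_mult powr_powr)
    finally show "bergman_norm q \<eta> (C_op \<mu> \<omega> f) \<le> K3 powr (1 / q) * M * bergman_norm p \<nu> f"
      by (simp add: bergman_norm_def i_def)
  qed
  then show ?thesis using K3 by (intro exI[of _ "K3 powr (1 / q)"]) auto
qed

text \<open>For the test function at scale y the kernel contributes y \<open>tail_mass g y\<close>,
  the norm of the function contributes (y \<open>tail_mass n y\<close>)^(1/p), and the norm of the
  image puts (y \<open>tail_mass h y\<close>)^(1/q) into the denominator. The powers of y combine to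
  y^(1 + 1/p - 1/q), the origin of the exponent a.\<close>

lemma tail_of_bergman_bound:
  "\<exists>K>0. \<forall>\<mu>\<in>M_plus. \<forall>C. bergman_bound (C_op \<mu> \<omega>) p \<nu> q \<eta> C \<longrightarrow>
    (\<forall>y. 0 < y \<longrightarrow> y \<le> 1 \<longrightarrow> measure_tail \<mu> (1 - y) \<le> K * C * \<Phi> y)"
proof -
  obtain \<gamma> K1 where K1: "K1 > 0" "\<And>y. 0 < y \<Longrightarrow> y \<le> 1 \<Longrightarrow> bergman_integral p \<nu> (test_function \<gamma> y) \<le> ennreal (K1 * y * tail_mass n y)"
    using test_function_norm[OF n pq(1)] by blast
  obtain c1 where c1: "c1 > 0" "\<And>\<mu> y. \<mu> \<in> M_plus \<Longrightarrow> 0 < y \<Longrightarrow> y \<le> 1 \<Longrightarrow>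
     c1 * measure_tail \<mu> (1 - y) / (y * tail_mass g y) \<le> norm (C_op \<mu> \<omega> (test_function \<gamma> y) (of_real (1 - y / 2)))"
    using C_op_test_function_ge[OF g, of \<gamma>] by blast
  have q0: "0 < q" using pq by simp
  obtain c2 where c2: "c2 > 0" "\<And>F y. F holomorphic_on ball 0 1 \<Longrightarrow> 0 < y \<Longrightarrow> y \<le> 1 \<Longrightarrow>
     ennreal (c2 * y * tail_mass h y * norm (F (of_real (1 - y / 2))) powr q) \<le> bergman_integral q \<eta> F"
    using bergman_integral_ge[OF h q0] by blast
  define K where "K = K1 powr (1 / p) / (c1 * c2 powr (1 / q))"
  have "measure_tail \<mu> (1 - y) \<le> K * C * \<Phi> y"
    if \<mu>: "\<mu> \<in> M_plus" and bd: "bergman_bound (C_op \<mu> \<omega>) p \<nu> q \<eta> C" and y: "0 < y" "y \<le> 1" for \<mu> C y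
  proof -
    define f where "f = test_function \<gamma> y"
    define G where "G = tail_mass g y"
    define Y where "Y = tail_mass n y"
    define T where "T = tail_mass h y"
    have pos: "0 < G" "0 < Y" "0 < T"
      using y doubling_profileD(3)[OF g] doubling_profileD(3)[OF n] doubling_profileD(3)[OF h] by (auto simp: G_def Y_def T_def)
    have fI: "bergman_integral p \<nu> f \<le> ennreal (K1 * y * Y)" unfolding f_def Y_def by (rule K1(2)[OF y])
    have hol: "f holomorphic_on ball 0 1" unfolding f_def by (rule test_function_holomorphic[OF y])
    have "bergman_integral p \<nu> f < \<infinity>" using fI ennreal_less_top le_less_trans by (metis infinity_ennreal_def)
    then have fs: "f \<in> bergman_space p \<nu>" using hol by (simp add: bergman_space_def)
    have C: "0 \<le> C" "C_op \<mu> \<omega> f \<in> bergman_space q \<eta>" "bergman_norm q \<eta> (C_op \<mu> \<omega> f) \<le> C * bergman_norm p \<nu> f"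
      using bd fs unfolding bergman_bound_def by auto
    have "enn2real (bergman_integral p \<nu> f) \<le> K1 * y * Y" using fI K1(1) y pos by (intro enn2real_leI) auto
    then have "bergman_norm p \<nu> f \<le> (K1 * y * Y) powr (1 / p)"
      unfolding bergman_norm_def using pq by (intro powr_mono2) auto
    then have up: "bergman_norm q \<eta> (C_op \<mu> \<omega> f) \<le> C * (K1 * y * Y) powr (1 / p)"
      using C(1,3) mult_left_mono[of _ _ C] by (meson order_trans)
    define t where "t = norm (C_op \<mu> \<omega> f (of_real (1 - y / 2)))"
    have t: "c1 * measure_tail \<mu> (1 - y) / (y * G) \<le> t" "0 \<le> t" unfolding t_def f_def G_def using c1(2)[OF \<mu> y] by auto
    have "C_op \<mu> \<omega> f holomorphic_on ball 0 1" "bergman_integral q \<eta> (C_op \<mu> \<omega> f) < \<infinity>" using C(2) by (auto simp: bergman_space_def)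
    then have "c2 * y * T * t powr q \<le> enn2real (bergman_integral q \<eta> (C_op \<mu> \<omega> f))"
      using c2(2)[of "C_op \<mu> \<omega> f" y] y unfolding t_def T_def
      by (metis enn2real_nonneg ennreal_enn2real ennreal_le_iff infinity_ennreal_def)
    then have "(c2 * y * T * t powr q) powr (1 / q) \<le> bergman_norm q \<eta> (C_op \<mu> \<omega> f)"
      unfolding bergman_norm_def using pq c2(1) y pos by (intro powr_mono2) auto
    also have "(c2 * y * T * t powr q) powr (1 / q) = (c2 * y * T) powr (1 / q) * t"
      using t(2) q0 by (simp add: powr_mult powr_powr)
    finally have low: "(c2 * y * T) powr (1 / q) * t \<le> C * (K1 * y * Y) powr (1 / p)" using up by linarith
    have "(c2 * y * T) powr (1 / q) * (c1 * measure_tail \<mu> (1 - y) / (y * G)) \<le> (c2 * y * T) powr (1 / q) * t"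
      by (intro mult_left_mono t) auto
    then have "(c2 * y * T) powr (1 / q) * (c1 * measure_tail \<mu> (1 - y) / (y * G)) \<le> C * (K1 * y * Y) powr (1 / p)" using low by linarith
    then have "measure_tail \<mu> (1 - y) \<le> C * (K1 * y * Y) powr (1 / p) * (y * G) / (c1 * (c2 * y * T) powr (1 / q))"
      using c1(1) c2(1) y pos by (simp add: field_simps)
    also have "\<dots> = K * C * \<Phi> y"
    proof -
      have "y powr a = y * y powr (1 / p) / y powr (1 / q)" using y by (simp add: powr_add powr_diff)
      then show ?thesis
        using y pos c1(1) c2(1) by (simp add: K_def tail_ratio_def G_def Y_def T_def powr_mult field_simps)
    qed
    finally show ?thesis .
  qed
  moreover have "K > 0" using K1(1) c1(1) c2(1) by (simp add: K_def)
  ultimately show ?thesis by blast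
qed

end

section \<open>Assembly of the equivalences\<close>

lemma comparable_onI:
  assumes "K1 > 0" "\<And>x. x \<in> S \<Longrightarrow> A x \<le> ennreal K1 * B x" and "K2 > 0" "\<And>x. x \<in> S \<Longrightarrow> B x \<le> ennreal K2 * A x"
  shows "comparable_on S A B"
proof -
  define c where "c = max K1 K2"
  have c: "0 < c" "K1 \<le> c" "K2 \<le> c" using assms by (auto simp: c_def)
  have "ennreal (1 / c) * B x \<le> A x \<and> A x \<le> ennreal c * B x" if x: "x \<in> S" for x
  proof
    have "ennreal (1 / c) * B x \<le> ennreal (1 / c) * (ennreal c * A x)"
      using assms(4)[OF x] mult_right_mono[OF ennreal_leI[OF c(3)], of "A x"] by (intro mult_left_mono) auto
    also have "\<dots> = ennreal (1 / c * c) * A x" using c by (subst ennreal_mult) (auto simp: mult.assoc)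
    finally show "ennreal (1 / c) * B x \<le> A x" using c by simp
    show "A x \<le> ennreal c * B x"
      using assms(2)[OF x] mult_right_mono[OF ennreal_leI[OF c(2)], of "B x"] by auto
  qed
  then show ?thesis unfolding comparable_on_def using c(1) by blast
qed

theorem theorem21:
  fixes p q :: real and \<omega> \<nu> \<eta> :: "complex \<Rightarrow> real"
  assumes "0 < p" and "p \<le> q" and "1 < q"
    and "\<omega> \<in> D_hat" and "\<nu> \<in> D_both" and "\<eta> \<in> D_both"
  shows "(\<forall>\<mu>\<in>M_plus.
            (bergman_bounded (C_op \<mu> \<omega>) p \<nu> q \<eta> \<longleftrightarrow> mu_L_infty p q \<omega> \<nu> \<eta> \<mu> < \<infinity>) \<and>
            (mu_L_infty p q \<omega> \<nu> \<eta> \<mu> < \<infinity> \<longleftrightarrow> mu_ell_infty p q \<omega> \<nu> \<eta> \<mu> < \<infinity>)) \<and>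
         comparable_on M_plus
           (\<lambda>\<mu>. bergman_op_norm (C_op \<mu> \<omega>) p \<nu> q \<eta>) (mu_L_infty p q \<omega> \<nu> \<eta>) \<and>
         comparable_on M_plus (mu_L_infty p q \<omega> \<nu> \<eta>) (mu_ell_infty p q \<omega> \<nu> \<eta>)"
proof -
  obtain g where g: "doubling_profile \<omega> g" using D_hat_profile assms(4) by blast
  obtain n where n: "doubling_profile \<nu> n" using D_hat_profile assms(5) by (auto simp: D_both_def)
  obtain h where h: "doubling_profile \<eta> h" using D_hat_profile assms(6) by (auto simp: D_both_def)
  have rn: "reverse_doubling n" using D_check_reverse_doubling[OF _ n] assms(5) by (auto simp: D_both_def)
  have rh: "reverse_doubling h" using D_check_reverse_doubling[OF _ h] assms(6) by (auto simp: D_both_def)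
  interpret exponents_and_profiles p q \<omega> \<nu> \<eta> g n h
    by unfold_locales (use assms g n h in auto)
  let ?L = "mu_L_infty p q \<omega> \<nu> \<eta>" and ?l = "mu_ell_infty p q \<omega> \<nu> \<eta>"
    and ?N = "\<lambda>\<mu>. bergman_op_norm (C_op \<mu> \<omega>) p \<nu> q \<eta>"
  obtain K1 where K1: "K1 > 0" "\<And>\<mu>. \<mu> \<in> M_plus \<Longrightarrow> ?L \<mu> \<le> ennreal K1 * ?l \<mu>" using L_infty_le_ell_infty by blast
  obtain K2 where K2: "K2 > 0" "\<And>\<mu>. \<mu> \<in> M_plus \<Longrightarrow> ?l \<mu> \<le> ennreal K2 * ?L \<mu>" using ell_infty_le_L_infty by blast
  obtain K3 where K3: "K3 > 0" "\<And>\<mu> M. \<mu> \<in> M_plus \<Longrightarrow> M > 0 \<Longrightarrow>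
      (\<forall>y. 0 < y \<longrightarrow> y \<le> 1 \<longrightarrow> measure_tail \<mu> (1 - y) \<le> M * \<Phi> y) \<Longrightarrow> bergman_bound (C_op \<mu> \<omega>) p \<nu> q \<eta> (K3 * M)"
    using bergman_bound_of_tail[OF rn rh] by blast
  obtain K4 where K4: "K4 > 0" "\<And>\<mu> C. \<mu> \<in> M_plus \<Longrightarrow> bergman_bound (C_op \<mu> \<omega>) p \<nu> q \<eta> C \<Longrightarrow>
      (\<forall>y. 0 < y \<longrightarrow> y \<le> 1 \<longrightarrow> measure_tail \<mu> (1 - y) \<le> K4 * C * \<Phi> y)"
    using tail_of_bergman_bound by blast
  have bound: "bergman_bound (C_op \<mu> \<omega>) p \<nu> q \<eta> (K3 * M)" if "\<mu> \<in> M_plus" "M > 0" "?L \<mu> \<le> ennreal M" for \<mu> M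
    using that by (intro K3(2)) (auto simp: mu_L_infty_le_iff)
  have L_le: "?L \<mu> \<le> ennreal (K4 * C)" if "\<mu> \<in> M_plus" "bergman_bound (C_op \<mu> \<omega>) p \<nu> q \<eta> C" for \<mu> C
  proof -
    have "0 \<le> K4 * C" using that(2) K4(1) by (simp add: bergman_bound_def)
    then show ?thesis using K4(2)[OF that] by (simp add: mu_L_infty_le_iff)
  qed
  have N1: "?N \<mu> \<le> ennreal K3 * ?L \<mu>" if \<mu>: "\<mu> \<in> M_plus" for \<mu>
  proof (rule ennreal_le_mult_if[OF K3(1)])
    fix M :: real assume "0 < M" "?L \<mu> \<le> ennreal M"
    then show "?N \<mu> \<le> ennreal (K3 * M)"
      unfolding bergman_op_norm_def using bound[OF \<mu>] by (intro INF_lower) auto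
  qed
  have N2: "?L \<mu> \<le> ennreal K4 * ?N \<mu>" if \<mu>: "\<mu> \<in> M_plus" for \<mu>
  proof -
    \<comment> \<open>With K4 on the left each admissible C is tested by itself; if there is none,
      the infimum is \<infinity> and nothing has to be shown.\<close>
    have "ennreal (1 / K4) * ?L \<mu> \<le> ?N \<mu>"
      unfolding bergman_op_norm_def
    proof (rule INF_greatest)
      fix C assume "C \<in> {C. bergman_bound (C_op \<mu> \<omega>) p \<nu> q \<eta> C}"
      then have C: "bergman_bound (C_op \<mu> \<omega>) p \<nu> q \<eta> C" "0 \<le> C" by (auto simp: bergman_bound_def)
      have "ennreal (1 / K4) * ?L \<mu> \<le> ennreal (1 / K4) * ennreal (K4 * C)" by (intro mult_left_mono L_le[OF \<mu> C(1)]) simp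
      also have "\<dots> = ennreal C" using K4(1) C(2) by (simp add: ennreal_mult[symmetric])
      finally show "ennreal (1 / K4) * ?L \<mu> \<le> ennreal C" .
    qed
    then have "ennreal K4 * (ennreal (1 / K4) * ?L \<mu>) \<le> ennreal K4 * ?N \<mu>" by (rule mult_left_mono) simp
    moreover have "ennreal K4 * (ennreal (1 / K4) * ?L \<mu>) = ?L \<mu>"
      using K4(1) by (simp add: mult.assoc[symmetric] ennreal_mult[symmetric])
    ultimately show ?thesis by simp
  qed
  have iff1: "bergman_bounded (C_op \<mu> \<omega>) p \<nu> q \<eta> \<longleftrightarrow> ?L \<mu> < \<infinity>" if \<mu>: "\<mu> \<in> M_plus" for \<mu>
  proof
    assume "bergman_bounded (C_op \<mu> \<omega>) p \<nu> q \<eta>"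
    then obtain C where "bergman_bound (C_op \<mu> \<omega>) p \<nu> q \<eta> C" by (auto simp: bergman_bounded_def)
    from L_le[OF \<mu> this] show "?L \<mu> < \<infinity>" using ennreal_less_top le_less_trans by (metis infinity_ennreal_def)
  next
    assume "?L \<mu> < \<infinity>"
    then obtain l where l: "?L \<mu> = ennreal l" "0 \<le> l" by (cases "?L \<mu>") auto
    \<comment> \<open>\<open>bound\<close> asks for a positive constant, hence l + 1, since l may be
      0.\<close>
    then have "?L \<mu> \<le> ennreal (l + 1)" by (simp add: ennreal_leI)
    with l(2) bound[OF \<mu>, of "l + 1"] show "bergman_bounded (C_op \<mu> \<omega>) p \<nu> q \<eta>" unfolding bergman_bounded_def by auto
  qed
  have iff2: "?L \<mu> < \<infinity> \<longleftrightarrow> ?l \<mu> < \<infinity>" if \<mu>: "\<mu> \<in> M_plus" for \<mu>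
    using K1(2)[OF \<mu>] K2(2)[OF \<mu>] by (auto simp: ennreal_mult_less_top intro: le_less_trans)
  show ?thesis
    using iff1 iff2 comparable_onI[of K3 M_plus ?N ?L K4] comparable_onI[of K1 M_plus ?L ?l K2] N1 N2 K1 K2 K3(1) K4(1) by blast
qed

end
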